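(* Let $U\in C^4([-1,1])$ satisfy: $U(\pm1)=0$, $\max_{x\in[-1,1]}U''(x)<0$, $U(-x)=U(x)$ for all $x$, and $U'(\pm1)=\mp1$. Then there exist positive constants $\alpha_L$, $C$, $\Upsilon$ and $\beta_0>1$ such that for all $\beta>\beta_0$, $$\sup_{\substack{0\le\alpha\le\alpha_L\beta^{-1/6}\\ \operatorname{Re}\lambda<\Upsilon\beta^{-1/2}}}\Big(\big\|(\mathcal B^{\mathfrak D,sym}_{\lambda,\alpha,\beta})^{-1}\big\|+\Big\|\frac{d}{dx}(\mathcal B^{\mathfrak D,sym}_{\lambda,\alpha,\beta})^{-1}\Big\|\Big)\le C\beta^{-1/2}\log\beta .$$ (In particular $\mathcal B^{\mathfrak D,sym}_{\lambda,\alpha,\beta}$ is invertible for all such $\lambda,\alpha$.)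
   Context: For $\beta>0$, $\alpha\ge0$, $\lambda\in\mathbb C$, let $\mathcal L_\beta=-\frac{d^2}{dx^2}+i\beta U$ and let $\mathcal B^{\mathfrak D}_{\lambda,\alpha,\beta}=(\mathcal L_\beta-\beta\lambda)\big(\frac{d^2}{dx^2}-\alpha^2\big)-i\beta U''$ (equivalently $\big(-\frac{d^2}{dx^2}+i\beta(U+i\lambda)\big)\big(\frac{d^2}{dx^2}-\alpha^2\big)-i\beta U''$), with domain $\{u\in H^4(-1,1): u(\pm1)=u'(\pm1)=0\}$. $\mathcal B^{\mathfrak D,sym}_{\lambda,\alpha,\beta}$ denotes its restriction to even functions (those with $u(-x)=u(x)$), viewed as an operator on the even subspace of $L^2(-1,1)$; equivalently it is the operator on $L^2(0,1)$ given by the same differential expression with domain $\{u\in H^4(0,1): u'(0)=u'''(0)=0,\ u(1)=u'(1)=0\}$. Norms are operator norms on $L^2$. *)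

theory Defs
  imports "HOL-Analysis.Analysis"
begin

definition L2_01 :: "(real \<Rightarrow> complex) \<Rightarrow> bool" where
  "L2_01 f \<longleftrightarrow> set_borel_measurable lborel {0..1} f \<and>
     set_integrable lborel {0..1} (\<lambda>x. (cmod (f x))^2)"

definition L2norm_01 :: "(real \<Rightarrow> complex) \<Rightarrow> real" where
  "L2norm_01 f = sqrt (LBINT x:{0..1}. (cmod (f x))^2)"

text \<open>Graph of the operator B^{D,sym}_{lambda,alpha,beta} on L^2(0,1):
  u is in H^4(0,1) (u,u',u'' differentiable on [0,1], u''' absolutely continuous with
  L^2 derivative u''''), u'(0)=u'''(0)=0, u(1)=u'(1)=0, u1 = u', and
  f = (-d^2/dx^2 + i beta (U + i lambda))(u'' - alpha^2 u) - i beta U'' u  a.e. on (0,1),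
  i.e. f = -u'''' + alpha^2 u'' + i beta (U + i lambda)(u'' - alpha^2 u) - i beta U'' u.\<close>
definition Bsym_graph ::
  "(real \<Rightarrow> real) \<Rightarrow> (real \<Rightarrow> real) \<Rightarrow> complex \<Rightarrow> real \<Rightarrow> real \<Rightarrow>
   (real \<Rightarrow> complex) \<Rightarrow> (real \<Rightarrow> complex) \<Rightarrow> (real \<Rightarrow> complex) \<Rightarrow> bool" where
  "Bsym_graph U U2 lam alpha beta u u1 f \<longleftrightarrow>
     (\<exists>u2 u3 u4.
        (\<forall>x\<in>{0..1}. (u has_vector_derivative u1 x) (at x within {0..1}) \<and>
                     (u1 has_vector_derivative u2 x) (at x within {0..1}) \<and>
                     (u2 has_vector_derivative u3 x) (at x within {0..1}) \<and>
                     u3 x = u3 0 + (LBINT t:{0..x}. u4 t)) \<and>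
        L2_01 u4 \<and>
        u1 0 = 0 \<and> u3 0 = 0 \<and> u 1 = 0 \<and> u1 1 = 0 \<and>
        (AE x in lborel. x \<in> {0..1} \<longrightarrow>
           f x = - u4 x + complex_of_real (alpha^2) * u2 x
                 + \<i> * complex_of_real beta * (complex_of_real (U x) + \<i> * lam)
                     * (u2 x - complex_of_real (alpha^2) * u x)
                 - \<i> * complex_of_real beta * complex_of_real (U2 x) * u x))"

definition Bsym_invertible ::
  "(real \<Rightarrow> real) \<Rightarrow> (real \<Rightarrow> real) \<Rightarrow> complex \<Rightarrow> real \<Rightarrow> real \<Rightarrow> bool" where
  "Bsym_invertible U U2 lam alpha beta \<longleftrightarrow>
     (\<forall>f. L2_01 f \<longrightarrow> (\<exists>u u1. Bsym_graph U U2 lam alpha beta u u1 f)) \<and>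
     (\<forall>u u1. Bsym_graph U U2 lam alpha beta u u1 (\<lambda>_. 0) \<longrightarrow> (\<forall>x\<in>{0..1}. u x = 0))"

definition Bsym_inv_norm ::
  "(real \<Rightarrow> real) \<Rightarrow> (real \<Rightarrow> real) \<Rightarrow> complex \<Rightarrow> real \<Rightarrow> real \<Rightarrow> ereal" where
  "Bsym_inv_norm U U2 lam alpha beta =
     Sup {ereal (L2norm_01 u / L2norm_01 f) | u u1 f.
            Bsym_graph U U2 lam alpha beta u u1 f \<and> L2_01 f \<and> L2norm_01 f \<noteq> 0}"

definition Bsym_dinv_norm ::
  "(real \<Rightarrow> real) \<Rightarrow> (real \<Rightarrow> real) \<Rightarrow> complex \<Rightarrow> real \<Rightarrow> real \<Rightarrow> ereal" where
  "Bsym_dinv_norm U U2 lam alpha beta =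
     Sup {ereal (L2norm_01 u1 / L2norm_01 f) | u u1 f.
            Bsym_graph U U2 lam alpha beta u u1 f \<and> L2_01 f \<and> L2norm_01 f \<noteq> 0}"

end

theory Submission
  imports Defs
begin

text \<open>
  Write \<open>\<lambda> = \<mu> + i\<nu>\<close>, \<open>V = U - \<nu> + i\<mu>\<close> and \<open>\<phi> = u'' - \<alpha>\<^sup>2 u\<close>. Testing the equation with
  \<open>\<phi>* / \<bar>U''\<bar>\<close> (\<open>*\<close> is complex conjugation) controls \<open>\<phi>'\<close> by \<open>\<phi>\<close>, since the non-local term \<open>U'' u\<close>
  then contributes nothing to the real part; no boundary condition on \<open>\<phi>\<close> is needed because the
  equation integrated over \<open>(0, x)\<close>,
  \<open>\<phi>' + F = i\<beta> (V u' - U' u - \<alpha>\<^sup>2 \<integral>\<^sub>0\<^sup>x V u)\<close> with \<open>F = \<integral>\<^sub>0\<^sup>x f\<close>, bounds \<open>\<phi>'(1)\<close>.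

  If \<open>\<lambda>\<close> is far from \<open>i U([0,1])\<close>, the same pairing also controls \<open>\<phi>\<close>. Otherwise let \<open>x\<^sub>c\<close> be the point
  where \<open>\<bar>U - \<nu>\<bar>\<close> is smallest, let \<open>\<kappa>\<close> be the largest of \<open>x\<^sub>c\<close>, \<open>\<beta>\<^sup>-\<^sup>1\<^sup>/\<^sup>4\<close> and the root of the distance, let
  \<open>L = (\<beta>\<kappa>)\<^sup>-\<^sup>1\<^sup>/\<^sup>3\<close> be the width of the critical layer, and shift \<open>V\<close> to \<open>V\<^sub>* = V - i\<kappa>L\<close>, which does not vanish.
  As \<open>V u' - U' u = V\<^sup>2 (u/V)'\<close>, the integrated equation bounds \<open>w = u/V\<^sub>*\<close>, and testing with \<open>\<phi>*/V\<^sub>*\<close>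
  then bounds \<open>\<phi>\<close>. The two tests close up when \<open>\<alpha>\<^sup>2/L\<close> and \<open>\<beta>\<mu>\<^sub>+ L\<^sup>2\<close> are small and give
  \<open>\<beta> \<parallel>u'\<parallel>\<^sup>2 \<le> K \<parallel>f\<parallel>\<^sup>2\<close>. This estimate yields
  injectivity; solutions for a given \<open>f\<close> are obtained by shooting from \<open>x = 0\<close>, with \<open>u(0)\<close> and \<open>u''(0)\<close>
  as parameters.
\<close>

section \<open>Integral inequalities\<close>

text \<open>Two obstacles shape the argument: the conditions at 1 are on \<open>u\<close>,
  \<open>u'\<close> and not on \<phi>, and \<open>V\<close> may nearly vanish anywhere in [0,1],
  including 0, where \<open>U'\<close> vanishes too. The pair \<kappa>, \<open>L\<close> treats all
  positions at once: at distance r from \<open>xc\<close> the shifted \<open>V\<close> is bounded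
  below by a multiple of (\<kappa> + r)(L + r), and \<open>\<beta> * \<kappa> * L ^ 3 = 1\<close>
  balances \<phi>'', of size \<phi>/L^2, against \<beta> V \<phi>, of size \<beta> \<kappa> L
  \<phi>. The floor \<beta>^(-1/4) is the value at which \<kappa> = L. The shift has negative
  imaginary part because Re \<lambda> is bounded above only: a very negative Re \<lambda> moves the
  shifted \<open>V\<close> further from 0.

  The exponents of the theorem are the extremes of \<kappa>. As \<kappa> is bounded, L is at least a
  multiple of \<beta>^(-1/3), so \<alpha> of order \<beta>^(-1/6) keeps \<alpha>^2/L small; as
  \<kappa> is at least \<beta>^(-1/4), so L at most \<beta>^(-1/4), \<mu> of order \<beta>^(-1/2)
  keeps \<beta> \<mu> L^2 small.

  In the layer case the norm of \<phi> is O(L^(3/2) \<Phi>) and |u| is O(\<kappa> L^2 \<Phi>).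
  Pairing \<open>u\<close> with \<open>u''\<close> gives O(\<beta> \<kappa> L^(7/2) \<Phi>^2) =
  O(L^(1/2) \<Phi>^2) for \<beta> times the squared norm of \<open>u'\<close>.\<close>

definition nrm :: "(real \<Rightarrow> complex) \<Rightarrow> real" where
  "nrm f = sqrt (integral {0..1} (\<lambda>x. (cmod (f x))\<^sup>2))"

lemma integral_complex_of_real_continuous:
  fixes g :: "real \<Rightarrow> real"
  assumes "continuous_on {a..b} g"
  shows "integral {a..b} (\<lambda>x. complex_of_real (g x)) = of_real (integral {a..b} g)"
  using integral_linear[OF integrable_continuous_interval[OF assms] bounded_linear_of_real]
  by (simp add: o_def)

text \<open>The optimal parameter is \<open>t = sqrt b / sqrt a\<close>; if \<open>a\<close> or
  \<open>b\<close> vanishes, very large or very small \<open>t\<close> force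
  \<open>c \<le> 0\<close>. Being about numbers, this yields Cauchy-Schwarz for the gauge integral
  and for the Lebesgue integral alike.\<close>

lemma le_sqrt_mult_if_young:
  fixes a b c :: real
  assumes "0 \<le> a" "0 \<le> b" and young: "\<And>t. t > 0 \<Longrightarrow> 2 * c \<le> t * a + b / t"
  shows "c \<le> sqrt a * sqrt b"
proof (cases "a = 0 \<or> b = 0")
  case True
  have "c \<le> 0"
  proof (rule ccontr)
    assume "\<not> c \<le> 0"
    then have c: "c > 0" by simp
    show False
    proof (cases "a = 0")
      case True
      have "2 * c \<le> b / ((b + 1) / c)"
        using young[of "(b + 1) / c"] True assms c by auto
      also have "\<dots> = c * (b / (b + 1))" by simp
      also have "\<dots> \<le> c * 1" using assms c by (intro mult_left_mono) auto
      finally show False using c by simp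
    next
      case False
      then have "b = 0" using \<open>a = 0 \<or> b = 0\<close> by simp
      then have "2 * c \<le> (c / a) * a" using young[of "c / a"] False assms c by auto
      then show False using c False by simp
    qed
  qed
  then show ?thesis using True assms by auto
next
  case False
  then have ab: "a > 0" "b > 0" using assms by auto
  define t where "t = sqrt b / sqrt a"
  have t: "t > 0" using ab by (simp add: t_def)
  have 1: "t * a = sqrt a * sqrt b"
    unfolding t_def using ab real_div_sqrt[of a] by (metis less_imp_le mult.commute times_divide_eq_left times_divide_eq_right)
  have 2: "b / t = sqrt a * sqrt b"
    unfolding t_def using ab real_div_sqrt[of b] by (metis divide_divide_eq_right less_imp_le mult.commute times_divide_eq_left)
  show ?thesis using young[OF t] 1 2 by simp
qed

lemma integral_mult_le_sqrt:
  fixes f g :: "real \<Rightarrow> real"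
  assumes f: "continuous_on {a..b} f" and g: "continuous_on {a..b} g"
  shows "integral {a..b} (\<lambda>x. f x * g x)
    \<le> sqrt (integral {a..b} (\<lambda>x. (f x)\<^sup>2)) * sqrt (integral {a..b} (\<lambda>x. (g x)\<^sup>2))"
proof (rule le_sqrt_mult_if_young)
  fix t :: real assume t: "t > 0"
  have pw: "2 * (f x * g x) \<le> t * (f x)\<^sup>2 + (g x)\<^sup>2 / t" for x
  proof -
    have "0 \<le> (t * f x - g x)\<^sup>2 / t" using t by simp
    also have "\<dots> = t * (f x)\<^sup>2 + (g x)\<^sup>2 / t - 2 * (f x * g x)"
      using t by (simp add: power2_eq_square field_simps)
    finally show ?thesis by simp
  qed
  have "2 * integral {a..b} (\<lambda>x. f x * g x) = integral {a..b} (\<lambda>x. 2 * (f x * g x))" by simp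
  also have "\<dots> \<le> integral {a..b} (\<lambda>x. t * (f x)\<^sup>2 + (g x)\<^sup>2 / t)"
    by (intro integral_le integrable_continuous_interval continuous_intros f g pw) (use t in auto)
  also have "\<dots> = t * integral {a..b} (\<lambda>x. (f x)\<^sup>2) + integral {a..b} (\<lambda>x. (g x)\<^sup>2) / t"
    using t by (subst integral_add) (auto intro!: integrable_continuous_interval continuous_intros f g)
  finally show "2 * integral {a..b} (\<lambda>x. f x * g x)
    \<le> t * integral {a..b} (\<lambda>x. (f x)\<^sup>2) + integral {a..b} (\<lambda>x. (g x)\<^sup>2) / t" .
qed (auto intro!: integral_nonneg integrable_continuous_interval continuous_intros f g)

lemma nrm_nonneg: "0 \<le> nrm f"
  by (simp add: nrm_def) (cases "(\<lambda>x. (cmod (f x))\<^sup>2) integrable_on {0..1}";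
    auto intro: integral_nonneg simp: not_integrable_integral)

lemma nrm_square:
  assumes "continuous_on {0..1} f"
  shows "(nrm f)\<^sup>2 = integral {0..1} (\<lambda>x. (cmod (f x))\<^sup>2)"
  unfolding nrm_def
  by (rule real_sqrt_pow2, rule integral_nonneg)
     (auto intro!: integrable_continuous_interval continuous_intros assms)

lemma integral_cmod_mult_le:
  assumes f: "continuous_on {0..1} f" and g: "continuous_on {0..1} g"
  shows "integral {0..1} (\<lambda>x. cmod (f x) * cmod (g x)) \<le> nrm f * nrm g"
  unfolding nrm_def by (rule integral_mult_le_sqrt; intro continuous_intros f g)

lemma integral_subinterval_le:
  fixes h :: "real \<Rightarrow> real"
  assumes "continuous_on {0..1} h" "\<And>x. x \<in> {0..1} \<Longrightarrow> 0 \<le> h x" "0 \<le> a" "b \<le> 1"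
  shows "integral {a..b} h \<le> integral {0..1} h"
  by (rule integral_subset_le)
     (use assms in \<open>auto intro!: integrable_continuous_interval intro: continuous_on_subset\<close>)

lemma nrm_le_if_le:
  assumes f: "continuous_on {0..1} f" and c: "\<And>x. x \<in> {0..1} \<Longrightarrow> cmod (f x) \<le> c"
  shows "nrm f \<le> c"
proof -
  have c0: "0 \<le> c" using order_trans[OF norm_ge_zero c[of 0]] by simp
  have "integral {0..1} (\<lambda>x. (cmod (f x))\<^sup>2) \<le> integral {0..1::real} (\<lambda>x. c\<^sup>2)"
    by (intro integral_le integrable_continuous_interval continuous_intros f power_mono c) auto
  then have "nrm f \<le> sqrt (c\<^sup>2)" unfolding nrm_def by (intro real_sqrt_le_mono) simp
  then show ?thesis using c0 by simp
qed

lemma nrm_mult_le: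
  assumes f: "continuous_on {0..1} f" and h: "continuous_on {0..1} h"
    and c: "\<And>x. x \<in> {0..1} \<Longrightarrow> cmod (h x) \<le> c * cmod (f x)" and "0 \<le> c"
  shows "nrm h \<le> c * nrm f"
proof -
  have "integral {0..1} (\<lambda>x. (cmod (h x))\<^sup>2) \<le> integral {0..1} (\<lambda>x. c\<^sup>2 * (cmod (f x))\<^sup>2)"
    by (intro integral_le integrable_continuous_interval continuous_intros f h)
       (use c in \<open>auto simp flip: power_mult_distrib intro!: power_mono\<close>)
  then have "nrm h \<le> sqrt (c\<^sup>2 * integral {0..1} (\<lambda>x. (cmod (f x))\<^sup>2))"
    unfolding nrm_def by (intro real_sqrt_le_mono) simp
  then show ?thesis using \<open>0 \<le> c\<close> by (simp add: real_sqrt_mult nrm_def)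
qed

lemma nrm_add_le:
  assumes f: "continuous_on {0..1} f" and g: "continuous_on {0..1} g"
  shows "nrm (\<lambda>x. f x + g x) \<le> nrm f + nrm g"
proof (rule power2_le_imp_le)
  have "(nrm (\<lambda>x. f x + g x))\<^sup>2 = integral {0..1} (\<lambda>x. (cmod (f x + g x))\<^sup>2)"
    by (intro nrm_square continuous_intros f g)
  also have "\<dots> \<le> integral {0..1} (\<lambda>x. ((cmod (f x))\<^sup>2 + (cmod (g x))\<^sup>2) + 2 * (cmod (f x) * cmod (g x)))"
  proof (intro integral_le integrable_continuous_interval continuous_intros f g)
    fix x
    have "(cmod (f x + g x))\<^sup>2 \<le> (cmod (f x) + cmod (g x))\<^sup>2"
      by (intro power_mono norm_triangle_ineq) auto
    then show "(cmod (f x + g x))\<^sup>2 \<le> ((cmod (f x))\<^sup>2 + (cmod (g x))\<^sup>2) + 2 * (cmod (f x) * cmod (g x))"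
      by (simp add: power2_sum)
  qed
  also have "\<dots> = ((nrm f)\<^sup>2 + (nrm g)\<^sup>2) + 2 * integral {0..1} (\<lambda>x. cmod (f x) * cmod (g x))"
    by (simp add: integral_add nrm_square f g integrable_continuous_interval continuous_intros)
  also have "\<dots> \<le> ((nrm f)\<^sup>2 + (nrm g)\<^sup>2) + 2 * (nrm f * nrm g)"
    using integral_cmod_mult_le[OF f g] by simp
  also have "\<dots> = (nrm f + nrm g)\<^sup>2" by (simp add: power2_sum)
  finally show "(nrm (\<lambda>x. f x + g x))\<^sup>2 \<le> (nrm f + nrm g)\<^sup>2" .
qed (simp add: nrm_nonneg)

lemma exists_le_average:
  fixes h :: "real \<Rightarrow> real"
  assumes "a < b" and h: "continuous_on {a..b} h"
  obtains y where "y \<in> {a..b}" "h y * (b - a) \<le> integral {a..b} h"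
proof -
  obtain y where y: "y \<in> {a..b}" "\<And>x. x \<in> {a..b} \<Longrightarrow> h y \<le> h x"
    using continuous_attains_inf[OF _ _ h] \<open>a < b\<close> by auto
  have "integral {a..b} (\<lambda>_. h y) \<le> integral {a..b} h"
    by (intro integral_le integrable_continuous_interval continuous_intros h y)
  then show ?thesis using that y \<open>a < b\<close> by (simp add: mult.commute)
qed

lemma vector_derivative_continuous_on:
  assumes "\<And>x. x \<in> S \<Longrightarrow> (f has_vector_derivative f' x) (at x within S)"
  shows "continuous_on S f"
  using assms continuous_on_eq_continuous_within has_vector_derivative_continuous by blast

lemma has_vector_derivative_quotient:
  fixes f g :: "real \<Rightarrow> complex"
  assumes "(f has_vector_derivative f') (at x within S)" "(g has_vector_derivative g') (at x within S)" "g x \<noteq> 0"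
  shows "((\<lambda>x. f x / g x) has_vector_derivative (f' * g x - f x * g') / (g x)\<^sup>2) (at x within S)"
  using has_derivative_divide'[OF assms(1,2)[unfolded has_vector_derivative_def] assms(3)]
  unfolding has_vector_derivative_def
  by (rule has_derivative_eq_rhs) (simp add: fun_eq_iff power2_eq_square scaleR_conv_of_real field_simps)

lemma norm_diff_le_integral:
  fixes f :: "real \<Rightarrow> complex"
  assumes "a \<le> b"
    and d: "\<And>x. x \<in> {a..b} \<Longrightarrow> (f has_vector_derivative f' x) (at x within {a..b})"
    and c: "continuous_on {a..b} f'"
  shows "cmod (f b - f a) \<le> integral {a..b} (\<lambda>x. cmod (f' x))"
proof -
  have "f b - f a = integral {a..b} f'"
    using fundamental_theorem_of_calculus[OF \<open>a \<le> b\<close> d] by (simp add: integral_unique)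
  also have "cmod \<dots> \<le> integral {a..b} (\<lambda>x. cmod (f' x))"
    by (rule continuous_on_imp_absolutely_integrable_on[OF c])
  finally show ?thesis .
qed

lemma norm_diff_le_integral_01:
  fixes f :: "real \<Rightarrow> complex"
  assumes d: "\<And>x. x \<in> {0..1} \<Longrightarrow> (f has_vector_derivative f' x) (at x within {0..1})"
    and c: "continuous_on {0..1} f'" and "0 \<le> a" "a \<le> b" "b \<le> 1"
  shows "cmod (f b - f a) \<le> integral {a..b} (\<lambda>x. cmod (f' x))"
  by (rule norm_diff_le_integral[OF \<open>a \<le> b\<close>])
     (use assms in \<open>auto intro: has_vector_derivative_within_subset[OF d] continuous_on_subset[OF c]\<close>)

lemma norm_diff_le_nrm:
  fixes f :: "real \<Rightarrow> complex"
  assumes d: "\<And>x. x \<in> {0..1} \<Longrightarrow> (f has_vector_derivative f' x) (at x within {0..1})"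
    and c: "continuous_on {0..1} f'" and ab: "a \<in> {0..1}" "b \<in> {0..1}"
  shows "cmod (f b - f a) \<le> sqrt \<bar>b - a\<bar> * nrm f'"
proof -
  have main: "cmod (f b - f a) \<le> sqrt \<bar>b - a\<bar> * nrm f'" if "0 \<le> a" "a \<le> b" "b \<le> 1" for a b
  proof -
    have c': "continuous_on {a..b} f'" by (rule continuous_on_subset[OF c]) (use that in auto)
    have "cmod (f b - f a) \<le> integral {a..b} (\<lambda>x. 1 * cmod (f' x))"
      using norm_diff_le_integral_01[OF d c that] by simp
    also have "\<dots> \<le> sqrt (integral {a..b} (\<lambda>x. 1\<^sup>2)) * sqrt (integral {a..b} (\<lambda>x. (cmod (f' x))\<^sup>2))"
      by (rule integral_mult_le_sqrt) (intro continuous_intros c')+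
    also have "\<dots> \<le> sqrt \<bar>b - a\<bar> * nrm f'"
      unfolding nrm_def
      by (intro mult_mono real_sqrt_le_mono integral_subinterval_le)
         (use that in \<open>auto intro!: continuous_intros c integral_nonneg integrable_continuous_interval c'\<close>)
    finally show ?thesis .
  qed
  show ?thesis
  proof (cases "a \<le> b")
    case True then show ?thesis using main ab by auto
  next
    case False then show ?thesis using main[of b a] ab by (auto simp: norm_minus_commute abs_minus_commute)
  qed
qed

text \<open>An Agmon inequality without boundary conditions: integrate the derivative of |f|^2 from
  a point where |f|^2 is at most its mean. The mean accounts for the term
  \<open>(nrm f)\<^sup>2\<close>.\<close>

lemma cmod_square_le:
  fixes f :: "real \<Rightarrow> complex"
  assumes d: "\<And>x. x \<in> {0..1} \<Longrightarrow> (f has_vector_derivative f' x) (at x within {0..1})"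
    and c: "continuous_on {0..1} f'" and x: "x \<in> {0..1}"
  shows "(cmod (f x))\<^sup>2 \<le> 2 * nrm f * nrm f' + (nrm f)\<^sup>2"
proof -
  have cf: "continuous_on {0..1} f" by (rule vector_derivative_continuous_on[OF d])
  obtain y where y: "y \<in> {0..1}" and "(cmod (f y))\<^sup>2 * (1 - 0) \<le> integral {0..1} (\<lambda>x. (cmod (f x))\<^sup>2)"
    by (rule exists_le_average[of 0 1 "\<lambda>x. (cmod (f x))\<^sup>2"]) (auto intro!: continuous_intros cf)
  then have y2: "(cmod (f y))\<^sup>2 \<le> (nrm f)\<^sup>2" by (simp add: nrm_square[OF cf])
  define s where "s = (\<lambda>x. f x * cnj (f x))"
  define s' where "s' = (\<lambda>x. f x * cnj (f' x) + f' x * cnj (f x))"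
  have ds: "(s has_vector_derivative s' x) (at x within {0..1})" if "x \<in> {0..1}" for x
    unfolding s_def s'_def
    by (intro has_vector_derivative_mult has_vector_derivative_cnj d that)
  have cs: "continuous_on {0..1} s'" unfolding s'_def by (intro continuous_intros c cf)
  have gen: "cmod (s b - s a) \<le> 2 * nrm f * nrm f'" if "0 \<le> a" "a \<le> b" "b \<le> 1" for a b
  proof -
    have "cmod (s b - s a) \<le> integral {a..b} (\<lambda>x. cmod (s' x))"
      by (rule norm_diff_le_integral_01[OF ds cs that])
    also have "\<dots> \<le> integral {0..1} (\<lambda>x. cmod (s' x))"
      by (rule integral_subinterval_le) (use that in \<open>auto intro!: continuous_intros cs\<close>)
    also have "\<dots> \<le> integral {0..1} (\<lambda>x. 2 * (cmod (f x) * cmod (f' x)))"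
    proof (intro integral_le integrable_continuous_interval continuous_intros cs c cf)
      fix x show "cmod (s' x) \<le> 2 * (cmod (f x) * cmod (f' x))"
        unfolding s'_def by (rule norm_triangle_le) (simp add: norm_mult)
    qed
    also have "\<dots> = 2 * integral {0..1} (\<lambda>x. cmod (f x) * cmod (f' x))" by simp
    also have "\<dots> \<le> 2 * (nrm f * nrm f')" using integral_cmod_mult_le[OF cf c] by simp
    finally show ?thesis by simp
  qed
  have "cmod (s x - s y) \<le> 2 * nrm f * nrm f'"
    using gen[of x y] gen[of y x] x y by (cases "x \<le> y") (auto simp: norm_minus_commute)
  moreover have "cmod (s x) \<le> cmod (s y) + cmod (s x - s y)"
    using norm_triangle_sub by blast
  moreover have "cmod (s z) = (cmod (f z))\<^sup>2" for z
    by (simp add: s_def norm_mult power2_eq_square)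
  ultimately show ?thesis using y2 by simp
qed

text \<open>All kernels centred at a critical point have this form; an antiderivative \<Psi> of
  \<rho> evaluates them on either side of \<open>x0\<close>. A bound \<open>B\<close> valid for
  every argument makes the result independent of the position of \<open>x0\<close>.\<close>

lemma integral_abs_shift_le:
  fixes \<rho> \<Psi> :: "real \<Rightarrow> real"
  assumes d: "\<And>y. 0 \<le> y \<Longrightarrow> (\<Psi> has_real_derivative \<rho> y) (at y)"
    and c: "continuous_on {0..} \<rho>"
    and b: "\<And>y. 0 \<le> y \<Longrightarrow> \<Psi> y \<le> B" and x0: "x0 \<in> {0..1}"
  shows "integral {0..1} (\<lambda>x. \<rho> \<bar>x - x0\<bar>) \<le> 2 * (B - \<Psi> 0)"
proof -
  have 1: "((\<lambda>x. \<rho> \<bar>x - x0\<bar>) has_integral (- \<Psi> (x0 - x0)) - (- \<Psi> (x0 - 0))) {0..x0}"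
  proof (rule fundamental_theorem_of_calculus)
    fix x assume x: "x \<in> {0..x0}"
    have "((\<lambda>x. \<Psi> (x0 - x)) has_real_derivative \<rho> (x0 - x) * - 1) (at x)"
      by (rule DERIV_chain'[where g = \<Psi>]) (use x in \<open>auto intro!: derivative_eq_intros d\<close>)
    from DERIV_minus[OF this]
    have "((\<lambda>x. - \<Psi> (x0 - x)) has_real_derivative \<rho> (x0 - x)) (at x)" by simp
    then show "((\<lambda>x. - \<Psi> (x0 - x)) has_vector_derivative \<rho> \<bar>x - x0\<bar>) (at x within {0..x0})"
      using x by (auto simp: has_real_derivative_iff_has_vector_derivative
          intro: has_vector_derivative_at_within simp: abs_if split: if_splits)
  qed (use x0 in auto)
  have 2: "((\<lambda>x. \<rho> \<bar>x - x0\<bar>) has_integral (\<Psi> (1 - x0)) - (\<Psi> (x0 - x0))) {x0..1}"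
  proof (rule fundamental_theorem_of_calculus)
    fix x assume x: "x \<in> {x0..1}"
    have "((\<lambda>x. \<Psi> (x - x0)) has_real_derivative \<rho> (x - x0) * 1) (at x)"
      by (rule DERIV_chain'[where g = \<Psi>]) (use x in \<open>auto intro!: derivative_eq_intros d\<close>)
    then show "((\<lambda>x. \<Psi> (x - x0)) has_vector_derivative \<rho> \<bar>x - x0\<bar>) (at x within {x0..1})"
      using x by (auto simp: has_real_derivative_iff_has_vector_derivative
          intro: has_vector_derivative_at_within)
  qed (use x0 in auto)
  have "((\<lambda>x. \<rho> \<bar>x - x0\<bar>) has_integral
     ((- \<Psi> (x0 - x0)) - (- \<Psi> (x0 - 0))) + ((\<Psi> (1 - x0)) - (\<Psi> (x0 - x0)))) {0..1}"
    by (rule has_integral_combine[OF _ _ 1 2]) (use x0 in auto)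
  then have "integral {0..1} (\<lambda>x. \<rho> \<bar>x - x0\<bar>) = \<Psi> x0 + \<Psi> (1 - x0) - 2 * \<Psi> 0"
    by (simp add: integral_unique)
  then show ?thesis using b[of x0] b[of "1 - x0"] x0 by simp
qed

lemma integral_kernel2:
  fixes l x0 :: real
  assumes "0 < l" "x0 \<in> {0..1}"
  shows "integral {0..1} (\<lambda>x. 1 / (l + \<bar>x - x0\<bar>)\<^sup>2) \<le> 2 / l"
proof -
  have "integral {0..1} (\<lambda>x. (\<lambda>y. 1 / (l + y)\<^sup>2) \<bar>x - x0\<bar>) \<le> 2 * (0 - (- 1 / (l + 0)))"
    by (rule integral_abs_shift_le[where \<Psi> = "\<lambda>y. - 1 / (l + y)"])
       (use assms in \<open>auto intro!: derivative_eq_intros continuous_intros simp: power2_eq_square\<close>)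
  then show ?thesis by simp
qed

lemma integral_kernel4:
  fixes l x0 :: real
  assumes "0 < l" "x0 \<in> {0..1}"
  shows "integral {0..1} (\<lambda>x. 1 / (l + \<bar>x - x0\<bar>) ^ 4) \<le> 1 / l ^ 3"
proof -
  have "integral {0..1} (\<lambda>x. (\<lambda>y. 1 / (l + y) ^ 4) \<bar>x - x0\<bar>) \<le> 2 * (0 - (- 1 / (3 * (l + 0) ^ 3)))"
  proof (rule integral_abs_shift_le[where \<Psi> = "\<lambda>y. - 1 / (3 * (l + y) ^ 3)"])
    fix y :: real assume "0 \<le> y"
    then have p: "l + y > 0" using assms by simp
    show "((\<lambda>y. - 1 / (3 * (l + y) ^ 3)) has_real_derivative 1 / (l + y) ^ 4) (at y)"
    proof -
      have "((\<lambda>y. - (1/3) * (1 / (l + y)) ^ 3) has_real_derivative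
          - (1/3) * (of_nat 3 * (- (1 / (l + y)\<^sup>2) * (1 / (l + y)) ^ (3 - Suc 0)))) (at y)"
        by (rule DERIV_cmult, rule DERIV_power)
           (use p in \<open>auto intro!: derivative_eq_intros simp: power2_eq_square\<close>)
      moreover have "- (1/3) * (1 / (l + z)) ^ 3 = - 1 / (3 * (l + z) ^ 3)" for z
        by (simp add: power_one_over)
      moreover have "- (1/3) * (of_nat 3 * (- (1 / (l + y)\<^sup>2) * (1 / (l + y)) ^ (3 - Suc 0))) = 1 / (l + y) ^ 4"
        by (simp add: power_one_over flip: power_add)
      ultimately show ?thesis by (simp add: mult.commute)
    qed
  qed (use assms in \<open>auto intro!: continuous_intros\<close>)
  also have "\<dots> \<le> 1 / l ^ 3" using assms by (simp add: field_simps)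
  finally show ?thesis by simp
qed

text \<open>The exponent is 3/4 - 2: the growth of \<open>u'\<close> away from the critical point
  against the squared kernel. It lies below -1, so the integral is a power of \<open>l\<close> and
  no logarithm appears.\<close>

lemma integral_kernel54:
  fixes l x0 :: real
  assumes "0 < l" "x0 \<in> {0..1}"
  shows "integral {0..1} (\<lambda>x. (l + \<bar>x - x0\<bar>) powr (-5/4)) \<le> 8 * l powr (-1/4)"
proof -
  have "integral {0..1} (\<lambda>x. (\<lambda>y. (l + y) powr (-5/4)) \<bar>x - x0\<bar>) \<le> 2 * (0 - (- 4 * (l + 0) powr (-1/4)))"
  proof (rule integral_abs_shift_le[where \<Psi> = "\<lambda>y. - 4 * (l + y) powr (-1/4)"])
    fix y :: real assume "0 \<le> y"
    then have p: "l + y > 0" using assms by simp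
    show "((\<lambda>y. - 4 * (l + y) powr (-1/4)) has_real_derivative (l + y) powr (-5/4)) (at y)"
      by (rule derivative_eq_intros refl | use p in simp)+ (use p in \<open>simp add: powr_diff field_simps\<close>)?
  qed (use assms in \<open>auto intro!: continuous_intros\<close>)
  then show ?thesis by simp
qed

section \<open>Linear initial value problems\<close>

text \<open>Banach's fixed point theorem in an exponentially weighted norm: the unknown is
  \<open>z x = exp (- M * x) *\<^sub>R y x\<close>, and the contraction factor is
  \<open>\<bar>K\<bar> / M\<close>. The weight gives the solution on all of [0,1] at once, without
  gluing short intervals.\<close>

lemma picard_lindeloef_lipschitz:
  fixes \<Theta> :: "real \<Rightarrow> 'a::banach \<Rightarrow> 'a"
  assumes cont: "\<And>y. continuous_on {0..1} y \<Longrightarrow> continuous_on {0..1} (\<lambda>t. \<Theta> t (y t))"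
    and lip: "\<And>t a b. t \<in> {0..1} \<Longrightarrow> norm (\<Theta> t a - \<Theta> t b) \<le> K * norm (a - b)"
  shows "\<exists>y. y 0 = y0 \<and> (\<forall>x\<in>{0..1}. (y has_vector_derivative \<Theta> x (y x)) (at x within {0..1}))"
proof -
  define M where "M = 2 * \<bar>K\<bar> + 1"
  have M: "M > 0" "\<bar>K\<bar> / M \<le> 1/2" unfolding M_def by (auto simp: field_simps)
  \<comment> \<open>The complete space at hand consists of bounded continuous functions on the whole
    line; the clamp \<open>c\<close> extends functions on [0,1] to it by constants.\<close>
  define c :: "real \<Rightarrow> real" where "c x = max 0 (min 1 x)" for x
  have c01: "c x \<in> {0..1}" for x by (auto simp: c_def)
  have cc: "c x = x" if "x \<in> {0..1}" for x using that by (auto simp: c_def)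
  have ccont: "continuous_on UNIV c" unfolding c_def by (intro continuous_intros)
  define I where "I = (\<lambda>(z::real \<Rightarrow>\<^sub>C 'a) x. integral {0..x} (\<lambda>t. \<Theta> t (exp (M * t) *\<^sub>R z t)))"
  have zc: "continuous_on S (apply_bcontfun z)" for z :: "real \<Rightarrow>\<^sub>C 'a" and S
    by (rule continuous_on_subset[of UNIV]) (use apply_bcontfun[of z] in \<open>auto simp: bcontfun_def\<close>)
  have ic: "continuous_on {0..1} (\<lambda>t. \<Theta> t (exp (M * t) *\<^sub>R z t))" for z :: "real \<Rightarrow>\<^sub>C 'a"
    by (intro cont continuous_intros zc)
  have Ic: "continuous_on {0..1} (I z)" for z
    unfolding I_def by (rule indefinite_integral_continuous_1, rule integrable_continuous_interval[OF ic])
  define T where "T = (\<lambda>z x. exp (- M * c x) *\<^sub>R (y0 + I z (c x)))"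
  have Tc: "continuous_on UNIV (T z)" for z
    unfolding T_def
    by (intro continuous_intros ccont continuous_on_compose2[OF Ic ccont]) (use c01 in auto)
  have Tb: "bounded (range (T z))" for z
  proof -
    have "continuous_on {0..1} (\<lambda>x. exp (- M * x) *\<^sub>R (y0 + I z x))" by (intro continuous_intros Ic)
    then have "compact ((\<lambda>x. exp (- M * x) *\<^sub>R (y0 + I z x)) ` {0..1})"
      by (intro compact_continuous_image) auto
    then have "bounded ((\<lambda>x. exp (- M * x) *\<^sub>R (y0 + I z x)) ` {0..1})" by (rule compact_imp_bounded)
    then show ?thesis by (rule bounded_subset) (use c01 in \<open>auto simp: T_def\<close>)
  qed
  have Tmem: "T z \<in> bcontfun" for z using Tc Tb by (simp add: bcontfun_def)
  define TT where "TT = (\<lambda>z. Bcontfun (T z))"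
  have TT: "apply_bcontfun (TT z) = T z" for z
    unfolding TT_def by (rule Bcontfun_inverse[OF Tmem])
  have contr: "dist (TT z) (TT z') \<le> 1/2 * dist z z'" for z z'
  proof (rule dist_bound)
    fix x
    define s where "s = c x"
    have s: "s \<in> {0..1}" using c01 by (simp add: s_def)
    have sub: "continuous_on {0..s} (\<lambda>t. \<Theta> t (exp (M * t) *\<^sub>R z t))" for z :: "real \<Rightarrow>\<^sub>C 'a"
      by (rule continuous_on_subset[OF ic]) (use s in auto)
    have bd: "norm (I z s - I z' s) \<le> integral {0..s} (\<lambda>t. \<bar>K\<bar> * dist z z' * exp (M * t))"
    proof -
      have "I z s - I z' s = integral {0..s} (\<lambda>t. \<Theta> t (exp (M * t) *\<^sub>R z t) - \<Theta> t (exp (M * t) *\<^sub>R z' t))"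
        unfolding I_def by (rule integral_diff[symmetric]; rule integrable_continuous_interval; rule sub)
      also have "norm \<dots> \<le> integral {0..s} (\<lambda>t. \<bar>K\<bar> * dist z z' * exp (M * t))"
      proof (rule integral_norm_bound_integral)
        fix t assume t: "t \<in> {0..s}"
        have "norm (\<Theta> t (exp (M * t) *\<^sub>R z t) - \<Theta> t (exp (M * t) *\<^sub>R z' t))
           \<le> K * norm (exp (M * t) *\<^sub>R z t - exp (M * t) *\<^sub>R z' t)" by (rule lip) (use t s in auto)
        also have "norm (exp (M * t) *\<^sub>R z t - exp (M * t) *\<^sub>R z' t) = exp (M * t) * dist (z t) (z' t)"
          by (simp add: dist_norm flip: scaleR_diff_right)
        also have "K * (exp (M * t) * dist (z t) (z' t)) \<le> \<bar>K\<bar> * (exp (M * t) * dist z z')"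
          by (intro mult_mono dist_bounded) auto
        finally show "norm (\<Theta> t (exp (M * t) *\<^sub>R z t) - \<Theta> t (exp (M * t) *\<^sub>R z' t))
           \<le> \<bar>K\<bar> * dist z z' * exp (M * t)" by (simp add: mult_ac)
      qed (auto intro!: integrable_continuous_interval continuous_intros sub)
      finally show ?thesis .
    qed
    have hi: "((\<lambda>t. \<bar>K\<bar> * dist z z' * exp (M * t)) has_integral
        (\<bar>K\<bar> * dist z z' * exp (M * s) / M - \<bar>K\<bar> * dist z z' * exp (M * 0) / M)) {0..s}"
      by (rule fundamental_theorem_of_calculus)
         (use s M in \<open>auto intro!: derivative_eq_intros
            simp: has_real_derivative_iff_has_vector_derivative[symmetric]\<close>)
    have ii: "integral {0..s} (\<lambda>t. \<bar>K\<bar> * dist z z' * exp (M * t))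
       = \<bar>K\<bar> * dist z z' * exp (M * s) / M - \<bar>K\<bar> * dist z z' / M"
      using integral_unique[OF hi] by simp
    have "dist (TT z x) (TT z' x) = exp (- M * s) * norm (I z s - I z' s)"
      by (simp add: TT T_def s_def[symmetric] dist_norm algebra_simps flip: scaleR_diff_right)
    also have "\<dots> \<le> exp (- M * s) * (\<bar>K\<bar> * dist z z' * exp (M * s) / M)"
    proof (intro mult_left_mono order_trans[OF bd])
      show "integral {0..s} (\<lambda>t. \<bar>K\<bar> * dist z z' * exp (M * t)) \<le> \<bar>K\<bar> * dist z z' * exp (M * s) / M"
        unfolding ii using M by auto
    qed auto
    also have "\<dots> = \<bar>K\<bar> / M * dist z z'" by (simp add: exp_minus)
    also have "\<dots> \<le> 1/2 * dist z z'" using M by (intro mult_right_mono) auto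
    finally show "dist (TT z x) (TT z' x) \<le> 1/2 * dist z z'" .
  qed
  obtain z where z: "TT z = z" using banach_fix_type[of "1/2" TT] contr by auto
  define y where "y x = y0 + I z x" for x
  have yz: "exp (M * x) *\<^sub>R z x = y x" if "x \<in> {0..1}" for x
  proof -
    have "z x = T z x" using TT[of z] z by simp
    then have "z x = exp (- M * x) *\<^sub>R y x" by (simp add: T_def cc[OF that] y_def)
    then show ?thesis by (simp flip: exp_add)
  qed
  have "(y has_vector_derivative \<Theta> x (y x)) (at x within {0..1})" if x: "x \<in> {0..1}" for x
  proof -
    have "(I z has_vector_derivative \<Theta> x (exp (M * x) *\<^sub>R z x)) (at x within {0..1})"
      unfolding I_def by (rule integral_has_vector_derivative[OF ic x])
    then show ?thesis unfolding y_def[abs_def] yz[OF x, symmetric, unfolded y_def]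
      by (auto intro!: derivative_eq_intros simp: yz[OF x] y_def)
  qed
  moreover have "y 0 = y0" by (simp add: y_def I_def)
  ultimately show ?thesis by blast
qed

section \<open>Square integrable functions on the unit interval\<close>

lemma L2_01_integrable:
  assumes "L2_01 f"
  shows "set_integrable lborel {0..1} f"
proof -
  have m: "set_borel_measurable lborel {0..1} f"
    and i: "set_integrable lborel {0..1} (\<lambda>x. (cmod (f x))\<^sup>2)" using assms by (auto simp: L2_01_def)
  have "set_integrable lborel {0..1::real} (\<lambda>x. 1::real)"
    by (intro borel_integrable_atLeastAtMost') auto
  from set_integral_add(1)[OF this i]
  have "set_integrable lborel {0..1} (\<lambda>x. 1 + (cmod (f x))\<^sup>2)" .
  then show ?thesis
  proof (rule set_integrable_bound[OF _ m], intro AE_I2 impI)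
    fix x
    have "0 \<le> (1/2 - cmod (f x))\<^sup>2" by simp
    then have "cmod (f x) \<le> 1 + (cmod (f x))\<^sup>2" by (simp add: power2_eq_square algebra_simps)
    then show "norm (f x) \<le> norm (1 + (cmod (f x))\<^sup>2)" by simp
  qed
qed

lemma L2norm_01_nonneg: "0 \<le> L2norm_01 f"
  by (auto simp: L2norm_01_def set_lebesgue_integral_def intro!: integral_nonneg_AE)

text \<open>The bridge between \<open>nrm\<close>, a gauge integral suited to calculus, and the
  Lebesgue norm of the operator's definition.\<close>

lemma L2_01_continuous:
  assumes "continuous_on {0..1} q"
  shows "L2_01 q" "L2norm_01 q = nrm q"
proof -
  have i: "set_integrable lborel {0..1} (\<lambda>x. (cmod (q x))\<^sup>2)"
    by (intro borel_integrable_atLeastAtMost' continuous_intros assms)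
  moreover have "set_borel_measurable lborel {0..1} q"
    using borel_integrable_atLeastAtMost'[OF assms] by (auto simp: set_integrable_def set_borel_measurable_def)
  ultimately show "L2_01 q" by (simp add: L2_01_def)
  show "L2norm_01 q = nrm q"
    by (simp add: L2norm_01_def nrm_def set_borel_integral_eq_integral(2)[OF i])
qed

lemma L2_01_mult_continuous:
  assumes f: "L2_01 f" and q: "continuous_on {0..1} q"
  shows "set_integrable lborel {0..1} (\<lambda>x. f x * q x)"
    and "cmod (LBINT x:{0..1}. f x * q x) \<le> L2norm_01 f * nrm q"
proof -
  have f1: "set_integrable lborel {0..1} f" by (rule L2_01_integrable[OF f])
  have f2: "set_integrable lborel {0..1} (\<lambda>x. (cmod (f x))\<^sup>2)" using f by (simp add: L2_01_def)
  have q1: "set_integrable lborel {0..1} q" by (rule borel_integrable_atLeastAtMost'[OF q])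
  have q2: "set_integrable lborel {0..1} (\<lambda>x. (cmod (q x))\<^sup>2)"
    by (intro borel_integrable_atLeastAtMost' continuous_intros q)
  have m: "set_borel_measurable lborel {0..1} (\<lambda>x. f x * q x)"
  proof -
    have "(\<lambda>x. (indicator {0..1} x *\<^sub>R f x) * (indicator {0..1} x *\<^sub>R q x)) \<in> borel_measurable lborel"
      using f1 q1 by (intro borel_measurable_times) (auto simp: set_integrable_def)
    also have "(\<lambda>x. (indicator {0..1} x *\<^sub>R f x) * (indicator {0..1} x *\<^sub>R q x))
      = (\<lambda>x. indicator {0..1} x *\<^sub>R (f x * q x))" by (auto simp: indicator_def)
    finally show ?thesis by (simp add: set_borel_measurable_def)
  qed
  have young: "2 * cmod (f x * q x) \<le> t * (cmod (f x))\<^sup>2 + (cmod (q x))\<^sup>2 / t" if t: "t > 0" for t x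
  proof -
    have "0 \<le> (t * cmod (f x) - cmod (q x))\<^sup>2 / t" using t by simp
    also have "\<dots> = t * (cmod (f x))\<^sup>2 + (cmod (q x))\<^sup>2 / t - 2 * (cmod (f x) * cmod (q x))"
      using t by (simp add: power2_eq_square field_simps)
    finally show ?thesis by (simp add: norm_mult)
  qed
  show fq: "set_integrable lborel {0..1} (\<lambda>x. f x * q x)"
  proof (rule set_integrable_bound[OF _ m])
    show "set_integrable lborel {0..1} (\<lambda>x. (cmod (f x))\<^sup>2 + (cmod (q x))\<^sup>2)"
      by (rule set_integral_add(1)[OF f2 q2])
    show "AE x in lborel. x \<in> {0..1} \<longrightarrow> norm (f x * q x) \<le> norm ((cmod (f x))\<^sup>2 + (cmod (q x))\<^sup>2)"
    proof (intro AE_I2 impI)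
      fix x
      have "2 * cmod (f x * q x) \<le> (cmod (f x))\<^sup>2 + (cmod (q x))\<^sup>2" using young[of 1] by simp
      moreover have "0 \<le> cmod (f x * q x)" by simp
      ultimately show "norm (f x * q x) \<le> norm ((cmod (f x))\<^sup>2 + (cmod (q x))\<^sup>2)"
        by (simp only: real_norm_def)
    qed
  qed
  have nfq: "set_integrable lborel {0..1} (\<lambda>x. cmod (f x * q x))"
    using set_integrable_norm[OF fq] by simp
  have 1: "cmod (LBINT x:{0..1}. f x * q x) \<le> (LBINT x:{0..1}. cmod (f x * q x))"
    using set_integral_norm_bound[OF fq] by simp
  have 2: "(LBINT x:{0..1}. cmod (f x * q x))
    \<le> sqrt (LBINT x:{0..1}. (cmod (f x))\<^sup>2) * sqrt (LBINT x:{0..1}. (cmod (q x))\<^sup>2)"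
  proof (rule le_sqrt_mult_if_young)
    fix t :: real assume t: "t > 0"
    have "2 * (LBINT x:{0..1}. cmod (f x * q x)) = (LBINT x:{0..1}. 2 * cmod (f x * q x))" by simp
    also have "\<dots> \<le> (LBINT x:{0..1}. t * (cmod (f x))\<^sup>2 + (cmod (q x))\<^sup>2 / t)"
      using f2 q2 nfq young[OF t]
      by (intro set_integral_mono set_integral_add(1)) auto
    also have "\<dots> = t * (LBINT x:{0..1}. (cmod (f x))\<^sup>2) + (LBINT x:{0..1}. (cmod (q x))\<^sup>2) / t"
      using f2 q2 by (subst set_integral_add(2)) auto
    finally show "2 * (LBINT x:{0..1}. cmod (f x * q x))
      \<le> t * (LBINT x:{0..1}. (cmod (f x))\<^sup>2) + (LBINT x:{0..1}. (cmod (q x))\<^sup>2) / t" .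
  qed (auto simp: set_lebesgue_integral_def intro!: integral_nonneg_AE)
  show "cmod (LBINT x:{0..1}. f x * q x) \<le> L2norm_01 f * nrm q"
    using order_trans[OF 1 2] L2_01_continuous(2)[OF q] by (simp add: L2norm_01_def)
qed

lemma set_lebesgue_integral_subinterval:
  fixes f :: "real \<Rightarrow> complex"
  assumes "set_integrable lborel {0..1} f" "x \<in> {0..1}"
  shows "set_integrable lborel {0..x} f" "(LBINT t:{0..x}. f t) = integral {0..x} f"
proof -
  show *: "set_integrable lborel {0..x} f"
    by (rule set_integrable_subset[OF assms(1)]) (use assms(2) in auto)
  show "(LBINT t:{0..x}. f t) = integral {0..x} f" by (rule set_borel_integral_eq_integral(2)[OF *])
qed

text \<open>The primitive of an integrable \<open>f\<close> need not be differentiable at every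
  point, so the product rule is replaced by Fubini's theorem.\<close>

lemma primitive_by_parts:
  fixes f q q' :: "real \<Rightarrow> complex"
  assumes f: "set_integrable lborel {0..1} f"
    and q: "\<And>x. x \<in> {0..1} \<Longrightarrow> (q has_vector_derivative q' x) (at x within {0..1})"
    and q': "continuous_on {0..1} q'"
  shows "(LBINT x:{0..1}. f x * q x)
    = (LBINT t:{0..1}. f t) * q 1 - integral {0..1} (\<lambda>x. (LBINT t:{0..x}. f t) * q' x)"
proof -
  define f0 where "f0 t = indicator {0..1} t *\<^sub>R f t" for t :: real
  define q0 where "q0 t = indicator {0..1} t *\<^sub>R q' t" for t :: real
  have f0: "integrable lborel f0" using f by (simp add: f0_def[abs_def] set_integrable_def)
  have q0: "integrable lborel q0"
    using borel_integrable_atLeastAtMost'[OF q'] by (simp add: q0_def[abs_def] set_integrable_def)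
  have [measurable]: "f0 \<in> borel_measurable lborel" "q0 \<in> borel_measurable lborel"
    using f0 q0 by auto
  \<comment> \<open>The kernel lives on the triangle \<open>t \<le> x\<close>. Integrated in
    \<open>x\<close> it gives \<open>f t * (q 1 - q t)\<close>, integrated in \<open>t\<close> the
    primitive of \<open>f\<close> times \<open>q' x\<close>.\<close>
  define k where "k t x = indicator {p. fst p \<le> snd p} (t, x) *\<^sub>R (f0 t * q0 x)" for t x :: real
  have [measurable]: "case_prod k \<in> borel_measurable (lborel \<Otimes>\<^sub>M lborel)"
    unfolding k_def[abs_def] by measurable
  have k1: "integrable lborel (k t)" for t
  proof (rule Bochner_Integration.integrable_bound[of _ "\<lambda>x. f0 t * q0 x"])
    show "integrable lborel (\<lambda>x. f0 t * q0 x)" using q0 by simp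
  qed (auto simp: k_def indicator_def)
  have "integrable (lborel \<Otimes>\<^sub>M lborel) (case_prod k)"
  proof (rule lborel_pair.Fubini_integrable)
    show "integrable lborel (\<lambda>t. LINT x|lborel. norm (case (t, x) of (t, x) \<Rightarrow> k t x))"
    proof (rule Bochner_Integration.integrable_bound)
      show "integrable lborel (\<lambda>t. norm (f0 t) * (LINT x|lborel. norm (q0 x)))" using f0 by simp
      show "AE t in lborel. norm (LINT x|lborel. norm (case (t, x) of (t, x) \<Rightarrow> k t x))
         \<le> norm (norm (f0 t) * (LINT x|lborel. norm (q0 x)))"
      proof (intro AE_I2)
        fix t
        have "(LINT x|lborel. norm (k t x)) \<le> (LINT x|lborel. norm (f0 t) * norm (q0 x))"
        proof (rule integral_mono)
          show "integrable lborel (\<lambda>x. norm (k t x))" using k1[of t] by (rule integrable_norm)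
          show "integrable lborel (\<lambda>x. norm (f0 t) * norm (q0 x))" using q0 by simp
        qed (auto simp: k_def indicator_def norm_mult)
        then show "norm (LINT x|lborel. norm (case (t, x) of (t, x) \<Rightarrow> k t x))
         \<le> norm (norm (f0 t) * (LINT x|lborel. norm (q0 x)))"
          by (simp add: integral_nonneg_AE abs_mult)
      qed
    qed simp
  qed (use k1 in simp_all)
  then have fub: "(LINT x|lborel. LINT t|lborel. k t x) = (LINT t|lborel. LINT x|lborel. k t x)"
    by (rule lborel_pair.Fubini_integral)
  have a: "(LINT x|lborel. k t x) = indicator {0..1} t *\<^sub>R (f t * (q 1 - q t))" for t
  proof (cases "t \<in> {0..1}")
    case True
    have "(q' has_integral (q 1 - q t)) {t..1}"
      by (rule fundamental_theorem_of_calculus)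
         (use True in \<open>auto intro: has_vector_derivative_within_subset[OF q]\<close>)
    moreover have "set_integrable lborel {t..1} q'"
      by (rule borel_integrable_atLeastAtMost', rule continuous_on_subset[OF q']) (use True in auto)
    ultimately have "(LBINT x:{t..1}. q' x) = q 1 - q t"
      by (simp add: set_borel_integral_eq_integral integral_unique)
    moreover have "k t x = f t * (indicator {t..1} x *\<^sub>R q' x)" for x
      using True by (auto simp: k_def f0_def q0_def indicator_def)
    ultimately show ?thesis using True
      by (simp add: set_lebesgue_integral_def del: mult_scaleR_right)
  qed (simp add: k_def f0_def)
  have b: "(LINT t|lborel. k t x) = indicator {0..1} x *\<^sub>R ((LBINT t:{0..x}. f t) * q' x)" for x
  proof (cases "x \<in> {0..1}")
    case True
    have "k t x = (indicator {0..x} t *\<^sub>R f t) * q' x" for t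
      using True by (auto simp: k_def f0_def q0_def indicator_def)
    then show ?thesis using True
      by (simp add: set_lebesgue_integral_def del: mult_scaleR_left)
  qed (simp add: k_def q0_def)
  have cF: "continuous_on {0..1} (\<lambda>x. LBINT t:{0..x}. f t)"
    using indefinite_integral_continuous_1[OF set_borel_integral_eq_integral(1)[OF f]]
    by (subst continuous_on_cong[OF refl set_lebesgue_integral_subinterval(2)[OF f]])
  have cq: "continuous_on {0..1} q" by (rule vector_derivative_continuous_on[OF q])
  have fq: "set_integrable lborel {0..1} (\<lambda>x. f x * q x)"
  proof -
    obtain B where B: "\<And>x. x \<in> {0..1} \<Longrightarrow> cmod (q x) \<le> B"
      using compact_imp_bounded[OF compact_continuous_image[OF cq compact_Icc]]
      unfolding bounded_iff by blast
    have "(\<lambda>x. (indicator {0..1} x *\<^sub>R f x) * (indicator {0..1} x *\<^sub>R q x)) \<in> borel_measurable lborel"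
      using f borel_integrable_atLeastAtMost'[OF cq]
      by (intro borel_measurable_times) (auto simp: set_integrable_def)
    also have "(\<lambda>x. (indicator {0..1} x *\<^sub>R f x) * (indicator {0..1} x *\<^sub>R q x))
      = (\<lambda>x. indicator {0..1} x *\<^sub>R (f x * q x))" by (auto simp: indicator_def)
    finally have m: "set_borel_measurable lborel {0..1} (\<lambda>x. f x * q x)"
      by (simp add: set_borel_measurable_def)
    have "set_integrable lborel {0..1} (\<lambda>x. f x * of_real B)" using f by simp
    then show ?thesis
    proof (rule set_integrable_bound[OF _ m], intro AE_I2 impI)
      fix x :: real assume "x \<in> {0..1}"
      then show "norm (f x * q x) \<le> norm (f x * complex_of_real B)"
        using B[of x] by (auto simp: norm_mult intro!: mult_left_mono)
    qed
  qed
  have "(LINT x|lborel. LINT t|lborel. k t x) = (LBINT x:{0..1}. (LBINT t:{0..x}. f t) * q' x)"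
    by (simp add: b set_lebesgue_integral_def)
  also have "\<dots> = integral {0..1} (\<lambda>x. (LBINT t:{0..x}. f t) * q' x)"
    by (rule set_borel_integral_eq_integral(2), rule borel_integrable_atLeastAtMost')
       (intro continuous_intros cF q')
  finally have l: "(LINT x|lborel. LINT t|lborel. k t x)
    = integral {0..1} (\<lambda>x. (LBINT t:{0..x}. f t) * q' x)" .
  have "(LINT t|lborel. LINT x|lborel. k t x) = (LBINT t:{0..1}. f t * q 1 - f t * q t)"
    by (simp add: a set_lebesgue_integral_def algebra_simps)
  also have "\<dots> = (LBINT t:{0..1}. f t) * q 1 - (LBINT t:{0..1}. f t * q t)"
    using f fq by (subst set_integral_diff(2)) auto
  finally show ?thesis using fub l by (simp add: algebra_simps)
qed

section \<open>Concave profiles and the energy estimate\<close>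

text \<open>One constant \<open>A\<close> carries all dependence on the profile. The quotient
  \<open>U3 x / (U2 x)\<^sup>2\<close> is the derivative of \<open>- 1 / U2\<close>, the weight of
  the energy estimate. Evenness survives only as \<open>U1 0 = 0\<close>.\<close>

locale profile =
  fixes U U1 U2 U3 :: "real \<Rightarrow> real" and A :: real
  assumes dU: "\<And>x. x \<in> {0..1} \<Longrightarrow> (U has_real_derivative U1 x) (at x within {0..1})"
    and dU1: "\<And>x. x \<in> {0..1} \<Longrightarrow> (U1 has_real_derivative U2 x) (at x within {0..1})"
    and dU2: "\<And>x. x \<in> {0..1} \<Longrightarrow> (U2 has_real_derivative U3 x) (at x within {0..1})"
    and cU3: "continuous_on {0..1} U3"
    and U1_0: "U1 0 = 0" and U_1: "U 1 = 0" and A1: "1 \<le> A"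
    and U2_ge: "\<And>x. x \<in> {0..1} \<Longrightarrow> 1 / A \<le> - U2 x"
    and U2_le: "\<And>x. x \<in> {0..1} \<Longrightarrow> - U2 x \<le> A"
    and U3_le: "\<And>x. x \<in> {0..1} \<Longrightarrow> \<bar>U3 x / (U2 x)\<^sup>2\<bar> \<le> A"
begin

lemma cU: "continuous_on {0..1} U" by (rule DERIV_continuous_on[OF dU])
lemma cU1: "continuous_on {0..1} U1" by (rule DERIV_continuous_on[OF dU1])
lemma cU2: "continuous_on {0..1} U2" by (rule DERIV_continuous_on[OF dU2])

lemma U2_neg: "x \<in> {0..1} \<Longrightarrow> U2 x < 0"
  using U2_ge[of x] A1 by (smt (verit) divide_pos_pos)

lemma U1_bounds:
  assumes x: "x \<in> {0..1}"
  shows "x / A \<le> - U1 x" "- U1 x \<le> A * x"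
proof -
  have "(U2 has_integral (U1 x - U1 0)) {0..x}"
    by (rule fundamental_theorem_of_calculus)
       (use x in \<open>auto intro!: DERIV_subset[OF dU1] simp flip: has_real_derivative_iff_has_vector_derivative\<close>)
  from has_integral_neg[OF this] have i: "((\<lambda>t. - U2 t) has_integral (- U1 x)) {0..x}" using U1_0 by simp
  have "((\<lambda>t. 1 / A) has_integral (1 / A * x)) {0..x}"
    using has_integral_const_real[of "1/A" 0 x] x by (simp add: mult.commute)
  from has_integral_le[OF this i] show "x / A \<le> - U1 x" using U2_ge x by auto
  have "((\<lambda>t. A) has_integral (A * x)) {0..x}"
    using has_integral_const_real[of "A" 0 x] x by (simp add: mult.commute)
  from has_integral_le[OF i this] show "- U1 x \<le> A * x" using U2_le x by auto
qed

lemma abs_U1_le: "x \<in> {0..1} \<Longrightarrow> \<bar>U1 x\<bar> \<le> A * x"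
  using U1_bounds[of x] A1 by (smt (verit) divide_nonneg_pos atLeastAtMost_iff)

text \<open>Integrating \<open>U1_bounds\<close>. Differences of squares, not of points, are the
  natural measure, because \<open>U1\<close> vanishes at 0.\<close>

lemma U_diff_bounds:
  assumes "0 \<le> x" "x \<le> y" "y \<le> 1"
  shows "(y\<^sup>2 - x\<^sup>2) / (2 * A) \<le> U x - U y" "U x - U y \<le> A / 2 * (y\<^sup>2 - x\<^sup>2)"
proof -
  have "(U1 has_integral (U y - U x)) {x..y}"
    by (rule fundamental_theorem_of_calculus)
       (use assms in \<open>auto intro!: DERIV_subset[OF dU] simp flip: has_real_derivative_iff_has_vector_derivative\<close>)
  from has_integral_neg[OF this] have i: "((\<lambda>t. - U1 t) has_integral (U x - U y)) {x..y}" by simp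
  have j: "((\<lambda>t. c * t) has_integral (c / 2 * y\<^sup>2 - c / 2 * x\<^sup>2)) {x..y}" for c
    by (rule fundamental_theorem_of_calculus)
       (use assms in \<open>auto intro!: derivative_eq_intros simp flip: has_real_derivative_iff_has_vector_derivative\<close>)
  have "1 / A / 2 * y\<^sup>2 - 1 / A / 2 * x\<^sup>2 \<le> U x - U y"
    by (rule has_integral_le[OF j i]) (use U1_bounds assms in auto)
  then show "(y\<^sup>2 - x\<^sup>2) / (2 * A) \<le> U x - U y" by (simp add: diff_divide_distrib mult.commute)
  have "U x - U y \<le> A / 2 * y\<^sup>2 - A / 2 * x\<^sup>2"
    by (rule has_integral_le[OF i j]) (use U1_bounds assms in auto)
  then show "U x - U y \<le> A / 2 * (y\<^sup>2 - x\<^sup>2)" by (simp add: right_diff_distrib)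
qed

text \<open>Here \<open>d\<close> is the distance from \<nu> to the range of \<open>U\<close>: below
  the range \<open>xc = 1\<close>, above it \<open>xc = 0\<close>, inside it
  \<open>U xc = \<nu>\<close> and \<open>d = 0\<close>. The last clause records that
  \<open>U - \<nu>\<close> has a fixed sign when \<open>d\<close> is positive.\<close>

lemma critical_point:
  obtains xc d where "xc \<in> {0..1}" "0 \<le> d"
    "\<And>x. x \<in> {0..1} \<Longrightarrow> \<bar>x\<^sup>2 - xc\<^sup>2\<bar> / (2 * A) + d \<le> \<bar>U x - \<nu>\<bar>"
    "\<And>x. x \<in> {0..1} \<Longrightarrow> \<bar>U x - \<nu>\<bar> \<le> A / 2 * \<bar>x\<^sup>2 - xc\<^sup>2\<bar> + d"
    "(\<forall>x\<in>{0..1}. d \<le> U x - \<nu>) \<or> (\<forall>x\<in>{0..1}. d \<le> \<nu> - U x) \<or> d = 0"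
proof -
  have key: "\<bar>x\<^sup>2 - c\<^sup>2\<bar> / (2 * A) \<le> \<bar>U x - U c\<bar> \<and> \<bar>U x - U c\<bar> \<le> A / 2 * \<bar>x\<^sup>2 - c\<^sup>2\<bar>"
    if "x \<in> {0..1}" "c \<in> {0..1}" for x c
  proof (cases "x \<le> c")
    case True
    then have "x\<^sup>2 \<le> c\<^sup>2" using that by (intro power_mono) auto
    moreover from this have "0 \<le> (c\<^sup>2 - x\<^sup>2) / (2 * A)" using A1 by simp
    ultimately have "\<bar>x\<^sup>2 - c\<^sup>2\<bar> = c\<^sup>2 - x\<^sup>2" "\<bar>U x - U c\<bar> = U x - U c"
      using U_diff_bounds[of x c] True that by auto
    then show ?thesis using U_diff_bounds[of x c] True that by simp
  next
    case False
    then have "c\<^sup>2 \<le> x\<^sup>2" using that by (intro power_mono) auto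
    moreover from this have "0 \<le> (x\<^sup>2 - c\<^sup>2) / (2 * A)" using A1 by simp
    ultimately have "\<bar>x\<^sup>2 - c\<^sup>2\<bar> = x\<^sup>2 - c\<^sup>2" "\<bar>U x - U c\<bar> = U c - U x"
      using U_diff_bounds[of c x] False that by auto
    then show ?thesis using U_diff_bounds[of c x] False that by simp
  qed
  have mono: "U y \<le> U x" if "0 \<le> x" "x \<le> y" "y \<le> 1" for x y
  proof -
    have "0 \<le> (y\<^sup>2 - x\<^sup>2) / (2 * A)" using that A1 by (intro divide_nonneg_nonneg) (auto intro: power_mono)
    then show ?thesis using U_diff_bounds[OF that] by linarith
  qed
  consider "\<nu> < 0" | "\<nu> > U 0" | "0 \<le> \<nu>" "\<nu> \<le> U 0" by linarith
  then show ?thesis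
  proof cases
    case 1
    have pos: "0 \<le> U x" if "x \<in> {0..1}" for x using mono[of x 1] that U_1 by auto
    show ?thesis
    proof (rule that[of 1 "-\<nu>"])
      fix x :: real assume x: "x \<in> {0..1}"
      show "\<bar>x\<^sup>2 - 1\<^sup>2\<bar> / (2 * A) + - \<nu> \<le> \<bar>U x - \<nu>\<bar>" "\<bar>U x - \<nu>\<bar> \<le> A / 2 * \<bar>x\<^sup>2 - 1\<^sup>2\<bar> + - \<nu>"
        using key[OF x, of 1] pos[OF x] 1 U_1 by auto
    qed (use 1 pos in auto)
  next
    case 2
    have pos: "U x \<le> U 0" if "x \<in> {0..1}" for x using mono[of 0 x] that by auto
    show ?thesis
    proof (rule that[of 0 "\<nu> - U 0"])
      fix x :: real assume x: "x \<in> {0..1}"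
      show "\<bar>x\<^sup>2 - 0\<^sup>2\<bar> / (2 * A) + (\<nu> - U 0) \<le> \<bar>U x - \<nu>\<bar>" "\<bar>U x - \<nu>\<bar> \<le> A / 2 * \<bar>x\<^sup>2 - 0\<^sup>2\<bar> + (\<nu> - U 0)"
        using key[OF x, of 0] pos[OF x] 2 by auto
    qed (use 2 pos in auto)
  next
    case 3
    then obtain c where c: "0 \<le> c" "c \<le> 1" "U c = \<nu>"
      using IVT2'[of U 1 \<nu> 0] cU U_1 by auto
    show ?thesis
      by (rule that[of c 0]) (use key[of _ c] c in auto)
  qed
qed

end

text \<open>The right-hand side \<open>f\<close> enters only through \<open>\<Phi> = \<parallel>f\<parallel>\<close>, once in the equation integrated over \<open>(0, x)\<close>
  and once in the weak form.\<close>

locale orr_sommerfeld = profile +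
  fixes u u1 u2 u3 :: "real \<Rightarrow> complex" and \<alpha> \<beta> \<mu> \<nu> \<Phi> :: real
    and V \<phi> \<phi>1 G H :: "real \<Rightarrow> complex"
  assumes du: "\<And>x. x \<in> {0..1} \<Longrightarrow> (u has_vector_derivative u1 x) (at x within {0..1})"
    and du1: "\<And>x. x \<in> {0..1} \<Longrightarrow> (u1 has_vector_derivative u2 x) (at x within {0..1})"
    and du2: "\<And>x. x \<in> {0..1} \<Longrightarrow> (u2 has_vector_derivative u3 x) (at x within {0..1})"
    and cu3: "continuous_on {0..1} u3"
    and u1_0: "u1 0 = 0" and u_1: "u 1 = 0" and u1_1: "u1 1 = 0"
    and beta: "1 \<le> \<beta>" and alpha: "\<alpha>\<^sup>2 \<le> 1/2" and Phi: "0 \<le> \<Phi>"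
    and V_eq: "\<And>x. V x = Complex (U x - \<nu>) \<mu>"
    and \<phi>_eq: "\<And>x. \<phi> x = u2 x - of_real (\<alpha>\<^sup>2) * u x"
    and \<phi>1_eq: "\<And>x. \<phi>1 x = u3 x - of_real (\<alpha>\<^sup>2) * u1 x"
    and G_eq: "\<And>x. G x = V x * u1 x - of_real (U1 x) * u x"
    and H_eq: "\<And>x. H x = integral {0..x} (\<lambda>t. V t * u t)"
    and eqn: "\<And>x. x \<in> {0..1} \<Longrightarrow>
      cmod (\<phi>1 x - \<i> * of_real \<beta> * (G x - of_real (\<alpha>\<^sup>2) * H x)) \<le> \<Phi>"
    and weak: "\<And>q q'. (\<And>x. x \<in> {0..1} \<Longrightarrow> (q has_vector_derivative q' x) (at x within {0..1})) \<Longrightarrow>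
      continuous_on {0..1} q' \<Longrightarrow>
      cmod (\<i> * of_real \<beta> * integral {0..1} (\<lambda>x. (V x * \<phi> x - of_real (U2 x) * u x) * q x)
        - \<phi>1 1 * q 1 + integral {0..1} (\<lambda>x. \<phi>1 x * q' x)) \<le> \<Phi> * nrm q"
begin

text \<open>\<open>Q\<close> is the pointwise bound for \<phi> that \<open>cmod_square_le\<close>
  supplies, and \<open>h\<close> is a pointwise bound for the non-local remainder
  \<open>H\<close>.\<close>

definition "P = nrm \<phi>"
definition "X = nrm \<phi>1"
definition "Q = sqrt (2 * P * X + P\<^sup>2)"
definition "h = integral {0..1} (\<lambda>x. cmod (V x) * cmod (u x))"

lemma cu: "continuous_on {0..1} u" by (rule vector_derivative_continuous_on[OF du])
lemma cu1: "continuous_on {0..1} u1" by (rule vector_derivative_continuous_on[OF du1])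
lemma cu2: "continuous_on {0..1} u2" by (rule vector_derivative_continuous_on[OF du2])

lemma V_alt: "V x = of_real (U x) - of_real \<nu> + \<i> * of_real \<mu>"
  by (simp add: V_eq complex_eq_iff)

lemma cV: "continuous_on {0..1} V"
  unfolding V_alt[abs_def] by (intro continuous_intros cU)
lemma c\<phi>: "continuous_on {0..1} \<phi>"
  unfolding \<phi>_eq[abs_def] by (intro continuous_intros cu2 cu)
lemma c\<phi>1: "continuous_on {0..1} \<phi>1"
  unfolding \<phi>1_eq[abs_def] by (intro continuous_intros cu3 cu1)
lemma cG: "continuous_on {0..1} G"
  unfolding G_eq[abs_def] by (intro continuous_intros cV cu1 cU1 cu)

lemma d\<phi>: "x \<in> {0..1} \<Longrightarrow> (\<phi> has_vector_derivative \<phi>1 x) (at x within {0..1})"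
  unfolding \<phi>_eq[abs_def] \<phi>1_eq
  by (intro has_vector_derivative_diff has_vector_derivative_mult_right du2 du)

lemma dV: "x \<in> {0..1} \<Longrightarrow> (V has_vector_derivative of_real (U1 x)) (at x within {0..1})"
  unfolding V_alt[abs_def]
  by (auto intro!: derivative_eq_intros has_vector_derivative_of_real dU)

lemma P_nonneg: "0 \<le> P" and X_nonneg: "0 \<le> X" by (simp_all add: P_def X_def nrm_nonneg)
lemma Q_nonneg: "0 \<le> Q" by (simp add: Q_def P_nonneg X_nonneg)
lemma Q_square: "Q\<^sup>2 = 2 * P * X + P\<^sup>2" by (simp add: Q_def P_nonneg X_nonneg)
lemma P_le_Q: "P \<le> Q"
  by (rule power2_le_imp_le) (simp_all add: Q_square P_nonneg X_nonneg Q_nonneg)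

lemma \<phi>_le_Q: "x \<in> {0..1} \<Longrightarrow> cmod (\<phi> x) \<le> Q"
  by (rule power2_le_imp_le) (use cmod_square_le[OF d\<phi> c\<phi>1] in \<open>auto simp: Q_square Q_nonneg P_def X_def\<close>)

lemma h_nonneg: "0 \<le> h"
  unfolding h_def by (intro integral_nonneg integrable_continuous_interval continuous_intros cV cu) auto

lemma H_le:
  assumes "x \<in> {0..1}"
  shows "cmod (H x) \<le> h"
proof -
  have "cmod (H x) \<le> integral {0..x} (\<lambda>t. cmod (V t * u t))"
    unfolding H_eq
    by (rule continuous_on_imp_absolutely_integrable_on, rule continuous_on_subset[of "{0..1}"])
       (use assms in \<open>auto intro!: continuous_on_mult cV cu\<close>)
  also have "\<dots> \<le> integral {0..1} (\<lambda>t. cmod (V t * u t))"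
    by (intro integral_subinterval_le continuous_intros cV cu) (use assms in auto)
  finally show ?thesis by (simp add: h_def norm_mult)
qed

text \<open>The integrated equation solved for \<open>G\<close>. Where \<open>V\<close> does not
  vanish, \<open>G = V\<^sup>2 * (u / V)'\<close>, so dividing this bound by
  \<open>V\<^sup>2\<close> and integrating controls \<open>u / V\<close>.\<close>

lemma G_le:
  assumes x: "x \<in> {0..1}"
  shows "cmod (G x) \<le> (cmod (\<phi>1 x) + \<Phi>) / \<beta> + \<alpha>\<^sup>2 * h"
proof -
  define r where "r = \<phi>1 x - \<i> * of_real \<beta> * (G x - of_real (\<alpha>\<^sup>2) * H x)"
  have "\<i> * of_real \<beta> * (G x - of_real (\<alpha>\<^sup>2) * H x) = \<phi>1 x - r" by (simp add: r_def)
  then have "cmod (\<i> * of_real \<beta> * (G x - of_real (\<alpha>\<^sup>2) * H x)) \<le> cmod (\<phi>1 x) + \<Phi>"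
    using norm_triangle_ineq4[of "\<phi>1 x" r] eqn[OF x] by (simp add: r_def)
  then have 1: "cmod (G x - of_real (\<alpha>\<^sup>2) * H x) \<le> (cmod (\<phi>1 x) + \<Phi>) / \<beta>"
    using beta by (simp add: norm_mult pos_le_divide_eq mult.commute del: of_real_power)
  have "cmod (of_real (\<alpha>\<^sup>2) * H x) \<le> \<alpha>\<^sup>2 * h"
    using H_le[OF x] by (simp add: norm_mult norm_power mult_left_mono)
  then show ?thesis using 1 norm_triangle_ineq[of "G x - of_real (\<alpha>\<^sup>2) * H x" "of_real (\<alpha>\<^sup>2) * H x"] by simp
qed

text \<open>\<open>G 1\<close> vanishes by both conditions at 1, so only the right-hand side and the
  term with \<open>\<alpha>\<^sup>2\<close> remain.\<close>

lemma \<phi>1_1_le: "cmod (\<phi>1 1) \<le> \<Phi> + \<beta> * (\<alpha>\<^sup>2 * h)"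
proof -
  have "G 1 = 0" by (simp add: G_eq u_1 u1_1)
  then have "cmod (\<phi>1 1 + \<i> * of_real \<beta> * (of_real (\<alpha>\<^sup>2) * H 1)) \<le> \<Phi>" using eqn[of 1] by simp
  moreover have "cmod (\<i> * of_real \<beta> * (of_real (\<alpha>\<^sup>2) * H 1)) \<le> \<beta> * (\<alpha>\<^sup>2 * h)"
    using H_le[of 1] beta by (simp add: norm_mult norm_power mult_left_mono)
  ultimately show ?thesis
    using norm_triangle_ineq4[of "\<phi>1 1 + \<i> * of_real \<beta> * (of_real (\<alpha>\<^sup>2) * H 1)" "\<i> * of_real \<beta> * (of_real (\<alpha>\<^sup>2) * H 1)"]
    by simp
qed

lemma u_le_nrm_u1:
  assumes "x \<in> {0..1}"
  shows "cmod (u x) \<le> nrm u1"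
proof -
  have "cmod (u x) \<le> sqrt \<bar>x - 1\<bar> * nrm u1"
    using norm_diff_le_nrm[OF du cu1, of 1 x] assms u_1 by simp
  also have "\<dots> \<le> 1 * nrm u1" using assms by (intro mult_right_mono nrm_nonneg) auto
  finally show ?thesis by simp
qed

lemma u1_le_nrm_u2:
  assumes "x \<in> {0..1}"
  shows "cmod (u1 x) \<le> nrm u2"
proof -
  have "cmod (u1 x) \<le> sqrt \<bar>x - 1\<bar> * nrm u2"
    using norm_diff_le_nrm[OF du1 cu2, of 1 x] assms u1_1 by simp
  also have "\<dots> \<le> 1 * nrm u2" using assms by (intro mult_right_mono nrm_nonneg) auto
  finally show ?thesis by simp
qed

lemma nrm_u_le: "nrm u \<le> nrm u1"
  by (rule nrm_le_if_le[OF cu u_le_nrm_u1])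
lemma nrm_u1_le: "nrm u1 \<le> nrm u2"
  by (rule nrm_le_if_le[OF cu1 u1_le_nrm_u2])

text \<open>\<open>u2 = \<phi> + \<alpha>\<^sup>2 u\<close>, and
  \<open>nrm u \<le> nrm u1 \<le> nrm u2\<close> lets the second term be absorbed since
  \<open>\<alpha>\<^sup>2 \<le> 1/2\<close>.\<close>

lemma nrm_u2_le: "nrm u2 \<le> 2 * P"
proof -
  have "nrm (\<lambda>x. \<phi> x + of_real (\<alpha>\<^sup>2) * u x) \<le> nrm \<phi> + nrm (\<lambda>x. of_real (\<alpha>\<^sup>2) * u x)"
    by (intro nrm_add_le c\<phi> continuous_intros cu)
  moreover have "nrm (\<lambda>x. of_real (\<alpha>\<^sup>2) * u x) \<le> 1/2 * nrm u"
  proof (rule nrm_mult_le)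
    fix x show "cmod (of_real (\<alpha>\<^sup>2) * u x) \<le> 1/2 * cmod (u x)"
      using mult_right_mono[OF alpha, of "cmod (u x)"] by (simp add: norm_mult norm_power)
  qed (auto intro!: continuous_intros cu)
  moreover have "(\<lambda>x. \<phi> x + of_real (\<alpha>\<^sup>2) * u x) = u2" by (simp add: \<phi>_eq fun_eq_iff)
  ultimately show ?thesis using nrm_u_le nrm_u1_le by (simp add: P_def)
qed

lemma u2_le_Q:
  assumes x: "x \<in> {0..1}"
  shows "cmod (u2 x) \<le> 2 * Q"
proof -
  have "u2 x = \<phi> x + of_real (\<alpha>\<^sup>2) * u x" by (simp add: \<phi>_eq)
  then have "cmod (u2 x) \<le> cmod (\<phi> x) + \<alpha>\<^sup>2 * cmod (u x)"
    by (metis norm_triangle_ineq norm_mult norm_of_real abs_of_nonneg zero_le_power2)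
  also have "\<alpha>\<^sup>2 * cmod (u x) \<le> 1/2 * (2 * P)"
    using alpha u_le_nrm_u1[OF x] nrm_u1_le nrm_u2_le by (intro mult_mono) auto
  finally show ?thesis using \<phi>_le_Q[OF x] P_le_Q by simp
qed

lemma integral_u_cnj_u2: "integral {0..1} (\<lambda>x. u x * cnj (u2 x)) = - of_real ((nrm u1)\<^sup>2)"
proof -
  have "((\<lambda>x. u x * cnj (u2 x) + u1 x * cnj (u1 x)) has_integral (u 1 * cnj (u1 1) - u 0 * cnj (u1 0))) {0..1}"
    by (rule fundamental_theorem_of_calculus)
       (auto intro!: has_vector_derivative_mult has_vector_derivative_cnj du du1)
  then have "integral {0..1} (\<lambda>x. u x * cnj (u2 x) + u1 x * cnj (u1 x)) = 0"
    by (simp add: integral_unique u_1 u1_0)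
  moreover have "integral {0..1} (\<lambda>x. u x * cnj (u2 x) + u1 x * cnj (u1 x))
    = integral {0..1} (\<lambda>x. u x * cnj (u2 x)) + integral {0..1} (\<lambda>x. u1 x * cnj (u1 x))"
    by (intro integral_add integrable_continuous_interval continuous_intros cu cu1 cu2)
  moreover have "integral {0..1} (\<lambda>x. u1 x * cnj (u1 x)) = of_real ((nrm u1)\<^sup>2)"
  proof -
    have "(\<lambda>x. u1 x * cnj (u1 x)) = (\<lambda>x. of_real ((cmod (u1 x))\<^sup>2))"
      by (simp add: complex_norm_square fun_eq_iff del: of_real_power)
    then show ?thesis unfolding nrm_square[OF cu1]
      by (simp only:) (intro integral_complex_of_real_continuous continuous_intros cu1)
  qed
  ultimately show ?thesis by (simp add: eq_neg_iff_add_eq_0)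
qed

text \<open>Interpolation through the integral of \<open>u * cnj u2\<close>. The layer case ends
  here: the bounds for \<open>P\<close> and for \<open>u\<close> have different powers of
  \<open>L\<close>, and their product is what compensates \<beta>.\<close>

lemma nrm_u1_square_le: "(nrm u1)\<^sup>2 \<le> 2 * P * nrm u"
proof -
  have "(nrm u1)\<^sup>2 = cmod (integral {0..1} (\<lambda>x. u x * cnj (u2 x)))"
    unfolding integral_u_cnj_u2 by (simp add: norm_power nrm_nonneg)
  also have "\<dots> \<le> integral {0..1} (\<lambda>x. cmod (u x * cnj (u2 x)))"
    by (intro continuous_on_imp_absolutely_integrable_on continuous_intros cu cu2)
  also have "\<dots> = integral {0..1} (\<lambda>x. cmod (u x) * cmod (u2 x))" by (simp add: norm_mult)
  also have "\<dots> \<le> nrm u * nrm u2" by (rule integral_cmod_mult_le[OF cu cu2])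
  also have "\<dots> \<le> nrm u * (2 * P)" by (intro mult_left_mono nrm_u2_le nrm_nonneg)
  finally show ?thesis by (simp add: mult_ac)
qed

lemma integral_u_cnj_\<phi>:
  "integral {0..1} (\<lambda>x. u x * cnj (\<phi> x)) = - of_real ((nrm u1)\<^sup>2 + \<alpha>\<^sup>2 * (nrm u)\<^sup>2)"
proof -
  have "(\<lambda>x. u x * cnj (\<phi> x)) = (\<lambda>x. u x * cnj (u2 x) - of_real (\<alpha>\<^sup>2 * (cmod (u x))\<^sup>2))"
    by (simp add: \<phi>_eq fun_eq_iff algebra_simps complex_norm_square del: of_real_power)
  then have "integral {0..1} (\<lambda>x. u x * cnj (\<phi> x)) =
    integral {0..1} (\<lambda>x. u x * cnj (u2 x)) - integral {0..1} (\<lambda>x. of_real (\<alpha>\<^sup>2 * (cmod (u x))\<^sup>2))"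
    by (simp only:) (intro integral_diff integrable_continuous_interval continuous_intros cu cu2)
  also have "integral {0..1} (\<lambda>x. complex_of_real (\<alpha>\<^sup>2 * (cmod (u x))\<^sup>2)) = of_real (integral {0..1} (\<lambda>x. \<alpha>\<^sup>2 * (cmod (u x))\<^sup>2))"
    by (intro integral_complex_of_real_continuous continuous_intros cu)
  also have "integral {0..1} (\<lambda>x. \<alpha>\<^sup>2 * (cmod (u x))\<^sup>2) = \<alpha>\<^sup>2 * (nrm u)\<^sup>2"
    by (simp add: nrm_square[OF cu])
  finally show ?thesis by (simp add: integral_u_cnj_u2)
qed

definition "g x = - 1 / U2 x"
text \<open>The price of the missing condition on \<phi> at 1: it bounds the boundary term of the
  weak form, with \<open>Q\<close> in the role of |\<phi>(1)|.\<close>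

definition "T = cmod (\<phi>1 1) * Q"

lemma T_nonneg: "0 \<le> T" by (simp add: T_def Q_nonneg)
lemma T_le: "T \<le> (\<Phi> + \<beta> * (\<alpha>\<^sup>2 * h)) * Q"
  unfolding T_def by (intro mult_right_mono \<phi>1_1_le Q_nonneg)

lemma g_bounds:
  assumes "x \<in> {0..1}"
  shows "1 / A \<le> g x" "g x \<le> A"
  using U2_ge[OF assms] U2_le[OF assms] U2_neg[OF assms] A1
  by (auto simp: g_def field_simps)

lemma cg: "continuous_on {0..1} g"
  unfolding g_def[abs_def] by (intro continuous_intros cU2) (use U2_neg in force)

lemma dg: "x \<in> {0..1} \<Longrightarrow> (g has_real_derivative U3 x / (U2 x)\<^sup>2) (at x within {0..1})"
  unfolding g_def[abs_def] using U2_neg[of x]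
  by (auto intro!: derivative_eq_intros dU2 simp: power2_eq_square)

text \<open>Pairing with \<open>\<phi> / \<bar>U''\<bar>\<close> makes the non-local term purely imaginary:
  it becomes \<open>\<i> \<beta>\<close> times \<open>\<integral> u \<phi>*\<close>, and that integral is real.\<close>

lemma energy:
  shows "integral {0..1} (\<lambda>x. g x * (cmod (\<phi>1 x))\<^sup>2) - \<beta> * \<mu> * integral {0..1} (\<lambda>x. g x * (cmod (\<phi> x))\<^sup>2)
      \<le> A * (X * P + \<Phi> * P + T)" (is "?X - _ * ?P \<le> ?r")
    and "\<beta> * \<bar>integral {0..1} (\<lambda>x. g x * (U x - \<nu>) * (cmod (\<phi> x))\<^sup>2) - ((nrm u1)\<^sup>2 + \<alpha>\<^sup>2 * (nrm u)\<^sup>2)\<bar>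
      \<le> A * (X * P + \<Phi> * P + T)"
proof -
  let ?W = "integral {0..1} (\<lambda>x. g x * (U x - \<nu>) * (cmod (\<phi> x))\<^sup>2)"
  let ?N = "(nrm u1)\<^sup>2 + \<alpha>\<^sup>2 * (nrm u)\<^sup>2"
  define q where "q x = of_real (g x) * cnj (\<phi> x)" for x
  define q' where "q' x = of_real (g x) * cnj (\<phi>1 x) + of_real (U3 x / (U2 x)\<^sup>2) * cnj (\<phi> x)" for x
  have U2n: "U2 x \<noteq> 0" if "x \<in> {0..1}" for x using U2_neg[OF that] by simp
  have cg': "continuous_on {0..1} (\<lambda>x. U3 x / (U2 x)\<^sup>2)"
    by (intro continuous_intros cU3 cU2) (use U2n in auto)
  have dq: "(q has_vector_derivative q' x) (at x within {0..1})" if "x \<in> {0..1}" for x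
    unfolding q_def[abs_def] q'_def
    by (intro has_vector_derivative_mult has_vector_derivative_cnj d\<phi> has_vector_derivative_of_real dg that)
  have cq': "continuous_on {0..1} q'" unfolding q'_def[abs_def]
    by (intro continuous_intros cg cg' c\<phi> c\<phi>1)
  have cq: "continuous_on {0..1} q" unfolding q_def[abs_def] by (intro continuous_intros cg c\<phi>)
  have sq: "z * cnj z = of_real ((cmod z)\<^sup>2)" for z by (rule complex_norm_square[symmetric])
  have "integral {0..1} (\<lambda>x. (V x * \<phi> x - of_real (U2 x) * u x) * q x)
    = integral {0..1} (\<lambda>x. (of_real (g x * (U x - \<nu>) * (cmod (\<phi> x))\<^sup>2)
        + \<i> * of_real \<mu> * of_real (g x * (cmod (\<phi> x))\<^sup>2)) + u x * cnj (\<phi> x))"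
  proof (rule integral_cong)
    fix x :: real assume x: "x \<in> {0..1}"
    have "of_real (U2 x) * complex_of_real (g x) = - 1"
      using U2n[OF x] by (simp add: g_def flip: of_real_mult)
    then have "(V x * \<phi> x - of_real (U2 x) * u x) * q x
      = V x * of_real (g x) * (\<phi> x * cnj (\<phi> x)) + u x * cnj (\<phi> x)"
      unfolding q_def by (simp add: algebra_simps)
    then show "(V x * \<phi> x - of_real (U2 x) * u x) * q x = (of_real (g x * (U x - \<nu>) * (cmod (\<phi> x))\<^sup>2)
        + \<i> * of_real \<mu> * of_real (g x * (cmod (\<phi> x))\<^sup>2)) + u x * cnj (\<phi> x)"
      unfolding sq V_alt by (simp add: algebra_simps)
  qed
  also have "\<dots> = (of_real ?W + \<i> * of_real \<mu> * of_real ?P) - of_real ?N"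
    by (subst integral_add, (intro integrable_continuous_interval continuous_intros cg cU cu c\<phi>)+,
        subst integral_add, (intro integrable_continuous_interval continuous_intros cg cU cu c\<phi>)+,
        subst integral_mult_right, subst integral_complex_of_real_continuous, intro continuous_intros cg cU c\<phi>,
        subst integral_complex_of_real_continuous, intro continuous_intros cg cU c\<phi>,
        simp add: integral_u_cnj_\<phi>)
  finally have I1: "integral {0..1} (\<lambda>x. (V x * \<phi> x - of_real (U2 x) * u x) * q x)
    = (of_real ?W + \<i> * of_real \<mu> * of_real ?P) - of_real ?N" .
  define r where "r = integral {0..1} (\<lambda>x. of_real (U3 x / (U2 x)\<^sup>2) * (\<phi>1 x * cnj (\<phi> x)))"
  have "integral {0..1} (\<lambda>x. \<phi>1 x * q' x)
    = integral {0..1} (\<lambda>x. of_real (g x * (cmod (\<phi>1 x))\<^sup>2) + of_real (U3 x / (U2 x)\<^sup>2) * (\<phi>1 x * cnj (\<phi> x)))"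
    by (rule integral_cong) (simp add: q'_def algebra_simps complex_norm_square del: of_real_power of_real_divide)
  also have "\<dots> = of_real ?X + r"
    unfolding r_def
    by (subst integral_add, (intro integrable_continuous_interval continuous_intros cg cg' c\<phi> c\<phi>1)+,
        subst integral_complex_of_real_continuous, intro continuous_intros cg c\<phi>1, simp)
  finally have I2: "integral {0..1} (\<lambda>x. \<phi>1 x * q' x) = of_real ?X + r" .
  have "cmod r \<le> integral {0..1} (\<lambda>x. A * (cmod (\<phi>1 x) * cmod (\<phi> x)))"
    unfolding r_def
  proof (rule integral_norm_bound_integral)
    fix x :: real assume x: "x \<in> {0..1}"
    have "\<bar>U3 x / (U2 x)\<^sup>2\<bar> * (cmod (\<phi>1 x) * cmod (\<phi> x)) \<le> A * (cmod (\<phi>1 x) * cmod (\<phi> x))"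
      by (intro mult_right_mono U3_le x) auto
    then show "cmod (of_real (U3 x / (U2 x)\<^sup>2) * (\<phi>1 x * cnj (\<phi> x))) \<le> A * (cmod (\<phi>1 x) * cmod (\<phi> x))"
      by (simp only: norm_mult norm_of_real complex_mod_cnj)
  qed (intro integrable_continuous_interval continuous_intros cg' c\<phi>1 c\<phi>)+
  also have "\<dots> \<le> A * (X * P)"
    using integral_cmod_mult_le[OF c\<phi>1 c\<phi>] A1 by (simp add: X_def P_def mult_left_mono)
  finally have r: "cmod r \<le> A * (X * P)" .
  have "nrm q \<le> A * P" unfolding P_def
  proof (rule nrm_mult_le[OF c\<phi> cq])
    fix x :: real assume x: "x \<in> {0..1}"
    have "0 \<le> g x" using order_trans[OF _ g_bounds(1)[OF x], of 0] A1 by simp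
    then show "cmod (q x) \<le> A * cmod (\<phi> x)"
      using g_bounds(2)[OF x] by (simp add: q_def norm_mult mult_right_mono)
  qed (use A1 in simp)
  then have 3: "\<Phi> * nrm q \<le> \<Phi> * (A * P)" by (intro mult_left_mono Phi)
  have "0 \<le> g 1" using order_trans[OF _ g_bounds(1)[of 1], of 0] A1 by simp
  then have "cmod (\<phi>1 1 * q 1) \<le> cmod (\<phi>1 1) * (A * Q)"
    unfolding q_def using g_bounds(2)[of 1] \<phi>_le_Q[of 1] A1
    by (auto simp: norm_mult intro!: mult_left_mono mult_mono)
  then have 4: "cmod (\<phi>1 1 * q 1) \<le> A * T" by (simp add: T_def mult_ac)
  \<comment> \<open>\<open>z\<close> holds the terms whose real and imaginary parts are explicit:
    the real part shows the dissipation, the imaginary part the weight \<open>U - \<nu>\<close>. The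
    derivative of \<open>g\<close> and the boundary term are errors.\<close>
  define z where "z = \<i> * of_real \<beta> * ((of_real ?W + \<i> * of_real \<mu> * of_real ?P) - of_real ?N) + of_real ?X"
  have "cmod (z + (r - \<phi>1 1 * q 1)) \<le> \<Phi> * nrm q"
    using weak[OF dq cq'] unfolding I1 I2 z_def by (simp add: algebra_simps)
  moreover have "cmod z \<le> cmod (z + (r - \<phi>1 1 * q 1)) + cmod (r - \<phi>1 1 * q 1)"
    using norm_triangle_ineq4[of "z + (r - \<phi>1 1 * q 1)" "r - \<phi>1 1 * q 1"] by simp
  moreover have "cmod (r - \<phi>1 1 * q 1) \<le> cmod r + cmod (\<phi>1 1 * q 1)" by (rule norm_triangle_ineq4)
  ultimately have z: "cmod z \<le> ?r" using r 3 4 by (simp add: algebra_simps)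
  have "Re z = ?X - \<beta> * \<mu> * ?P" "Im z = \<beta> * (?W - ?N)"
    by (simp_all add: z_def algebra_simps)
  then show "?X - \<beta> * \<mu> * ?P \<le> ?r" "\<beta> * \<bar>?W - ?N\<bar> \<le> ?r"
    using order_trans[OF complex_Re_le_cmod z] order_trans[OF abs_Im_le_cmod z] beta by (simp_all add: abs_mult)
qed

end

section \<open>The critical layer\<close>

text \<open>The disjunct \<open>\<kappa> = L\<close> of \<open>\<kappa>_cases\<close> encodes
  \<kappa> = \<beta>^(-1/4), as \<open>\<beta> * \<kappa> * L ^ 3 = 1\<close> shows. \<kappa> is
  thus the largest of three scales: the critical point, the layer width at the centre, and the root
  of the distance from \<lambda> to i U([0,1]). \<open>Km\<close> bounds \<kappa> so that constants
  stay uniform, and \<open>\<mu>_le\<close> keeps the shifted \<open>V\<close> in the lower half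
  plane.\<close>

locale layer = orr_sommerfeld +
  fixes xc d \<kappa> L Km :: real
  assumes xc: "xc \<in> {0..1}" and d0: "0 \<le> d"
    and U_low: "\<And>x. x \<in> {0..1} \<Longrightarrow> \<bar>x\<^sup>2 - xc\<^sup>2\<bar> / (2 * A) + d \<le> \<bar>U x - \<nu>\<bar>"
    and U_up: "\<And>x. x \<in> {0..1} \<Longrightarrow> \<bar>U x - \<nu>\<bar> \<le> A / 2 * \<bar>x\<^sup>2 - xc\<^sup>2\<bar> + d"
    and \<kappa>0: "0 < \<kappa>" and L0: "0 < L" and L_le_\<kappa>: "L \<le> \<kappa>" and L1: "L \<le> 1"
    and \<beta>\<kappa>L: "\<beta> * \<kappa> * L ^ 3 = 1" and E_le: "\<bar>\<mu>\<bar> + d \<le> \<kappa>\<^sup>2" and xc_le: "xc \<le> \<kappa>"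
    and \<kappa>_le: "\<kappa> \<le> Km" and Km1: "1 \<le> Km"
    and \<kappa>_cases: "\<kappa> = xc \<or> \<kappa> = L \<or> \<kappa>\<^sup>2 = \<bar>\<mu>\<bar> + d"
    and \<mu>_le: "\<mu> \<le> \<kappa> * L / 2"
begin

text \<open>The model size (\<kappa> + r)(L + r) at r = 0: the least shift that gives
  \<open>V\<close> this lower bound at the critical point itself.\<close>

definition "\<delta> = \<kappa> * L"
definition "D = \<delta> - \<mu>"
definition "Vs x = Complex (U x - \<nu>) (- D)"
definition "rr x = \<bar>x - xc\<bar>"
definition "C1 = 24 * A"
text \<open>The size of \<open>u / V\<close> when driven by the right-hand side of
  \<open>G_le\<close> alone: \<open>2 * \<kappa>\<^sup>2 * B\<close> bounds the kernel integral in
  \<open>integral_Src\<close>. The factor 1/\<beta> appears as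
  \<open>\<kappa> * L ^ 3\<close>.\<close>

definition "B = (L * sqrt L * X + L\<^sup>2 * \<Phi>) / \<kappa> + \<alpha>\<^sup>2 * h / (\<kappa>\<^sup>2 * L)"
definition "C3 = 7 * A * C1\<^sup>2"
text \<open>\<open>W\<close> adds the cost of the shift. Dividing by \<open>Vs\<close> instead of
  \<open>V\<close> leaves a term \<open>\<delta> * u1\<close> in the derivative of \<open>w\<close>,
  and \<open>u1_le\<close> turns it into a multiple of \<open>B\<close> and the second
  summand.\<close>

definition "W = B + L powr (3/4) * sqrt (P * Q) / \<kappa>"
definition "C4 = 2 * C1\<^sup>2 * (34 + 2 * C3)"
definition "w x = u x / Vs x"
definition "zz x = \<bar>x\<^sup>2 - xc\<^sup>2\<bar>"
definition "EE = \<bar>\<mu>\<bar> + d"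
text \<open>By \<open>V_up\<close>, \<open>Vs\<close> grows at most like
  \<open>\<kappa>\<^sup>2 + x\<^sup>2\<close>; bounding \<open>w\<close> with this weight therefore
  bounds \<open>u = Vs * w\<close> uniformly in \<open>x\<close>.\<close>

definition "om x = (\<kappa>\<^sup>2 + x\<^sup>2) / \<kappa>\<^sup>2"

lemma zz0: "0 \<le> zz x" by (simp add: zz_def)
lemma EE0: "0 \<le> EE" "d \<le> EE" "\<bar>\<mu>\<bar> \<le> EE" using d0 by (auto simp: EE_def)

lemma C1_ge: "1 \<le> C1" using A1 by (simp add: C1_def)
lemma C3_ge: "1 \<le> C3"
proof -
  have "1 \<le> C1\<^sup>2" using C1_ge by simp
  then have "1 * 1 \<le> 7 * A * C1\<^sup>2" using A1 by (intro mult_mono) auto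
  then show ?thesis by (simp add: C3_def)
qed
lemma C4_ge: "1 \<le> C4"
proof -
  have "1 \<le> C1\<^sup>2" using C1_ge by simp
  then have "1 * 1 \<le> (2 * C1\<^sup>2) * (34 + 2 * C3)" using C3_ge by (intro mult_mono) auto
  then show ?thesis by (simp add: C4_def)
qed

lemma \<delta>0: "0 < \<delta>" using \<kappa>0 L0 by (simp add: \<delta>_def)
text \<open>For positive \<mu> the hypothesis \<open>\<mu> \<le> \<delta> / 2\<close> makes the left
  side at most \<delta>/2 and \<open>D\<close> at least \<delta>/2; for negative \<mu>,
  \<open>D = \<delta> + \<bar>\<mu>\<bar>\<close>.\<close>

lemma D_ge: "(\<delta> + \<bar>\<mu>\<bar>) / 3 \<le> D"
  using \<mu>_le \<delta>0 unfolding D_def \<delta>_def by (simp add: abs_if mult.commute)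
lemma D0: "0 < D" using D_ge \<delta>0 by (smt (verit) divide_pos_pos)

section \<open>Size of \<open>V\<close> and of its shift \<open>Vs\<close> around the critical
  point\<close>

lemma rr0: "0 \<le> rr x" by (simp add: rr_def)
lemma c_rr: "continuous_on S rr" unfolding rr_def[abs_def] by (intro continuous_intros)
lemma x_le: "x \<le> \<kappa> + rr x" using xc_le by (simp add: rr_def)

lemma sq_diff: "x \<in> {0..1} \<Longrightarrow> zz x = rr x * (x + xc)"
  using xc by (simp add: zz_def rr_def power2_eq_square square_diff_square_factored abs_mult mult.commute)

lemma rr_sq_le: "x \<in> {0..1} \<Longrightarrow> (rr x)\<^sup>2 \<le> zz x"
  using sq_diff[of x] xc mult_left_mono[OF _ rr0, of "rr x" "x + xc" x] by (auto simp: rr_def power2_eq_square)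

text \<open>If \<open>\<kappa> = xc\<close>, then \<open>zz x = rr x * (x + xc)\<close> already
  contains the product. In the other cases \<kappa>^2 is one of the last two summands, and the
  inequality of arithmetic and geometric means splits the product.\<close>

lemma \<kappa>rr_le:
  assumes x: "x \<in> {0..1}"
  shows "\<kappa> * rr x \<le> zz x + EE + \<kappa> * L"
proof -
  note E = EE0(1)
  have kl: "0 \<le> \<kappa> * L" using \<kappa>0 L0 by simp
  have am: "\<kappa> * rr x \<le> (\<kappa>\<^sup>2 + (rr x)\<^sup>2) / 2"
    using sum_squares_bound[of \<kappa> "rr x"] by simp
  from \<kappa>_cases consider "\<kappa> = xc" | "\<kappa> = L" | "\<kappa>\<^sup>2 = EE" unfolding EE_def by blast
  then show ?thesis
  proof cases
    case 1
    have "rr x * xc \<le> rr x * (x + xc)" using x rr0 by (intro mult_left_mono) auto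
    then show ?thesis using 1 E kl sq_diff[OF x] by (simp add: mult.commute)
  next
    case 2
    then have "\<kappa>\<^sup>2 = \<kappa> * L" by (simp add: power2_eq_square)
    then show ?thesis using am rr_sq_le[OF x] E kl zz0[of x] by argo
  next
    case 3
    then show ?thesis using am rr_sq_le[OF x] E kl zz0[of x] by argo
  qed
qed

lemma R_le:
  assumes x: "x \<in> {0..1}"
  shows "(\<kappa> + rr x) * (L + rr x) \<le> 3 * (zz x + EE + \<kappa> * L)"
proof -
  have "rr x * L \<le> rr x * \<kappa>" using L_le_\<kappa> rr0 by (intro mult_left_mono) auto
  then have "(\<kappa> + rr x) * (L + rr x) \<le> \<kappa> * L + 2 * (\<kappa> * rr x) + (rr x)\<^sup>2"
    by (simp add: algebra_simps power2_eq_square)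
  then show ?thesis using \<kappa>rr_le[OF x] rr_sq_le[OF x] zz0[of x] EE0(1) by argo
qed

lemma cmod_ge_half: "(\<bar>a\<bar> + \<bar>b\<bar>) / 2 \<le> cmod (Complex a b)"
  using abs_Re_le_cmod[of "Complex a b"] abs_Im_le_cmod[of "Complex a b"] by simp

lemma cmod_le_sum: "cmod (Complex a b) \<le> \<bar>a\<bar> + \<bar>b\<bar>"
  using cmod_le[of "Complex a b"] by simp

text \<open>The real part of \<open>Vs\<close> controls \<open>zz\<close> and \<open>d\<close>, and
  the imaginary part \<open>- D\<close> controls \<mu> and the shift, by
  \<open>D_ge\<close>.\<close>

lemma Vs_ge:
  assumes x: "x \<in> {0..1}"
  shows "zz x + EE + \<kappa> * L \<le> 6 * A * cmod (Vs x)"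
proof -
  have A6: "zz x = 2 * A * (zz x / (2 * A))" using A1 by simp
  have "d \<le> 2 * A * d" "\<delta> + \<bar>\<mu>\<bar> \<le> A * (\<delta> + \<bar>\<mu>\<bar>)"
    using A1 d0 \<delta>0 mult_right_mono[of 1 "2 * A" d] mult_right_mono[of 1 A "\<delta> + \<bar>\<mu>\<bar>"] by auto
  then have "zz x + EE + \<kappa> * L
    \<le> 2 * A * (zz x / (2 * A) + d) + A * (\<delta> + \<bar>\<mu>\<bar>)"
    using A6 by (simp add: \<delta>_def distrib_left EE_def)
  also have "\<dots> \<le> 2 * A * \<bar>U x - \<nu>\<bar> + A * (3 * D)"
    using A1 D_ge by (intro add_mono mult_left_mono U_low[folded zz_def] x) auto
  also have "\<dots> \<le> A * (3 * (\<bar>U x - \<nu>\<bar> + \<bar>- D\<bar>))" using A1 D0 by (simp add: algebra_simps)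
  also have "\<dots> \<le> A * (6 * cmod (Vs x))"
    using A1 cmod_ge_half[of "U x - \<nu>" "- D"] by (intro mult_left_mono) (auto simp: Vs_def)
  finally show ?thesis by simp
qed

lemma Vs_low:
  assumes x: "x \<in> {0..1}"
  shows "(\<kappa> + rr x) * (L + rr x) \<le> C1 * cmod (Vs x)"
proof -
  have "0 \<le> A * cmod (Vs x)" using A1 by simp
  then show ?thesis using R_le[OF x] Vs_ge[OF x] unfolding C1_def by argo
qed

text \<open>To the right of the layer the lower bound holds without the shift. The integrated
  equation can thus be used there in its exact form, with no error term in \<open>u1\<close>. This
  is also the lemma that fixes \<open>C1 = 24 * A\<close>.\<close>

lemma V_low:
  assumes x: "x \<in> {0..1}" and xL: "xc + L \<le> x"
  shows "(\<kappa> + rr x) * (L + rr x) \<le> C1 * cmod (V x)"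
proof -
  have r: "L \<le> rr x" using xL L0 by (simp add: rr_def)
  have "\<kappa> * L \<le> zz x + EE"
  proof -
    from \<kappa>_cases consider "\<kappa> = xc" | "\<kappa> = L" | "\<kappa>\<^sup>2 = EE" unfolding EE_def by blast
    then show ?thesis
    proof cases
      case 1
      have "L * xc \<le> rr x * (x + xc)" using r x xc L0 by (intro mult_mono) auto
      then show ?thesis using 1 sq_diff[OF x] EE0 by (simp add: mult.commute)
    next
      case 2
      have "L * L \<le> rr x * (x + xc)" using r x xc L0 xL by (intro mult_mono) auto
      then show ?thesis using 2 sq_diff[OF x] EE0 by simp
    next
      case 3
      have "\<kappa> * L \<le> \<kappa>\<^sup>2" using L_le_\<kappa> \<kappa>0 by (simp add: power2_eq_square)
      then show ?thesis using 3 zz0[of x] by simp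
    qed
  qed
  then have "(\<kappa> + rr x) * (L + rr x) \<le> 6 * (zz x + EE)" using R_le[OF x] by argo
  also have "\<dots> \<le> 6 * (2 * A * (zz x / (2 * A) + d) + 2 * A * \<bar>\<mu>\<bar>)"
    using A1 d0 mult_right_mono[of 1 "2 * A" d] mult_right_mono[of 1 "2 * A" "\<bar>\<mu>\<bar>"]
    by (simp add: distrib_left EE_def)
  also have "\<dots> \<le> 6 * (2 * A * \<bar>U x - \<nu>\<bar> + 2 * A * \<bar>\<mu>\<bar>)"
    using A1 by (intro add_mono mult_left_mono U_low[folded zz_def] x) auto
  also have "\<dots> = C1 * ((\<bar>U x - \<nu>\<bar> + \<bar>\<mu>\<bar>) / 2)" by (simp add: C1_def algebra_simps)
  also have "\<dots> \<le> C1 * cmod (V x)"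
    unfolding V_eq by (intro mult_left_mono cmod_ge_half) (use C1_ge in auto)
  finally show ?thesis .
qed

text \<open>A sharper form of \<open>Vs_low\<close> with \<open>D / \<kappa>\<close> in place of
  \<open>L\<close>. When \<mu> is very negative, \<open>D\<close> far exceeds
  \<open>\<kappa> * L\<close>, and \<open>Vs_low\<close> alone would leave a factor
  \<open>D / \<kappa>\<close> instead of \<open>L\<close> in
  \<open>integral_near_le\<close>.\<close>

lemma Vs_near:
  assumes x: "x \<in> {0..1}"
  shows "(\<kappa> + rr x) * (D / \<kappa> + rr x) \<le> 26 * A * cmod (Vs x)"
proof -
  have "D \<le> 2 * \<kappa>\<^sup>2"
  proof -
    have "\<kappa> * L \<le> \<kappa>\<^sup>2" using L_le_\<kappa> \<kappa>0 by (simp add: power2_eq_square)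
    then show ?thesis using E_le d0 by (simp add: D_def \<delta>_def)
  qed
  then have "D / \<kappa> \<le> 2 * \<kappa>" using \<kappa>0 by (simp add: field_simps power2_eq_square)
  then have 1: "rr x * (D / \<kappa>) \<le> 2 * (\<kappa> * rr x)" using mult_left_mono[OF _ rr0, of "D / \<kappa>" "2 * \<kappa>" x] by (simp add: mult_ac)
  have "(\<kappa> + rr x) * (D / \<kappa> + rr x) = \<kappa> * (D / \<kappa>) + \<kappa> * rr x + rr x * (D / \<kappa>) + rr x * rr x"
    by (simp only: distrib_left distrib_right add.assoc add.commute add.left_commute)
  also have "\<kappa> * (D / \<kappa>) = D" using \<kappa>0 by simp
  finally have "(\<kappa> + rr x) * (D / \<kappa> + rr x) \<le> D + 3 * (\<kappa> * rr x) + (rr x)\<^sup>2"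
    using 1 by (simp add: power2_eq_square)
  also have "\<dots> \<le> 2 * cmod (Vs x) + 3 * (6 * A * cmod (Vs x)) + 6 * A * cmod (Vs x)"
  proof -
    have "D \<le> 2 * cmod (Vs x)" using cmod_ge_half[of "U x - \<nu>" "- D"] D0 by (simp add: Vs_def)
    moreover have "\<kappa> * rr x \<le> 6 * A * cmod (Vs x)" using \<kappa>rr_le[OF x] Vs_ge[OF x] by argo
    moreover have "(rr x)\<^sup>2 \<le> 6 * A * cmod (Vs x)"
      using rr_sq_le[OF x] Vs_ge[OF x] EE0(1) \<delta>0 unfolding \<delta>_def by argo
    ultimately show ?thesis by linarith
  qed
  also have "2 * cmod (Vs x) \<le> 2 * (A * cmod (Vs x))" using A1 mult_right_mono[of 1 A "cmod (Vs x)"] by simp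
  finally show ?thesis by simp
qed

lemma V_up: assumes x: "x \<in> {0..1}"
  shows "cmod (V x) \<le> 3 * A * (\<kappa>\<^sup>2 + x\<^sup>2)" "cmod (Vs x) \<le> 3 * A * (\<kappa>\<^sup>2 + x\<^sup>2)"
proof -
  have "xc\<^sup>2 \<le> \<kappa>\<^sup>2" using xc xc_le by (intro power_mono) auto
  then have "zz x \<le> \<kappa>\<^sup>2 + x\<^sup>2" using zero_le_power2[of x] zero_le_power2[of xc] unfolding zz_def by linarith
  then have 1: "A / 2 * zz x \<le> A / 2 * (\<kappa>\<^sup>2 + x\<^sup>2)" using A1 by (intro mult_left_mono) auto
  have 2: "\<kappa> * L \<le> \<kappa>\<^sup>2" using L_le_\<kappa> \<kappa>0 by (simp add: power2_eq_square)
  have 3: "2 * \<kappa>\<^sup>2 \<le> 5 / 2 * A * (\<kappa>\<^sup>2 + x\<^sup>2)"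
  proof -
    have "2 * \<kappa>\<^sup>2 \<le> (5 / 2 * A) * \<kappa>\<^sup>2" using A1 by (intro mult_right_mono) auto
    also have "\<dots> \<le> (5 / 2 * A) * (\<kappa>\<^sup>2 + x\<^sup>2)" using A1 by (intro mult_left_mono) auto
    finally show ?thesis .
  qed
  have "cmod (V x) \<le> \<bar>U x - \<nu>\<bar> + \<bar>\<mu>\<bar>" unfolding V_eq by (rule cmod_le_sum)
  then show "cmod (V x) \<le> 3 * A * (\<kappa>\<^sup>2 + x\<^sup>2)" using U_up[OF x, folded zz_def] 1 2 3 E_le zero_le_power2[of \<kappa>] by (simp add: algebra_simps)
  have "cmod (Vs x) \<le> \<bar>U x - \<nu>\<bar> + \<bar>D\<bar>" unfolding Vs_def using cmod_le_sum[of _ "- D"] by simp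
  moreover have "\<bar>D\<bar> \<le> \<kappa> * L + \<bar>\<mu>\<bar>" using D0 by (simp add: D_def \<delta>_def)
  ultimately show "cmod (Vs x) \<le> 3 * A * (\<kappa>\<^sup>2 + x\<^sup>2)" using U_up[OF x, folded zz_def] 1 2 3 E_le by (simp add: algebra_simps)
qed

lemma Vs_nz: "Vs x \<noteq> 0" using D0 by (simp add: Vs_def complex_eq_iff)

lemma Vs_alt: "Vs x = V x - \<i> * of_real \<delta>" by (simp add: Vs_def V_eq D_def complex_eq_iff)

lemma cVs: "continuous_on {0..1} Vs" unfolding Vs_alt[abs_def] by (intro continuous_intros cV)

lemma dVs: "x \<in> {0..1} \<Longrightarrow> (Vs has_vector_derivative of_real (U1 x)) (at x within {0..1})"
  unfolding Vs_alt[abs_def] by (auto intro!: derivative_eq_intros dV)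

lemma inv_\<beta>: "1 / \<beta> = \<kappa> * L ^ 3" using \<beta>\<kappa>L beta by (simp add: field_simps)

lemma B_nonneg: "0 \<le> B"
  unfolding B_def using \<kappa>0 L0 X_nonneg Phi h_nonneg by (intro add_nonneg_nonneg divide_nonneg_nonneg mult_nonneg_nonneg) auto

lemma W_nonneg: "0 \<le> W"
  unfolding W_def using B_nonneg P_nonneg Q_nonneg \<kappa>0 by simp

lemma \<kappa>2B: "\<kappa>\<^sup>2 * B = \<kappa> * (L * sqrt L * X + L\<^sup>2 * \<Phi>) + \<alpha>\<^sup>2 * h / L"
  unfolding B_def using \<kappa>0 L0 by (simp add: distrib_left power2_eq_square field_simps)

lemma cont_kernel: "continuous_on {0..1} (\<lambda>x. 1 / (L + rr x)\<^sup>2)"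
  by (intro continuous_intros c_rr) (use L0 rr0 in \<open>auto simp: add_pos_nonneg less_imp_neq[symmetric]\<close>)

section \<open>Bounds from the integrated equation\<close>

definition "Src x = (cmod (\<phi>1 x) + \<Phi>) / \<beta> + \<alpha>\<^sup>2 * h"

lemma Src_nonneg: "0 \<le> Src x" unfolding Src_def using Phi beta h_nonneg by simp

lemma cSrc: "continuous_on {0..1} Src"
  unfolding Src_def[abs_def] by (intro continuous_intros c\<phi>1) (use beta in auto)

text \<open>The part with \<open>\<phi>1\<close> is paired with the kernel by Cauchy-Schwarz, where
  \<open>integral_kernel4\<close> gives L^(-3/2); the constant part uses
  \<open>integral_kernel2\<close>. Rewriting 1/\<beta> as \<open>\<kappa> * L ^ 3\<close> produces
  the three terms of \<open>B\<close>.\<close>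

lemma integral_Src: "integral {0..1} (\<lambda>x. Src x * (1 / (L + rr x)\<^sup>2)) \<le> 2 * \<kappa>\<^sup>2 * B"
proof -
  let ?k = "\<lambda>x. 1 / (L + rr x)\<^sup>2"
  have k2: "integral {0..1} ?k \<le> 2 / L" unfolding rr_def using integral_kernel2[OF L0 xc] .
  have k4: "integral {0..1} (\<lambda>x. (?k x)\<^sup>2) \<le> 1 / L ^ 3"
    using integral_kernel4[OF L0 xc] by (simp add: rr_def power_divide flip: power_mult)
  have "integral {0..1} (\<lambda>x. cmod (\<phi>1 x) * ?k x) \<le> X * sqrt (integral {0..1} (\<lambda>x. (?k x)\<^sup>2))"
    unfolding X_def nrm_def by (rule integral_mult_le_sqrt) (intro continuous_intros c\<phi>1 cont_kernel)+
  also have "\<dots> \<le> X * sqrt (1 / L ^ 3)" by (intro mult_left_mono real_sqrt_le_mono k4 X_nonneg)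
  also have "sqrt (1 / L ^ 3) = 1 / (L * sqrt L)"
    using L0 by (simp add: real_sqrt_divide power3_eq_cube real_sqrt_mult)
  finally have 1: "integral {0..1} (\<lambda>x. cmod (\<phi>1 x) * ?k x) \<le> X * (1 / (L * sqrt L))" .
  have "integral {0..1} (\<lambda>x. Src x * ?k x) =
    integral {0..1} (\<lambda>x. 1 / \<beta> * (cmod (\<phi>1 x) * ?k x) + (\<Phi> / \<beta> + \<alpha>\<^sup>2 * h) * ?k x)"
    by (rule integral_cong) (simp add: Src_def add_divide_distrib distrib_right distrib_left)
  also have "\<dots> = 1 / \<beta> * integral {0..1} (\<lambda>x. cmod (\<phi>1 x) * ?k x) + (\<Phi> / \<beta> + \<alpha>\<^sup>2 * h) * integral {0..1} ?k"
    by (subst integral_add)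
       (auto intro!: integrable_continuous_interval continuous_on_mult_left continuous_on_mult c\<phi>1 cont_kernel continuous_on_norm
          simp del: times_divide_eq_right times_divide_eq_left mult_1)
  also have "\<dots> \<le> 1 / \<beta> * (X * (1 / (L * sqrt L))) + (\<Phi> / \<beta> + \<alpha>\<^sup>2 * h) * (2 / L)"
    using beta Phi h_nonneg by (intro add_mono mult_left_mono 1 k2) auto
  also have "\<dots> = \<kappa> * L ^ 3 * (X * (1 / (L * sqrt L))) + (\<Phi> * (\<kappa> * L ^ 3) + \<alpha>\<^sup>2 * h) * (2 / L)"
    unfolding inv_\<beta>[symmetric] by simp
  also have "\<dots> = \<kappa> * (L * sqrt L * X) + 2 * (\<kappa> * (L\<^sup>2 * \<Phi>)) + 2 * (\<alpha>\<^sup>2 * h / L)"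
  proof -
    have s: "L ^ 3 * (1 / (L * sqrt L)) = L * sqrt L"
      using L0 real_div_sqrt[of L] by (simp add: power3_eq_cube field_simps)
    have "\<kappa> * L ^ 3 * (X * (1 / (L * sqrt L))) = \<kappa> * X * (L ^ 3 * (1 / (L * sqrt L)))" by (simp only: mult_ac)
    also have "\<dots> = \<kappa> * (L * sqrt L * X)" unfolding s by (simp only: mult_ac)
    finally have a: "\<kappa> * L ^ 3 * (X * (1 / (L * sqrt L))) = \<kappa> * (L * sqrt L * X)" .
    have b: "(\<Phi> * (\<kappa> * L ^ 3) + \<alpha>\<^sup>2 * h) * (2 / L) = 2 * (\<kappa> * (L\<^sup>2 * \<Phi>)) + 2 * (\<alpha>\<^sup>2 * h / L)"
      using L0 by (simp add: field_simps power3_eq_cube power2_eq_square)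
    show ?thesis using a b by simp
  qed
  also have "\<dots> \<le> 2 * \<kappa>\<^sup>2 * B"
  proof -
    have "0 \<le> \<kappa> * (L * sqrt L * X)" using \<kappa>0 L0 X_nonneg by simp
    moreover have "2 * \<kappa>\<^sup>2 * B = 2 * (\<kappa> * (L * sqrt L * X)) + 2 * (\<kappa> * (L\<^sup>2 * \<Phi>)) + 2 * (\<alpha>\<^sup>2 * h / L)"
      using \<kappa>2B by (simp add: distrib_left)
    ultimately show ?thesis by linarith
  qed
  finally show ?thesis .
qed

lemma inv_sq_le:
  assumes "(\<kappa> + rr x) * (L + rr x) \<le> C1 * v" "0 \<le> v" "0 \<le> x"
  shows "1 / v\<^sup>2 \<le> C1\<^sup>2 / \<kappa>\<^sup>2 * (1 / (L + rr x)\<^sup>2)"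
    and "(\<kappa>\<^sup>2 + x\<^sup>2) / v\<^sup>2 \<le> 2 * C1\<^sup>2 * (1 / (L + rr x)\<^sup>2)"
proof -
  have p: "0 < \<kappa> + rr x" "0 < L + rr x" using \<kappa>0 L0 rr0[of x] by auto
  then have "0 < C1 * v" using assms(1) mult_pos_pos by (smt (verit))
  then have v: "0 < v" using C1_ge by (simp add: zero_less_mult_iff)
  have 0: "((\<kappa> + rr x) * (L + rr x))\<^sup>2 \<le> (C1 * v)\<^sup>2" using p by (intro power_mono assms) auto
  then have 1: "(\<kappa> + rr x)\<^sup>2 / v\<^sup>2 \<le> C1\<^sup>2 * (1 / (L + rr x)\<^sup>2)"
    unfolding power_mult_distrib using p v by (simp add: pos_divide_le_eq pos_le_divide_eq mult.commute)
  have "\<kappa>\<^sup>2 \<le> (\<kappa> + rr x)\<^sup>2" using \<kappa>0 rr0 by (intro power_mono) auto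
  then have "\<kappa>\<^sup>2 / v\<^sup>2 \<le> C1\<^sup>2 * (1 / (L + rr x)\<^sup>2)" using 1 v by (smt (verit) divide_right_mono zero_le_power2)
  from divide_right_mono[OF this, of "\<kappa>\<^sup>2"]
  show "1 / v\<^sup>2 \<le> C1\<^sup>2 / \<kappa>\<^sup>2 * (1 / (L + rr x)\<^sup>2)" using \<kappa>0 by (simp add: mult.commute)
  have "x\<^sup>2 \<le> (\<kappa> + rr x)\<^sup>2" using x_le assms(3) by (intro power_mono) auto
  then have "\<kappa>\<^sup>2 + x\<^sup>2 \<le> 2 * (\<kappa> + rr x)\<^sup>2" using \<open>\<kappa>\<^sup>2 \<le> (\<kappa> + rr x)\<^sup>2\<close> by simp
  then have "(\<kappa>\<^sup>2 + x\<^sup>2) / v\<^sup>2 \<le> 2 * ((\<kappa> + rr x)\<^sup>2 / v\<^sup>2)" by (metis divide_right_mono times_divide_eq_right zero_le_power2)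
  then show "(\<kappa>\<^sup>2 + x\<^sup>2) / v\<^sup>2 \<le> 2 * C1\<^sup>2 * (1 / (L + rr x)\<^sup>2)" using 1 by simp
qed


text \<open>A value of \<open>u1\<close> next to the layer obtained from the unshifted equation: on
  [s0, 1] one may divide by \<open>V\<close>, start from \<open>u 1 = 0\<close>, and read off
  \<open>u1 s0\<close>. Without such a value the bound for \<open>w\<close>, which involves
  \<open>u1\<close>, would be circular.\<close>

lemma exists_reference_point:
  obtains s0 where "s0 \<in> {0..1}" "cmod (u1 s0) \<le> C3 * \<kappa> * B"
    "\<And>s. s \<in> {0..1} \<Longrightarrow> \<bar>s - s0\<bar> \<le> 2 * (L + rr s)"
proof (cases "xc + 2 * L \<le> 1")
  case False
  \<comment> \<open>The layer reaches the wall, where \<open>u1 1 = 0\<close> serves as the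
    reference value.\<close>
  show ?thesis
  proof (rule that[of 1])
    show "cmod (u1 1) \<le> C3 * \<kappa> * B" using u1_1 C3_ge \<kappa>0 B_nonneg by simp
    fix s :: real assume "s \<in> {0..1}"
    then show "\<bar>s - 1\<bar> \<le> 2 * (L + rr s)" using False L0 xc by (auto simp: rr_def abs_if)
  qed simp
next
  case True
  have sub: "{xc + L..xc + 2 * L} \<subseteq> {0..1}" using True xc L0 by auto
  \<comment> \<open>Averaging over an interval of length \<open>L\<close> beside the layer provides
    a point where \<open>\<phi>1\<close> is at most \<open>X / sqrt L\<close>, as
    \<open>G_le\<close> needs a pointwise value.\<close>
  obtain s0 where s0: "s0 \<in> {xc + L..xc + 2 * L}"
    and "(cmod (\<phi>1 s0))\<^sup>2 * (xc + 2 * L - (xc + L)) \<le> integral {xc + L..xc + 2 * L} (\<lambda>x. (cmod (\<phi>1 x))\<^sup>2)"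
  proof (rule exists_le_average)
    show "xc + L < xc + 2 * L" using L0 by simp
    show "continuous_on {xc + L..xc + 2 * L} (\<lambda>x. (cmod (\<phi>1 x))\<^sup>2)"
      by (rule continuous_on_subset[OF _ sub]) (intro continuous_intros c\<phi>1)
  qed
  note this(2)
  also have "integral {xc + L..xc + 2 * L} (\<lambda>x. (cmod (\<phi>1 x))\<^sup>2) \<le> integral {0..1} (\<lambda>x. (cmod (\<phi>1 x))\<^sup>2)"
    by (rule integral_subinterval_le) (use True xc L0 in \<open>auto intro!: continuous_intros c\<phi>1\<close>)
  also have "\<dots> = X\<^sup>2" by (simp add: X_def nrm_square[OF c\<phi>1])
  finally have "(cmod (\<phi>1 s0) * sqrt L)\<^sup>2 \<le> X\<^sup>2" using L0 by (simp add: power_mult_distrib)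
  then have "cmod (\<phi>1 s0) * sqrt L \<le> X" by (rule power2_le_imp_le) (rule X_nonneg)
  then have ph: "cmod (\<phi>1 s0) \<le> X / sqrt L" using L0 by (simp add: pos_le_divide_eq)
  have s01: "s0 \<in> {0..1}" using s0 sub by auto
  have Vlow: "(\<kappa> + rr x) * (L + rr x) \<le> C1 * cmod (V x)" if "x \<in> {s0..1}" for x
    by (rule V_low) (use that s0 s01 in auto)
  have Vnz: "V x \<noteq> 0" if "x \<in> {s0..1}" for x
  proof
    assume "V x = 0"
    then have "(\<kappa> + rr x) * (L + rr x) \<le> 0" using Vlow[OF that] by simp
    moreover have "0 < (\<kappa> + rr x) * (L + rr x)" using \<kappa>0 L0 rr0[of x] by (intro mult_pos_pos) auto
    ultimately show False by simp
  qed
  define w0 where "w0 x = u x / V x" for x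
  have subs: "{s0..1} \<subseteq> {0..1}" using s01 by auto
  have dw: "(w0 has_vector_derivative G x / (V x)\<^sup>2) (at x within {s0..1})" if x: "x \<in> {s0..1}" for x
  proof -
    have x1: "x \<in> {0..1}" using x subs by auto
    have "((\<lambda>x. u x / V x) has_vector_derivative (u1 x * V x - u x * of_real (U1 x)) / (V x)\<^sup>2) (at x within {s0..1})"
      by (rule has_vector_derivative_quotient[OF has_vector_derivative_within_subset[OF du[OF x1] subs]
            has_vector_derivative_within_subset[OF dV[OF x1] subs] Vnz[OF x]])
    then show ?thesis unfolding w0_def[abs_def] by (simp add: G_eq mult.commute)
  qed
  have cw: "continuous_on {s0..1} (\<lambda>x. G x / (V x)\<^sup>2)"
    by (intro continuous_intros continuous_on_subset[OF cG subs] continuous_on_subset[OF cV subs]) (use Vnz in auto)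
  have "cmod (w0 1 - w0 s0) \<le> integral {s0..1} (\<lambda>x. cmod (G x / (V x)\<^sup>2))"
    by (rule norm_diff_le_integral[OF _ dw cw]) (use s01 in auto)
  also have "\<dots> \<le> integral {s0..1} (\<lambda>x. C1\<^sup>2 / \<kappa>\<^sup>2 * (Src x * (1 / (L + rr x)\<^sup>2)))"
  proof (rule integral_le)
    show "(\<lambda>x. cmod (G x / (V x)\<^sup>2)) integrable_on {s0..1}"
      by (intro integrable_continuous_interval continuous_on_norm cw)
    show "(\<lambda>x. C1\<^sup>2 / \<kappa>\<^sup>2 * (Src x * (1 / (L + rr x)\<^sup>2))) integrable_on {s0..1}"
      by (rule integrable_continuous_interval, rule continuous_on_subset[OF _ subs])
         (intro continuous_on_mult_left continuous_on_mult cSrc cont_kernel)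
    fix x assume x: "x \<in> {s0..1}"
    then have x1: "x \<in> {0..1}" using subs by auto
    have "cmod (G x / (V x)\<^sup>2) = cmod (G x) * (1 / (cmod (V x))\<^sup>2)" by (simp add: norm_divide norm_power)
    also have "\<dots> \<le> Src x * (C1\<^sup>2 / \<kappa>\<^sup>2 * (1 / (L + rr x)\<^sup>2))"
      using G_le[OF x1] Src_nonneg[of x]
      by (intro mult_mono inv_sq_le(1)[OF Vlow[OF x]]) (use x1 in \<open>auto simp: Src_def\<close>)
    finally show "cmod (G x / (V x)\<^sup>2) \<le> C1\<^sup>2 / \<kappa>\<^sup>2 * (Src x * (1 / (L + rr x)\<^sup>2))" by (simp add: mult_ac)
  qed
  also have "\<dots> \<le> integral {0..1} (\<lambda>x. C1\<^sup>2 / \<kappa>\<^sup>2 * (Src x * (1 / (L + rr x)\<^sup>2)))"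
    by (rule integral_subinterval_le, (intro continuous_on_mult_left continuous_on_mult cSrc cont_kernel))
       (use s01 Src_nonneg in auto)
  also have "\<dots> = C1\<^sup>2 / \<kappa>\<^sup>2 * integral {0..1} (\<lambda>x. Src x * (1 / (L + rr x)\<^sup>2))" by (rule integral_mult_right)
  also have "\<dots> \<le> C1\<^sup>2 / \<kappa>\<^sup>2 * (2 * \<kappa>\<^sup>2 * B)" by (intro mult_left_mono integral_Src) auto
  also have "\<dots> = 2 * C1\<^sup>2 * B" using \<kappa>0 by simp
  finally have w0: "cmod (w0 s0) \<le> 2 * C1\<^sup>2 * B" by (simp add: w0_def u_1)
  \<comment> \<open>The definition of \<open>G\<close> solved for \<open>u1\<close>. Since
    \<open>\<bar>U1\<bar>\<close> is at most a multiple of \<kappa> at \<open>s0\<close>, both terms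
    are of size \<open>\<kappa> * B\<close>.\<close>
  have u1s0: "u1 s0 = G s0 / V s0 + of_real (U1 s0) * w0 s0"
    using Vnz[of s0] s01 by (simp add: G_eq w0_def field_simps)
  have V1: "\<kappa> * L \<le> C1 * cmod (V s0)"
  proof -
    have "\<kappa> * L \<le> (\<kappa> + rr s0) * (L + rr s0)" using \<kappa>0 L0 rr0 by (intro mult_mono) auto
    then show ?thesis using Vlow[of s0] s01 by simp
  qed
  have Vp: "0 < cmod (V s0)" using Vnz[of s0] s01 by simp
  have GV: "cmod (G s0 / V s0) \<le> C1 * \<kappa> * B"
  proof -
    have "cmod (G s0) \<le> (cmod (\<phi>1 s0) + \<Phi>) / \<beta> + \<alpha>\<^sup>2 * h" by (rule G_le[OF s01])
    also have "\<dots> \<le> (X / sqrt L + \<Phi>) / \<beta> + \<alpha>\<^sup>2 * h" using ph beta by (intro add_mono divide_right_mono) auto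
    also have "\<dots> = (X / sqrt L + \<Phi>) * (\<kappa> * L ^ 3) + \<alpha>\<^sup>2 * h" unfolding inv_\<beta>[symmetric] by simp
    also have "\<dots> = \<kappa> * L * (\<kappa> * B)"
    proof -
      have "L ^ 3 / sqrt L = L * (L * sqrt L)" using L0 real_div_sqrt[of L]
        by (simp add: power3_eq_cube field_simps)
      moreover have "(X / sqrt L + \<Phi>) * (\<kappa> * L ^ 3) = \<kappa> * X * (L ^ 3 / sqrt L) + \<kappa> * L * (L\<^sup>2 * \<Phi>)"
        by (simp add: distrib_right power3_eq_cube power2_eq_square)
      ultimately have "(X / sqrt L + \<Phi>) * (\<kappa> * L ^ 3) = \<kappa> * L * (L * sqrt L * X + L\<^sup>2 * \<Phi>)"
        by (simp only: distrib_left mult_ac)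
      moreover have "\<kappa> * L * (\<kappa> * B) = L * (\<kappa>\<^sup>2 * B)" by (simp add: power2_eq_square)
      moreover have "L * (\<kappa>\<^sup>2 * B) = \<kappa> * L * (L * sqrt L * X + L\<^sup>2 * \<Phi>) + \<alpha>\<^sup>2 * h"
        unfolding \<kappa>2B using L0 by (simp add: distrib_left)
      ultimately show ?thesis by simp
    qed
    also have "\<dots> \<le> C1 * cmod (V s0) * (\<kappa> * B)" using V1 \<kappa>0 B_nonneg by (intro mult_right_mono) auto
    finally show ?thesis using Vp by (simp add: norm_divide pos_divide_le_eq mult_ac)
  qed
  have "\<bar>U1 s0\<bar> \<le> A * s0" by (rule abs_U1_le[OF s01])
  also have "\<dots> \<le> A * (3 * \<kappa>)" using s0 xc_le L_le_\<kappa> A1 by (intro mult_left_mono) auto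
  finally have "cmod (of_real (U1 s0) * w0 s0) \<le> (A * (3 * \<kappa>)) * (2 * C1\<^sup>2 * B)"
    unfolding norm_mult norm_of_real using w0 A1 \<kappa>0 by (intro mult_mono) auto
  then have "cmod (u1 s0) \<le> C1 * \<kappa> * B + 6 * A * C1\<^sup>2 * (\<kappa> * B)"
    unfolding u1s0 using GV norm_triangle_ineq[of "G s0 / V s0" "of_real (U1 s0) * w0 s0"] by (simp add: mult_ac)
  also have "C1 * \<kappa> * B \<le> A * C1\<^sup>2 * (\<kappa> * B)"
  proof -
    have "1 * (1 * C1) \<le> A * (C1 * C1)" using A1 C1_ge by (intro mult_mono) auto
    then have "C1 * (\<kappa> * B) \<le> A * C1\<^sup>2 * (\<kappa> * B)" using \<kappa>0 B_nonneg by (intro mult_right_mono) (auto simp: power2_eq_square)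
    then show ?thesis by (simp add: mult_ac)
  qed
  finally have fin: "cmod (u1 s0) \<le> C3 * \<kappa> * B" by (simp add: C3_def mult_ac)
  show ?thesis
  proof (rule that[OF s01 fin])
    fix s :: real assume "s \<in> {0..1}"
    then show "\<bar>s - s0\<bar> \<le> 2 * (L + rr s)" using s0 L0 by (auto simp: rr_def abs_if)
  qed
qed

text \<open>The increment of \<open>u1\<close> is bounded by a multiple of \<open>P\<close> times
  the square root of the distance, and by a multiple of \<open>Q\<close> times the distance; the
  geometric mean gives the power 3/4. The first bound alone would put into \<open>P_step\<close> a
  multiple of \<open>P\<^sup>2\<close> that is not small, the second alone would make the kernel
  integral logarithmic.\<close>

lemma u1_le:
  assumes s: "s \<in> {0..1}"
  shows "cmod (u1 s) \<le> C3 * \<kappa> * B + 4 * sqrt (P * Q) * (L + rr s) powr (3/4)"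
proof -
  obtain s0 where s0: "s0 \<in> {0..1}" "cmod (u1 s0) \<le> C3 * \<kappa> * B"
    and dist: "\<And>s. s \<in> {0..1} \<Longrightarrow> \<bar>s - s0\<bar> \<le> 2 * (L + rr s)"
    by (rule exists_reference_point) blast
  define e where "e = \<bar>s - s0\<bar>"
  have e0: "0 \<le> e" by (simp add: e_def)
  have a: "cmod (u1 s - u1 s0) \<le> sqrt e * (2 * P)"
    using norm_diff_le_nrm[OF du1 cu2 s0(1) s] mult_left_mono[OF nrm_u2_le, of "sqrt e"]
    by (simp add: e_def)
  have b: "cmod (u1 s - u1 s0) \<le> e * (2 * Q)"
  proof -
    have gen: "cmod (u1 b - u1 a) \<le> (b - a) * (2 * Q)" if "0 \<le> a" "a \<le> b" "b \<le> 1" for a b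
    proof -
      have "cmod (u1 b - u1 a) \<le> integral {a..b} (\<lambda>x. cmod (u2 x))"
        by (rule norm_diff_le_integral_01[OF du1 cu2 that])
      also have "\<dots> \<le> integral {a..b} (\<lambda>x. 2 * Q)"
        by (intro integral_le integrable_continuous_interval continuous_on_norm continuous_on_subset[OF cu2] continuous_on_const u2_le_Q)
           (use that in auto)
      finally show ?thesis using that by (simp add: algebra_simps)
    qed
    show ?thesis
      using gen[of s s0] gen[of s0 s] s s0(1) by (cases "s \<le> s0") (auto simp: e_def norm_minus_commute)
  qed
  have "(cmod (u1 s - u1 s0))\<^sup>2 \<le> (sqrt e * (2 * P)) * (e * (2 * Q))"
    unfolding power2_eq_square using a b P_nonneg e0 by (intro mult_mono) auto
  also have "\<dots> = (2 * sqrt (P * Q) * e powr (3/4))\<^sup>2"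
  proof -
    have "(e powr (3/4))\<^sup>2 = sqrt e * e"
    proof (cases "e = 0")
      case False
      then have ep: "e > 0" using e0 by simp
      have "(e powr (3/4))\<^sup>2 = e powr (1/2 + 1)"
        by (simp add: power2_eq_square flip: powr_add)
      also have "\<dots> = sqrt e * e" using ep by (simp only: powr_add powr_half_sqrt[OF e0] powr_one[OF e0])
      finally show ?thesis .
    qed simp
    then show ?thesis using P_nonneg Q_nonneg by (simp add: power_mult_distrib mult_ac)
  qed
  finally have "cmod (u1 s - u1 s0) \<le> 2 * sqrt (P * Q) * e powr (3/4)"
    by (rule power2_le_imp_le) (simp add: P_nonneg Q_nonneg)
  also have "\<dots> \<le> 2 * sqrt (P * Q) * (2 * (L + rr s) powr (3/4))"
  proof (intro mult_left_mono)
    have "e powr (3/4) \<le> (2 * (L + rr s)) powr (3/4)" using dist[OF s] e0 by (intro powr_mono2) (auto simp: e_def)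
    also have "\<dots> = 2 powr (3/4) * (L + rr s) powr (3/4)" using L0 rr0 by (intro powr_mult)
    also have "\<dots> \<le> 2 powr 1 * (L + rr s) powr (3/4)" by (intro mult_right_mono powr_mono) auto
    finally show "e powr (3/4) \<le> 2 * (L + rr s) powr (3/4)" by simp
  qed (simp add: P_nonneg Q_nonneg)
  finally show ?thesis using s0(2) norm_triangle_ineq[of "u1 s0" "u1 s - u1 s0"] by simp
qed

section \<open>Decay of \<open>w = u / Vs\<close>\<close>

lemma om_pos: "0 < om x" using \<kappa>0 by (simp add: om_def add_pos_nonneg)

text \<open>The shift is constant, so \<open>Vs\<close> has the derivative of \<open>V\<close> and
  the quotient rule again yields \<open>G\<close>, up to the term with \<delta>.\<close>

lemma dw: "x \<in> {0..1} \<Longrightarrow> (w has_vector_derivative (G x - \<i> * of_real \<delta> * u1 x) / (Vs x)\<^sup>2) (at x within {0..1})"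
  using has_vector_derivative_quotient[OF du dVs Vs_nz, of x]
  unfolding w_def[abs_def] by (simp add: G_eq Vs_alt algebra_simps)

lemma cw: "continuous_on {0..1} w"
  unfolding w_def[abs_def] by (intro continuous_intros cu cVs) (simp add: Vs_nz)

lemma cdw: "continuous_on {0..1} (\<lambda>x. (G x - \<i> * of_real \<delta> * u1 x) / (Vs x)\<^sup>2)"
  by (intro continuous_intros cG cu1 cVs) (simp add: Vs_nz)

lemma w_1: "w 1 = 0" by (simp add: w_def u_1)

lemma integral_kernel_powr:
  "integral {0..1} (\<lambda>x. (L + rr x) powr (3/4) * (1 / (L + rr x)\<^sup>2)) \<le> 8 * L powr (-1/4)"
proof -
  have "(L + rr x) powr (3/4) * (1 / (L + rr x)\<^sup>2) = (L + \<bar>x - xc\<bar>) powr (-5/4)" for x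
  proof -
    have p: "0 < L + rr x" using L0 rr0[of x] by simp
    then have "1 / (L + rr x)\<^sup>2 = (L + rr x) powr (-2)" by (simp add: powr_minus powr_numeral divide_inverse)
    then show ?thesis by (simp add: rr_def flip: powr_add)
  qed
  then show ?thesis using integral_kernel54[OF L0 xc] by simp
qed

text \<open>Integrate the derivative of \<open>w\<close> back from \<open>w 1 = 0\<close>. The
  weight increases, so \<open>om x \<le> om s\<close> carries it under the integral, where it costs
  only a constant by \<open>inv_sq_le\<close>. The three kernel integrals then give the source, the
  reference value of \<open>u1\<close>, and its growth.\<close>

lemma om_w_le:
  assumes x: "x \<in> {0..1}"
  shows "om x * cmod (w x) \<le> C4 * W"
proof -
  let ?k = "\<lambda>x. 1 / (L + rr x)\<^sup>2"
  let ?b = "\<lambda>x. Src x * ?k x + (\<delta> * (C3 * \<kappa> * B) * ?k x + \<delta> * (4 * sqrt (P * Q)) * ((L + rr x) powr (3/4) * ?k x))"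
  have cp: "continuous_on {0..1} (\<lambda>x. (L + rr x) powr (3/4))"
    by (intro continuous_intros c_rr) (use L0 rr0 in \<open>auto simp: add_pos_nonneg less_imp_neq[symmetric]\<close>)
  have cb: "continuous_on {0..1} ?b"
    by (intro continuous_on_add continuous_on_mult_left continuous_on_mult cSrc cont_kernel cp)
  have sub: "{x..1} \<subseteq> {0..1}" using x by auto
  have "cmod (w x) = cmod (w 1 - w x)" by (simp add: w_1)
  also have "\<dots> \<le> integral {x..1} (\<lambda>s. cmod ((G s - \<i> * of_real \<delta> * u1 s) / (Vs s)\<^sup>2))"
    by (rule norm_diff_le_integral_01[OF dw cdw]) (use x in auto)
  finally have "om x * cmod (w x) \<le> om x * integral {x..1} (\<lambda>s. cmod ((G s - \<i> * of_real \<delta> * u1 s) / (Vs s)\<^sup>2))"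
    using om_pos[of x] by (intro mult_left_mono) auto
  also have "\<dots> = integral {x..1} (\<lambda>s. om x * cmod ((G s - \<i> * of_real \<delta> * u1 s) / (Vs s)\<^sup>2))" by simp
  also have "\<dots> \<le> integral {x..1} (\<lambda>s. 2 * C1\<^sup>2 / \<kappa>\<^sup>2 * ?b s)"
  proof (rule integral_le)
    show "(\<lambda>s. om x * cmod ((G s - \<i> * of_real \<delta> * u1 s) / (Vs s)\<^sup>2)) integrable_on {x..1}"
      by (intro integrable_continuous_interval continuous_on_mult_left continuous_on_norm continuous_on_subset[OF cdw sub])
    show "(\<lambda>s. 2 * C1\<^sup>2 / \<kappa>\<^sup>2 * ?b s) integrable_on {x..1}"
      by (intro integrable_continuous_interval continuous_on_mult_left continuous_on_subset[OF cb sub])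
    fix s assume s: "s \<in> {x..1}"
    then have s1: "s \<in> {0..1}" using sub by auto
    have num: "cmod (G s - \<i> * of_real \<delta> * u1 s)
      \<le> Src s + \<delta> * (C3 * \<kappa> * B + 4 * sqrt (P * Q) * (L + rr s) powr (3/4))"
    proof -
      have "cmod (\<i> * of_real \<delta> * u1 s) \<le> \<delta> * (C3 * \<kappa> * B + 4 * sqrt (P * Q) * (L + rr s) powr (3/4))"
        using u1_le[OF s1] \<delta>0 by (simp add: norm_mult mult_left_mono)
      then show ?thesis using G_le[OF s1] norm_triangle_ineq4[of "G s" "\<i> * of_real \<delta> * u1 s"] by (simp add: Src_def)
    qed
    have om_le: "om x \<le> om s"
    proof -
      have "x\<^sup>2 \<le> s\<^sup>2" using s x by (intro power_mono) auto
      then show ?thesis unfolding om_def by (intro divide_right_mono) auto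
    qed
    have den: "om s * (1 / (cmod (Vs s))\<^sup>2) \<le> 2 * C1\<^sup>2 / \<kappa>\<^sup>2 * ?k s"
      using divide_right_mono[OF inv_sq_le(2)[OF Vs_low[OF s1]], of "\<kappa>\<^sup>2"] s1
      by (simp add: om_def mult.commute)
    have "om x * cmod ((G s - \<i> * of_real \<delta> * u1 s) / (Vs s)\<^sup>2)
      = cmod (G s - \<i> * of_real \<delta> * u1 s) * (om x * (1 / (cmod (Vs s))\<^sup>2))"
      by (simp add: norm_divide norm_power)
    also have "\<dots> \<le> cmod (G s - \<i> * of_real \<delta> * u1 s) * (om s * (1 / (cmod (Vs s))\<^sup>2))"
      by (intro mult_left_mono mult_right_mono om_le) auto
    also have "\<dots> \<le> (Src s + \<delta> * (C3 * \<kappa> * B + 4 * sqrt (P * Q) * (L + rr s) powr (3/4))) * (2 * C1\<^sup>2 / \<kappa>\<^sup>2 * ?k s)"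
    proof (rule mult_mono[OF num den])
      show "0 \<le> Src s + \<delta> * (C3 * \<kappa> * B + 4 * sqrt (P * Q) * (L + rr s) powr (3/4))"
        using order_trans[OF norm_ge_zero num] .
      show "0 \<le> om s * (1 / (cmod (Vs s))\<^sup>2)" using om_pos[of s] by (intro mult_nonneg_nonneg) auto
    qed
    also have "\<dots> = 2 * C1\<^sup>2 / \<kappa>\<^sup>2 * ?b s"
      by (simp only: distrib_left distrib_right mult_ac)
    finally show "om x * cmod ((G s - \<i> * of_real \<delta> * u1 s) / (Vs s)\<^sup>2) \<le> 2 * C1\<^sup>2 / \<kappa>\<^sup>2 * ?b s" .
  qed
  also have "\<dots> \<le> integral {0..1} (\<lambda>s. 2 * C1\<^sup>2 / \<kappa>\<^sup>2 * ?b s)"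
  proof (rule integral_subinterval_le)
    show "continuous_on {0..1} (\<lambda>s. 2 * C1\<^sup>2 / \<kappa>\<^sup>2 * ?b s)" by (intro continuous_on_mult_left cb)
    fix s
    show "0 \<le> 2 * C1\<^sup>2 / \<kappa>\<^sup>2 * ?b s"
      using Src_nonneg[of s] \<delta>0 C3_ge \<kappa>0 B_nonneg P_nonneg Q_nonneg
      by (intro mult_nonneg_nonneg add_nonneg_nonneg) auto
  qed (use x in auto)
  also have "\<dots> = 2 * C1\<^sup>2 / \<kappa>\<^sup>2 * integral {0..1} ?b" by (rule integral_mult_right)
  also have "integral {0..1} ?b = integral {0..1} (\<lambda>x. Src x * ?k x) + (\<delta> * (C3 * \<kappa> * B) * integral {0..1} ?k
      + \<delta> * (4 * sqrt (P * Q)) * integral {0..1} (\<lambda>x. (L + rr x) powr (3/4) * ?k x))"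
    by (subst integral_add, (intro integrable_continuous_interval continuous_on_add continuous_on_mult_left continuous_on_mult cSrc cont_kernel cp)+,
        subst integral_add, (intro integrable_continuous_interval continuous_on_add continuous_on_mult_left continuous_on_mult cSrc cont_kernel cp)+,
        subst integral_mult_right, subst integral_mult_right, rule refl)
  also have "2 * C1\<^sup>2 / \<kappa>\<^sup>2 * \<dots> \<le> 2 * C1\<^sup>2 / \<kappa>\<^sup>2 * (2 * \<kappa>\<^sup>2 * B + (\<delta> * (C3 * \<kappa> * B) * (2 / L)
      + \<delta> * (4 * sqrt (P * Q)) * (8 * L powr (-1/4))))"
    using \<delta>0 C3_ge \<kappa>0 B_nonneg P_nonneg Q_nonneg integral_kernel2[OF L0 xc, folded rr_def]
    by (intro mult_left_mono add_mono integral_Src integral_kernel_powr) auto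
  also have "\<dots> = 2 * C1\<^sup>2 * (2 * B + (2 * C3 * B + 32 * (L powr (3/4) * sqrt (P * Q) / \<kappa>)))"
  proof -
    have "L * L powr (-1/4) = L powr (3/4)"
      using L0 powr_add[of L 1 "-1/4"] by simp
    then have "\<delta> * (4 * sqrt (P * Q)) * (8 * L powr (-1/4)) = \<kappa>\<^sup>2 * (32 * (L powr (3/4) * sqrt (P * Q) / \<kappa>))"
      using \<kappa>0 by (simp add: \<delta>_def power2_eq_square)
    moreover have "\<delta> * (C3 * \<kappa> * B) * (2 / L) = \<kappa>\<^sup>2 * (2 * C3 * B)"
      using L0 by (simp add: \<delta>_def power2_eq_square)
    ultimately have "2 * \<kappa>\<^sup>2 * B + (\<delta> * (C3 * \<kappa> * B) * (2 / L) + \<delta> * (4 * sqrt (P * Q)) * (8 * L powr (-1/4)))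
      = \<kappa>\<^sup>2 * (2 * B + (2 * C3 * B + 32 * (L powr (3/4) * sqrt (P * Q) / \<kappa>)))"
      by (simp add: distrib_left)
    then show ?thesis using \<kappa>0 by simp
  qed
  also have "\<dots> \<le> 2 * C1\<^sup>2 * ((34 + 2 * C3) * W)"
  proof (intro mult_left_mono)
    define y where "y = L powr (3/4) * sqrt (P * Q) / \<kappa>"
    have "0 \<le> y" using P_nonneg Q_nonneg \<kappa>0 by (simp add: y_def)
    then have "0 \<le> C3 * y" "0 \<le> C3 * B" using C3_ge B_nonneg by auto
    then show "2 * B + (2 * C3 * B + 32 * (L powr (3/4) * sqrt (P * Q) / \<kappa>)) \<le> (34 + 2 * C3) * W"
      using \<open>0 \<le> y\<close> B_nonneg unfolding W_def y_def[symmetric] by (simp add: algebra_simps)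
  qed simp
  finally show ?thesis by (simp add: C4_def mult.assoc)
qed

lemma w_le:
  assumes "x \<in> {0..1}"
  shows "cmod (w x) \<le> C4 * W * (\<kappa>\<^sup>2 / (\<kappa>\<^sup>2 + x\<^sup>2))"
  using om_w_le[OF assms] \<kappa>0 om_pos[of x] by (simp add: om_def pos_le_divide_eq pos_divide_le_eq add_pos_nonneg mult_ac)

lemma u_le:
  assumes x: "x \<in> {0..1}"
  shows "cmod (u x) \<le> 3 * A * C4 * (\<kappa>\<^sup>2 * W)"
proof -
  have p: "0 < \<kappa>\<^sup>2 + x\<^sup>2" using \<kappa>0 by (simp add: add_pos_nonneg)
  have "cmod (u x) = cmod (Vs x) * cmod (w x)" using Vs_nz[of x] by (simp add: w_def norm_divide)
  also have "\<dots> \<le> (3 * A * (\<kappa>\<^sup>2 + x\<^sup>2)) * (C4 * W * (\<kappa>\<^sup>2 / (\<kappa>\<^sup>2 + x\<^sup>2)))"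
    using A1 by (intro mult_mono V_up w_le x) auto
  also have "\<dots> = 3 * A * C4 * (\<kappa>\<^sup>2 * W)" using p by simp
  finally show ?thesis .
qed

lemma h_le: "h \<le> 18 * A\<^sup>2 * C4 * Km\<^sup>2 * (\<kappa>\<^sup>2 * W)"
proof -
  have "h \<le> integral {0..1::real} (\<lambda>x. 18 * A\<^sup>2 * C4 * Km\<^sup>2 * (\<kappa>\<^sup>2 * W))"
    unfolding h_def
  proof (intro integral_le integrable_continuous_interval continuous_intros cV cu)
    fix x :: real assume x: "x \<in> {0..1}"
    have "\<kappa>\<^sup>2 \<le> Km\<^sup>2" using \<kappa>_le \<kappa>0 by (intro power_mono) auto
    moreover have "x\<^sup>2 \<le> 1" using x by (simp add: power_le_one)
    moreover have "1 \<le> Km\<^sup>2" using Km1 by simp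
    ultimately have "\<kappa>\<^sup>2 + x\<^sup>2 \<le> 2 * Km\<^sup>2" by simp
    then have "3 * A * (\<kappa>\<^sup>2 + x\<^sup>2) \<le> 3 * A * (2 * Km\<^sup>2)" using A1 by (intro mult_left_mono) auto
    then have "cmod (V x) \<le> 3 * A * (2 * Km\<^sup>2)" using V_up(1)[OF x] by simp
    then have "cmod (V x) * cmod (u x) \<le> (3 * A * (2 * Km\<^sup>2)) * (3 * A * C4 * (\<kappa>\<^sup>2 * W))"
      using A1 by (intro mult_mono u_le x) auto
    then show "cmod (V x) * cmod (u x) \<le> 18 * A\<^sup>2 * C4 * Km\<^sup>2 * (\<kappa>\<^sup>2 * W)" by (simp add: power2_eq_square mult_ac)
  qed
  then show ?thesis by simp
qed

text \<open>The decay \<kappa>^2/(\<kappa>^2 + x^2) concentrates \<open>w\<close> on an interval of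
  length of order \<kappa>, which is the origin of the factor \<open>sqrt \<kappa>\<close>.\<close>

lemma nrm_w_le: "nrm w \<le> 2 * C4 * (sqrt \<kappa> * W)"
proof -
  have c: "continuous_on {0..1} (\<lambda>x. 1 / (\<kappa> + \<bar>x - 0\<bar>)\<^sup>2)"
    by (intro continuous_intros) (use \<kappa>0 in \<open>auto simp: add_pos_nonneg less_imp_neq[symmetric]\<close>)
  have "(nrm w)\<^sup>2 = integral {0..1} (\<lambda>x. (cmod (w x))\<^sup>2)" by (rule nrm_square[OF cw])
  also have "\<dots> \<le> integral {0..1} (\<lambda>x. (C4 * W)\<^sup>2 * (2 * \<kappa>\<^sup>2) * (1 / (\<kappa> + \<bar>x - 0\<bar>)\<^sup>2))"
  proof (rule integral_le)
    show "(\<lambda>x. (cmod (w x))\<^sup>2) integrable_on {0..1}" by (intro integrable_continuous_interval continuous_intros cw)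
    show "(\<lambda>x. (C4 * W)\<^sup>2 * (2 * \<kappa>\<^sup>2) * (1 / (\<kappa> + \<bar>x - 0\<bar>)\<^sup>2)) integrable_on {0..1}"
      by (intro integrable_continuous_interval continuous_on_mult_left c)
    fix x :: real assume x: "x \<in> {0..1}"
    have p: "0 < \<kappa>\<^sup>2 + x\<^sup>2" "0 < \<kappa> + x" using \<kappa>0 x by (auto simp: add_pos_nonneg)
    define q where "q = \<kappa>\<^sup>2 / (\<kappa>\<^sup>2 + x\<^sup>2)"
    have q: "0 \<le> q" "q \<le> 1" using p by (auto simp: q_def)
    have "(cmod (w x))\<^sup>2 \<le> (C4 * W * q)\<^sup>2"
      using w_le[OF x] by (intro power_mono) (auto simp: q_def)
    also have "\<dots> = (C4 * W)\<^sup>2 * (q * q)" by (simp add: power_mult_distrib power2_eq_square)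
    also have "\<dots> \<le> (C4 * W)\<^sup>2 * q" using q by (intro mult_left_mono) (auto intro: mult_left_le_one_le)
    also have "q \<le> (2 * \<kappa>\<^sup>2) * (1 / (\<kappa> + x)\<^sup>2)"
    proof -
      have "(\<kappa> + x)\<^sup>2 \<le> 2 * (\<kappa>\<^sup>2 + x\<^sup>2)" using sum_squares_bound[of \<kappa> x] by (simp add: power2_sum)
      then have "\<kappa>\<^sup>2 * (\<kappa> + x)\<^sup>2 \<le> \<kappa>\<^sup>2 * (2 * (\<kappa>\<^sup>2 + x\<^sup>2))" by (intro mult_left_mono) auto
      then show ?thesis unfolding q_def using p
        by (simp add: pos_divide_le_eq pos_le_divide_eq mult_ac distrib_left del: distrib_left_numeral)
    qed
    finally show "(cmod (w x))\<^sup>2 \<le> (C4 * W)\<^sup>2 * (2 * \<kappa>\<^sup>2) * (1 / (\<kappa> + \<bar>x - 0\<bar>)\<^sup>2)"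
      using x by (simp add: mult_left_mono mult.assoc)
  qed
  also have "\<dots> = (C4 * W)\<^sup>2 * (2 * \<kappa>\<^sup>2) * integral {0..1} (\<lambda>x. 1 / (\<kappa> + \<bar>x - 0\<bar>)\<^sup>2)" by (rule integral_mult_right)
  also have "\<dots> \<le> (C4 * W)\<^sup>2 * (2 * \<kappa>\<^sup>2) * (2 / \<kappa>)" by (intro mult_left_mono integral_kernel2) (use \<kappa>0 in auto)
  also have "\<dots> = (2 * C4 * (sqrt \<kappa> * W))\<^sup>2" using \<kappa>0 by (simp add: power_mult_distrib) (simp add: power2_eq_square)
  finally show ?thesis by (rule power2_le_imp_le) (use C4_ge W_nonneg \<kappa>0 in simp)
qed

section \<open>The weak form tested with \<open>cnj \<phi> / Vs\<close>\<close>

lemma Vs_ge_\<delta>: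
  assumes "x \<in> {0..1}"
  shows "1 / cmod (Vs x) \<le> C1 / (\<kappa> * L)"
proof -
  have "\<kappa> * L \<le> (\<kappa> + rr x) * (L + rr x)" using \<kappa>0 L0 rr0 by (intro mult_mono) auto
  then have "\<kappa> * L \<le> C1 * cmod (Vs x)" using Vs_low[OF assms] by simp
  then show ?thesis using \<kappa>0 L0 Vs_nz[of x] by (simp add: pos_divide_le_eq pos_le_divide_eq)
qed

text \<open>\<open>U1\<close> is at most \<open>A * (\<kappa> + rr x)\<close>, which cancels one
  factor of the lower bound for \<open>Vs\<close> squared. Thus the derivative of 1/Vs costs only
  1/(\<kappa> L^2).\<close>

lemma U1_Vs_le:
  assumes x: "x \<in> {0..1}"
  shows "\<bar>U1 x\<bar> / (cmod (Vs x))\<^sup>2 \<le> A * C1\<^sup>2 / (\<kappa> * L\<^sup>2)"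
proof -
  have v: "0 < (cmod (Vs x))\<^sup>2" using Vs_nz[of x] by simp
  have p: "0 < \<kappa> + rr x" "0 < L + rr x" using \<kappa>0 L0 rr0[of x] by auto
  have "\<bar>U1 x\<bar> * (\<kappa> * L\<^sup>2) \<le> (A * (\<kappa> + rr x)) * ((\<kappa> + rr x) * (L + rr x)\<^sup>2)"
  proof (rule mult_mono)
    have "A * x \<le> A * (\<kappa> + rr x)" using A1 x_le by (intro mult_left_mono) auto
    then show "\<bar>U1 x\<bar> \<le> A * (\<kappa> + rr x)" using abs_U1_le[OF x] by simp
    show "\<kappa> * L\<^sup>2 \<le> (\<kappa> + rr x) * (L + rr x)\<^sup>2" using \<kappa>0 L0 rr0 by (intro mult_mono power_mono) auto
  qed (use A1 p \<kappa>0 L0 in auto)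
  also have "\<dots> = A * ((\<kappa> + rr x) * (L + rr x))\<^sup>2" by (simp add: power2_eq_square mult_ac)
  also have "\<dots> \<le> A * (C1 * cmod (Vs x))\<^sup>2" using A1 p by (intro mult_left_mono power_mono Vs_low x) auto
  finally have "\<bar>U1 x\<bar> * (\<kappa> * L\<^sup>2) \<le> A * C1\<^sup>2 * (cmod (Vs x))\<^sup>2" by (simp add: power_mult_distrib mult_ac)
  then show ?thesis using v \<kappa>0 L0 by (simp add: pos_divide_le_eq pos_le_divide_eq mult_ac)
qed

text \<open>The kernel is rescaled to width \<open>D / \<kappa>\<close>, so its mass cancels the
  factor \<open>D\<close> and leaves \<open>L\<close> whatever the size of \<mu>.\<close>

lemma integral_near_le:
  "integral {0..1} (\<lambda>x. \<delta> * D / (cmod (Vs x))\<^sup>2 * (cmod (\<phi> x))\<^sup>2) \<le> 1352 * A\<^sup>2 * (L * Q\<^sup>2)"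
proof -
  define l where "l = D / \<kappa>"
  have l: "0 < l" using D0 \<kappa>0 by (simp add: l_def)
  have c: "continuous_on {0..1} (\<lambda>x. 1 / (l + \<bar>x - xc\<bar>)\<^sup>2)"
    by (intro continuous_intros) (use l in \<open>auto simp: add_pos_nonneg less_imp_neq[symmetric]\<close>)
  have "integral {0..1} (\<lambda>x. \<delta> * D / (cmod (Vs x))\<^sup>2 * (cmod (\<phi> x))\<^sup>2)
    \<le> integral {0..1} (\<lambda>x. (26 * A)\<^sup>2 * L * l * Q\<^sup>2 * (1 / (l + \<bar>x - xc\<bar>)\<^sup>2))"
  proof (rule integral_le)
    show "(\<lambda>x. \<delta> * D / (cmod (Vs x))\<^sup>2 * (cmod (\<phi> x))\<^sup>2) integrable_on {0..1}"
      by (intro integrable_continuous_interval continuous_intros cVs c\<phi>) (simp add: Vs_nz)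
    show "(\<lambda>x. (26 * A)\<^sup>2 * L * l * Q\<^sup>2 * (1 / (l + \<bar>x - xc\<bar>)\<^sup>2)) integrable_on {0..1}"
      by (intro integrable_continuous_interval continuous_on_mult_left c)
    fix x :: real assume x: "x \<in> {0..1}"
    have v: "0 < (cmod (Vs x))\<^sup>2" using Vs_nz[of x] by simp
    have p: "0 < l + rr x" using l rr0[of x] by simp
    have "(\<kappa> * (l + rr x))\<^sup>2 \<le> ((\<kappa> + rr x) * (l + rr x))\<^sup>2"
      using p \<kappa>0 rr0 by (intro power_mono mult_right_mono) auto
    also have "\<dots> \<le> (26 * A * cmod (Vs x))\<^sup>2"
      unfolding l_def using p \<kappa>0 rr0[of x] l by (intro power_mono Vs_near x) (auto simp: l_def)
    finally have "\<kappa>\<^sup>2 * (l + rr x)\<^sup>2 \<le> (26 * A)\<^sup>2 * (cmod (Vs x))\<^sup>2" by (simp add: power_mult_distrib)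
    then have "\<kappa>\<^sup>2 / (cmod (Vs x))\<^sup>2 \<le> (26 * A)\<^sup>2 * (1 / (l + rr x)\<^sup>2)"
      using v p by (simp add: pos_divide_le_eq pos_le_divide_eq mult_ac)
    then have "L * l * (\<kappa>\<^sup>2 / (cmod (Vs x))\<^sup>2) \<le> L * l * ((26 * A)\<^sup>2 * (1 / (l + rr x)\<^sup>2))"
      using L0 l by (intro mult_left_mono) auto
    moreover have "\<delta> * D / (cmod (Vs x))\<^sup>2 = L * l * (\<kappa>\<^sup>2 / (cmod (Vs x))\<^sup>2)"
      using \<kappa>0 by (simp add: \<delta>_def l_def power2_eq_square)
    ultimately have "\<delta> * D / (cmod (Vs x))\<^sup>2 \<le> L * l * ((26 * A)\<^sup>2 * (1 / (l + rr x)\<^sup>2))" by (simp only:)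
    moreover have "(cmod (\<phi> x))\<^sup>2 \<le> Q\<^sup>2" using \<phi>_le_Q[OF x] by (intro power_mono) auto
    ultimately have "\<delta> * D / (cmod (Vs x))\<^sup>2 * (cmod (\<phi> x))\<^sup>2 \<le> L * l * ((26 * A)\<^sup>2 * (1 / (l + rr x)\<^sup>2)) * Q\<^sup>2"
      using \<delta>0 D0 L0 l by (intro mult_mono) auto
    then show "\<delta> * D / (cmod (Vs x))\<^sup>2 * (cmod (\<phi> x))\<^sup>2 \<le> (26 * A)\<^sup>2 * L * l * Q\<^sup>2 * (1 / (l + \<bar>x - xc\<bar>)\<^sup>2)"
      by (simp add: rr_def mult_ac)
  qed
  also have "\<dots> = (26 * A)\<^sup>2 * L * l * Q\<^sup>2 * integral {0..1} (\<lambda>x. 1 / (l + \<bar>x - xc\<bar>)\<^sup>2)" by (rule integral_mult_right)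
  also have "\<dots> \<le> (26 * A)\<^sup>2 * L * l * Q\<^sup>2 * (2 / l)"
    using L0 l by (intro mult_left_mono integral_kernel2 xc) auto
  also have "\<dots> = 1352 * A\<^sup>2 * (L * Q\<^sup>2)" using l by (simp add: power_mult_distrib)
  finally show ?thesis .
qed

text \<open>With this test function the local term is \<open>V / Vs\<close> times |\<phi>|^2, whose
  real part is |\<phi>|^2 minus a piece concentrated in the layer, and the non-local term becomes
  \<open>U2 * w * cnj \<phi>\<close>, controlled by \<open>nrm w\<close>. All remaining terms carry
  1/\<beta>, that is \<open>\<kappa> * L ^ 3\<close>, against powers of 1/L from
  \<open>1 / Vs\<close> and its derivative.\<close>

lemma P_step:
  "P\<^sup>2 \<le> 1352 * A\<^sup>2 * (L * Q\<^sup>2) + A * (nrm w * P) + A * C1\<^sup>2 * (L\<^sup>2 * X\<^sup>2 + L * X * P + L\<^sup>2 * \<Phi> * P + L\<^sup>2 * T)"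
proof -
  define q where "q x = cnj (\<phi> x) / Vs x" for x
  define q' where "q' x = (cnj (\<phi>1 x) * Vs x - cnj (\<phi> x) * of_real (U1 x)) / (Vs x)\<^sup>2" for x
  have dq: "(q has_vector_derivative q' x) (at x within {0..1})" if "x \<in> {0..1}" for x
    unfolding q_def[abs_def] q'_def
    by (rule has_vector_derivative_quotient[OF has_vector_derivative_cnj[OF d\<phi>[OF that]] dVs[OF that] Vs_nz])
  have cq: "continuous_on {0..1} q" by (rule vector_derivative_continuous_on[OF dq])
  have cq': "continuous_on {0..1} q'" unfolding q'_def[abs_def]
    by (intro continuous_intros c\<phi> c\<phi>1 cVs cU1) (simp add: Vs_nz)
  define J where "J = integral {0..1} (\<lambda>x. (V x * \<phi> x - of_real (U2 x) * u x) * q x)"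
  have kL: "0 < \<kappa> * L" using \<kappa>0 L0 by simp
  have nq: "nrm q \<le> C1 / (\<kappa> * L) * P"
    unfolding P_def
  proof (rule nrm_mult_le[OF c\<phi> cq])
    fix x :: real assume "x \<in> {0..1}"
    then show "cmod (q x) \<le> C1 / (\<kappa> * L) * cmod (\<phi> x)"
      using mult_right_mono[OF Vs_ge_\<delta>, of x "cmod (\<phi> x)"] by (simp add: q_def norm_divide)
  qed (use C1_ge kL in simp)
  have q1: "cmod (\<phi>1 1 * q 1) \<le> C1 / (\<kappa> * L) * T"
  proof -
    have "cmod (q 1) \<le> C1 / (\<kappa> * L) * Q"
      unfolding q_def norm_divide using mult_mono[OF Vs_ge_\<delta>[of 1] \<phi>_le_Q[of 1]] C1_ge kL by simp
    then have "cmod (\<phi>1 1) * cmod (q 1) \<le> cmod (\<phi>1 1) * (C1 / (\<kappa> * L) * Q)" by (intro mult_left_mono) auto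
    then show ?thesis by (simp add: norm_mult T_def mult_ac)
  qed
  have iq': "cmod (integral {0..1} (\<lambda>x. \<phi>1 x * q' x)) \<le> C1 / (\<kappa> * L) * X\<^sup>2 + A * C1\<^sup>2 / (\<kappa> * L\<^sup>2) * (X * P)"
  proof -
    have "cmod (integral {0..1} (\<lambda>x. \<phi>1 x * q' x)) \<le>
      integral {0..1} (\<lambda>x. C1 / (\<kappa> * L) * (cmod (\<phi>1 x))\<^sup>2 + A * C1\<^sup>2 / (\<kappa> * L\<^sup>2) * (cmod (\<phi>1 x) * cmod (\<phi> x)))"
    proof (rule integral_norm_bound_integral)
      show "(\<lambda>x. \<phi>1 x * q' x) integrable_on {0..1}" by (intro integrable_continuous_interval continuous_intros c\<phi>1 cq')
      show "(\<lambda>x. C1 / (\<kappa> * L) * (cmod (\<phi>1 x))\<^sup>2 + A * C1\<^sup>2 / (\<kappa> * L\<^sup>2) * (cmod (\<phi>1 x) * cmod (\<phi> x))) integrable_on {0..1}"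
        by (intro integrable_continuous_interval continuous_on_add continuous_on_mult_left continuous_intros c\<phi>1 c\<phi>)
      fix x :: real assume x: "x \<in> {0..1}"
      have "q' x = cnj (\<phi>1 x) / Vs x - cnj (\<phi> x) * of_real (U1 x) / (Vs x)\<^sup>2"
        using Vs_nz[of x] by (simp add: q'_def diff_divide_distrib power2_eq_square)
      then have "cmod (q' x) \<le> cmod (cnj (\<phi>1 x) / Vs x) + cmod (cnj (\<phi> x) * of_real (U1 x) / (Vs x)\<^sup>2)"
        by (simp only: norm_triangle_ineq4)
      also have "\<dots> = cmod (\<phi>1 x) * (1 / cmod (Vs x)) + cmod (\<phi> x) * (\<bar>U1 x\<bar> / (cmod (Vs x))\<^sup>2)"
        by (simp add: norm_divide norm_mult norm_power)
      also have "\<dots> \<le> cmod (\<phi>1 x) * (C1 / (\<kappa> * L)) + cmod (\<phi> x) * (A * C1\<^sup>2 / (\<kappa> * L\<^sup>2))"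
        by (intro add_mono mult_left_mono Vs_ge_\<delta> U1_Vs_le x) auto
      finally have "cmod (\<phi>1 x) * cmod (q' x) \<le> cmod (\<phi>1 x) * (cmod (\<phi>1 x) * (C1 / (\<kappa> * L)) + cmod (\<phi> x) * (A * C1\<^sup>2 / (\<kappa> * L\<^sup>2)))"
        by (intro mult_left_mono) auto
      also have "\<dots> = C1 / (\<kappa> * L) * (cmod (\<phi>1 x))\<^sup>2 + A * C1\<^sup>2 / (\<kappa> * L\<^sup>2) * (cmod (\<phi>1 x) * cmod (\<phi> x))"
        unfolding power2_eq_square[of "cmod (\<phi>1 x)"] by (simp only: distrib_left mult_ac)
      finally show "cmod (\<phi>1 x * q' x) \<le> C1 / (\<kappa> * L) * (cmod (\<phi>1 x))\<^sup>2 + A * C1\<^sup>2 / (\<kappa> * L\<^sup>2) * (cmod (\<phi>1 x) * cmod (\<phi> x))"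
        by (simp only: norm_mult)
    qed
    also have "\<dots> = C1 / (\<kappa> * L) * X\<^sup>2 + A * C1\<^sup>2 / (\<kappa> * L\<^sup>2) * integral {0..1} (\<lambda>x. cmod (\<phi>1 x) * cmod (\<phi> x))"
      unfolding X_def nrm_square[OF c\<phi>1]
      by (subst integral_add, (intro integrable_continuous_interval continuous_on_add continuous_on_mult_left continuous_intros c\<phi>1 c\<phi>)+,
          subst integral_mult_right, subst integral_mult_right, rule refl)
    also have "\<dots> \<le> C1 / (\<kappa> * L) * X\<^sup>2 + A * C1\<^sup>2 / (\<kappa> * L\<^sup>2) * (X * P)"
      using integral_cmod_mult_le[OF c\<phi>1 c\<phi>] A1 \<kappa>0 by (intro add_left_mono mult_left_mono) (auto simp: X_def P_def)
    finally show ?thesis .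
  qed
  have tri: "cmod a \<le> cmod (a - b + c) + cmod b + cmod c" for a b c :: complex by norm
  have "cmod (\<i> * of_real \<beta> * J - \<phi>1 1 * q 1 + integral {0..1} (\<lambda>x. \<phi>1 x * q' x)) \<le> \<Phi> * nrm q"
    unfolding J_def by (rule weak[OF dq cq'])
  then have "cmod (\<i> * of_real \<beta> * J) \<le> \<Phi> * nrm q + cmod (\<phi>1 1 * q 1) + cmod (integral {0..1} (\<lambda>x. \<phi>1 x * q' x))"
    using tri[of "\<i> * of_real \<beta> * J" "\<phi>1 1 * q 1" "integral {0..1} (\<lambda>x. \<phi>1 x * q' x)"] by linarith
  also have "\<dots> \<le> \<Phi> * (C1 / (\<kappa> * L) * P) + C1 / (\<kappa> * L) * T
      + (C1 / (\<kappa> * L) * X\<^sup>2 + A * C1\<^sup>2 / (\<kappa> * L\<^sup>2) * (X * P))"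
    using q1 iq' mult_left_mono[OF nq Phi] by linarith
  finally have "\<beta> * cmod J \<le> \<Phi> * (C1 / (\<kappa> * L) * P) + C1 / (\<kappa> * L) * T
      + (C1 / (\<kappa> * L) * X\<^sup>2 + A * C1\<^sup>2 / (\<kappa> * L\<^sup>2) * (X * P))"
    using beta by (simp add: norm_mult)
  \<comment> \<open>Multiplication by \<open>\<kappa> * L ^ 3\<close> is division by
    \<beta>.\<close>
  then have "\<kappa> * L ^ 3 * (\<beta> * cmod J) \<le> \<kappa> * L ^ 3 * (\<Phi> * (C1 / (\<kappa> * L) * P) + C1 / (\<kappa> * L) * T
      + (C1 / (\<kappa> * L) * X\<^sup>2 + A * C1\<^sup>2 / (\<kappa> * L\<^sup>2) * (X * P)))"
    using \<kappa>0 L0 by (intro mult_left_mono) auto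
  also have "\<kappa> * L ^ 3 * (\<beta> * cmod J) = (\<beta> * \<kappa> * L ^ 3) * cmod J" by (simp only: mult_ac)
  also have "\<dots> = cmod J" by (simp only: \<beta>\<kappa>L mult_1)
  also have "\<kappa> * L ^ 3 * (\<Phi> * (C1 / (\<kappa> * L) * P) + C1 / (\<kappa> * L) * T
      + (C1 / (\<kappa> * L) * X\<^sup>2 + A * C1\<^sup>2 / (\<kappa> * L\<^sup>2) * (X * P)))
    = C1 * (L\<^sup>2 * \<Phi> * P) + C1 * (L\<^sup>2 * T) + (C1 * (L\<^sup>2 * X\<^sup>2) + A * C1\<^sup>2 * (L * X * P))"
    using \<kappa>0 L0 by (simp add: field_simps power2_eq_square power3_eq_cube)
  also have "\<dots> \<le> A * C1\<^sup>2 * (L\<^sup>2 * \<Phi> * P) + A * C1\<^sup>2 * (L\<^sup>2 * T) + (A * C1\<^sup>2 * (L\<^sup>2 * X\<^sup>2) + A * C1\<^sup>2 * (L * X * P))"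
  proof -
    have "1 * (1 * C1) \<le> A * (C1 * C1)" using A1 C1_ge by (intro mult_mono) auto
    then have "C1 \<le> A * C1\<^sup>2" by (simp add: power2_eq_square)
    then show ?thesis using Phi P_nonneg T_nonneg by (intro add_mono mult_right_mono order_refl) auto
  qed
  finally have J1: "cmod J \<le> A * C1\<^sup>2 * (L\<^sup>2 * X\<^sup>2 + L * X * P + L\<^sup>2 * \<Phi> * P + L\<^sup>2 * T)"
    by (simp add: distrib_left)
  have Jeq: "J = integral {0..1} (\<lambda>x. V x / Vs x * of_real ((cmod (\<phi> x))\<^sup>2))
      - integral {0..1} (\<lambda>x. of_real (U2 x) * (w x * cnj (\<phi> x)))"
  proof -
    have "J = integral {0..1} (\<lambda>x. V x / Vs x * of_real ((cmod (\<phi> x))\<^sup>2) - of_real (U2 x) * (w x * cnj (\<phi> x)))"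
      unfolding J_def
      by (rule integral_cong)
         (simp add: q_def w_def complex_norm_square diff_divide_distrib left_diff_distrib mult.assoc del: of_real_power)
    also have "\<dots> = integral {0..1} (\<lambda>x. V x / Vs x * of_real ((cmod (\<phi> x))\<^sup>2))
      - integral {0..1} (\<lambda>x. of_real (U2 x) * (w x * cnj (\<phi> x)))"
      by (intro integral_diff integrable_continuous_interval continuous_intros cV cVs c\<phi> cU2 cw) (simp add: Vs_nz)
    finally show ?thesis .
  qed
  have R1: "Re (integral {0..1} (\<lambda>x. V x / Vs x * of_real ((cmod (\<phi> x))\<^sup>2)))
    = P\<^sup>2 - integral {0..1} (\<lambda>x. \<delta> * D / (cmod (Vs x))\<^sup>2 * (cmod (\<phi> x))\<^sup>2)"
  proof -
    have "Re (integral {0..1} (\<lambda>x. V x / Vs x * of_real ((cmod (\<phi> x))\<^sup>2)))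
      = integral {0..1} (\<lambda>x. Re (V x / Vs x * of_real ((cmod (\<phi> x))\<^sup>2)))"
      using integral_linear[OF integrable_continuous_interval bounded_linear_Re, of 0 1 "\<lambda>x. V x / Vs x * of_real ((cmod (\<phi> x))\<^sup>2)"]
      by (simp add: o_def continuous_intros cV cVs c\<phi> Vs_nz del: of_real_power)
    also have "\<dots> = integral {0..1} (\<lambda>x. (cmod (\<phi> x))\<^sup>2 - \<delta> * D / (cmod (Vs x))\<^sup>2 * (cmod (\<phi> x))\<^sup>2)"
    proof (rule integral_cong)
      fix x :: real
      have "Re (V x / Vs x) = 1 - \<delta> * D / (cmod (Vs x))\<^sup>2"
      proof -
        have "V x = Vs x + \<i> * of_real \<delta>" by (simp add: Vs_alt)
        then have "V x / Vs x = 1 + \<i> * of_real \<delta> / Vs x" using Vs_nz[of x] by (simp add: add_divide_distrib)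
        moreover have "Re (\<i> * of_real \<delta> / Vs x) = - (\<delta> * D / (cmod (Vs x))\<^sup>2)"
          by (simp add: Re_divide Vs_def cmod_power2)
        ultimately show ?thesis by simp
      qed
      then show "Re (V x / Vs x * of_real ((cmod (\<phi> x))\<^sup>2)) = (cmod (\<phi> x))\<^sup>2 - \<delta> * D / (cmod (Vs x))\<^sup>2 * (cmod (\<phi> x))\<^sup>2"
        by (simp add: left_diff_distrib del: of_real_power times_divide_eq_left)
    qed
    also have "\<dots> = P\<^sup>2 - integral {0..1} (\<lambda>x. \<delta> * D / (cmod (Vs x))\<^sup>2 * (cmod (\<phi> x))\<^sup>2)"
      unfolding P_def nrm_square[OF c\<phi>]
      by (intro integral_diff integrable_continuous_interval continuous_intros cVs c\<phi>) (simp add: Vs_nz)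
    finally show ?thesis .
  qed
  have R2: "cmod (integral {0..1} (\<lambda>x. of_real (U2 x) * (w x * cnj (\<phi> x)))) \<le> A * (nrm w * P)"
  proof -
    have "cmod (integral {0..1} (\<lambda>x. of_real (U2 x) * (w x * cnj (\<phi> x)))) \<le> integral {0..1} (\<lambda>x. A * (cmod (w x) * cmod (\<phi> x)))"
    proof (rule integral_norm_bound_integral)
      fix x :: real assume x: "x \<in> {0..1}"
      have "\<bar>U2 x\<bar> \<le> A" using U2_le[OF x] U2_neg[OF x] by simp
      then show "cmod (of_real (U2 x) * (w x * cnj (\<phi> x))) \<le> A * (cmod (w x) * cmod (\<phi> x))"
        by (simp add: norm_mult mult_right_mono)
    qed (intro integrable_continuous_interval continuous_intros cU2 cw c\<phi>)+
    also have "\<dots> \<le> A * (nrm w * P)"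
      using integral_cmod_mult_le[OF cw c\<phi>] A1 by (simp add: P_def mult_left_mono)
    finally show ?thesis .
  qed
  have "P\<^sup>2 = Re J + Re (integral {0..1} (\<lambda>x. of_real (U2 x) * (w x * cnj (\<phi> x))))
     + integral {0..1} (\<lambda>x. \<delta> * D / (cmod (Vs x))\<^sup>2 * (cmod (\<phi> x))\<^sup>2)"
    unfolding Jeq minus_complex.simps R1 by simp
  also have "\<dots> \<le> cmod J + A * (nrm w * P) + 1352 * A\<^sup>2 * (L * Q\<^sup>2)"
    using order_trans[OF complex_Re_le_cmod R2] integral_near_le by (intro add_mono complex_Re_le_cmod) auto
  finally show ?thesis using J1 by linarith
qed

end

section \<open>Absorbing inequalities\<close>

lemma young8: "a * b \<le> a\<^sup>2 / 8 + 2 * b\<^sup>2" for a b :: real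
proof -
  have "0 \<le> (a - 4 * b)\<^sup>2" by simp
  then show ?thesis by (simp add: power2_eq_square algebra_simps)
qed

text \<open>Here \<open>main\<close> is \<open>P_step\<close> divided by \<open>L\<^sup>2\<close>,
  with R = P/L. The term in \<open>t\<close> needs three nested Young steps, through
  \<open>t\<^sup>2 = R * q\<close>, then the formula for \<open>q\<^sup>2\<close>, then
  \<open>R * X\<close>; each doubles the power of \<open>C\<close>, from \<open>C\<^sup>2\<close> to
  \<open>C ^ 16\<close>. In total 13/16 of \<open>R\<^sup>2\<close> is absorbed.\<close>

lemma absorb_R:
  fixes C R X \<Phi> T q t l :: real
  assumes C: "1 \<le> C" and nn: "0 \<le> R" "0 \<le> X" "0 \<le> \<Phi>" "0 \<le> T" "0 \<le> q" "0 \<le> t" "0 \<le> l" "l \<le> 1"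
    and small: "1024 * C ^ 8 * l ^ 4 \<le> 1"
    and q: "q\<^sup>2 = 2 * R * X + l ^ 4 * R\<^sup>2" and t: "t\<^sup>2 = R * q"
    and main: "R\<^sup>2 \<le> C * (2 * R * X + l ^ 4 * R\<^sup>2 + 2 * C * (X + l\<^sup>2 * \<Phi> + t) * R + X\<^sup>2 + X * R + l ^ 4 * \<Phi> * R + T)"
  shows "R\<^sup>2 \<le> 1000000 * C ^ 16 * (X\<^sup>2 + l ^ 4 * \<Phi>\<^sup>2 + T)"
proof -
  have Cn: "1 \<le> C ^ n" for n using C by simp
  have Cmono: "C ^ i \<le> C ^ j" if "i \<le> j" for i j using C that by (simp add: power_increasing)
  have y1: "R * (2 * C\<^sup>2 * t) \<le> R\<^sup>2 / 8 + 8 * C ^ 4 * (R * q)"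
    using young8[of R "2 * C\<^sup>2 * t"] t by (simp add: power_mult_distrib flip: power_mult)
  have y2: "R * (8 * C ^ 4 * q) \<le> R\<^sup>2 / 8 + 128 * C ^ 8 * (2 * R * X + l ^ 4 * R\<^sup>2)"
    using young8[of R "8 * C ^ 4 * q"] q by (simp add: power_mult_distrib flip: power_mult)
  have y3: "R * (256 * C ^ 8 * X) \<le> R\<^sup>2 / 8 + 131072 * C ^ 16 * X\<^sup>2"
    using young8[of R "256 * C ^ 8 * X"] by (simp add: power_mult_distrib flip: power_mult)
  have y4: "128 * C ^ 8 * (l ^ 4 * R\<^sup>2) \<le> R\<^sup>2 / 8"
    using mult_right_mono[OF small, of "R\<^sup>2"] by simp
  have y5: "R * (5 * C\<^sup>2 * X) \<le> R\<^sup>2 / 8 + 50 * C ^ 4 * X\<^sup>2"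
    using young8[of R "5 * C\<^sup>2 * X"] by (simp add: power_mult_distrib flip: power_mult)
  have y6: "R * (3 * C\<^sup>2 * (l\<^sup>2 * \<Phi>)) \<le> R\<^sup>2 / 8 + 18 * C ^ 4 * (l ^ 4 * \<Phi>\<^sup>2)"
    using young8[of R "3 * C\<^sup>2 * (l\<^sup>2 * \<Phi>)"] by (simp add: power_mult_distrib flip: power_mult)
  have y7: "C * (l ^ 4 * R\<^sup>2) \<le> R\<^sup>2 / 16"
  proof -
    have "C \<le> C ^ 8" using Cmono[of 1 8] by simp
    then have "C * (l ^ 4 * R\<^sup>2) \<le> C ^ 8 * (l ^ 4 * R\<^sup>2)" using nn by (intro mult_right_mono) auto
    moreover have "0 \<le> R\<^sup>2" by simp
    ultimately show ?thesis using y4 by linarith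
  qed
  have c1: "C * (3 * (R * X)) + 2 * C\<^sup>2 * (R * X) \<le> R * (5 * C\<^sup>2 * X)"
  proof -
    have "C * (3 * (R * X)) \<le> C\<^sup>2 * (3 * (R * X))" using Cmono[of 1 2] nn by (intro mult_right_mono) auto
    then show ?thesis by (simp add: mult_ac)
  qed
  have c2: "2 * C\<^sup>2 * (l\<^sup>2 * \<Phi> * R) + C * (l ^ 4 * \<Phi> * R) \<le> R * (3 * C\<^sup>2 * (l\<^sup>2 * \<Phi>))"
  proof -
    have "l ^ 4 \<le> l\<^sup>2" using nn by (intro power_decreasing) auto
    then have "C * (l ^ 4 * \<Phi> * R) \<le> C\<^sup>2 * (l\<^sup>2 * \<Phi> * R)"
      using Cmono[of 1 2] nn C by (intro mult_mono mult_right_mono) auto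
    then show ?thesis by (simp add: mult_ac)
  qed
  have "R\<^sup>2 \<le> (C * (3 * (R * X)) + 2 * C\<^sup>2 * (R * X)) + (2 * C\<^sup>2 * (l\<^sup>2 * \<Phi> * R) + C * (l ^ 4 * \<Phi> * R))
      + C * (l ^ 4 * R\<^sup>2) + R * (2 * C\<^sup>2 * t) + C * X\<^sup>2 + C * T"
    using main by (simp add: algebra_simps power2_eq_square)
  then have "R\<^sup>2 \<le> (13/16) * R\<^sup>2 + (131072 * C ^ 16 * X\<^sup>2 + 50 * C ^ 4 * X\<^sup>2 + C * X\<^sup>2) + 18 * C ^ 4 * (l ^ 4 * \<Phi>\<^sup>2) + C * T"
    using c1 c2 y1 y2 y3 y4 y5 y6 y7 by (simp add: algebra_simps)
  moreover have e0: "0 \<le> (131072 * C ^ 16 * X\<^sup>2 + 50 * C ^ 4 * X\<^sup>2 + C * X\<^sup>2) + 18 * C ^ 4 * (l ^ 4 * \<Phi>\<^sup>2) + C * T"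
    using nn C by (intro add_nonneg_nonneg mult_nonneg_nonneg) auto
  ultimately have r: "R\<^sup>2 \<le> 6 * ((131072 * C ^ 16 * X\<^sup>2 + 50 * C ^ 4 * X\<^sup>2 + C * X\<^sup>2) + 18 * C ^ 4 * (l ^ 4 * \<Phi>\<^sup>2) + C * T)"
    by argo
  have "50 * C ^ 4 * X\<^sup>2 \<le> 50 * C ^ 16 * X\<^sup>2" "C * X\<^sup>2 \<le> C ^ 16 * X\<^sup>2" "C * T \<le> C ^ 16 * T"
    "18 * C ^ 4 * (l ^ 4 * \<Phi>\<^sup>2) \<le> 18 * C ^ 16 * (l ^ 4 * \<Phi>\<^sup>2)"
    using Cmono[of 4 16] Cmono[of 1 16] nn by (auto intro!: mult_right_mono)
  moreover have "0 \<le> C ^ 16 * X\<^sup>2" "0 \<le> C ^ 16 * T" "0 \<le> C ^ 16 * (l ^ 4 * \<Phi>\<^sup>2)" using nn C by auto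
  moreover have "1000000 * C ^ 16 * (X\<^sup>2 + l ^ 4 * \<Phi>\<^sup>2 + T)
    = 1000000 * (C ^ 16 * X\<^sup>2) + 1000000 * (C ^ 16 * (l ^ 4 * \<Phi>\<^sup>2)) + 1000000 * (C ^ 16 * T)"
    by (simp add: algebra_simps)
  ultimately show ?thesis using r by argo
qed

text \<open>If \<open>S\<close> exceeded \<open>60 * K * Z\<close>, the two terms on the right would
  be at most 56/60 and 4/3600 of \<open>S\<^sup>2\<close>, too little together.\<close>

lemma absorb_S:
  fixes K S Z :: real
  assumes "1 \<le> K" "0 \<le> S" "0 \<le> Z" and m: "S\<^sup>2 \<le> 56 * K * (Z * S) + 4 * K * Z\<^sup>2"
  shows "S \<le> 60 * K * Z"
proof (rule ccontr)
  assume "\<not> S \<le> 60 * K * Z"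
  then have s: "60 * K * Z < S" by simp
  have Spos: "0 < S" using s assms by (smt (verit) mult_nonneg_nonneg)
  have "56 * K * (Z * S) = (56/60) * ((60 * K * Z) * S)" by simp
  also have "\<dots> \<le> (56/60) * (S * S)" using s assms by (intro mult_left_mono mult_right_mono) auto
  finally have 1: "56 * K * (Z * S) \<le> (56/60) * S\<^sup>2" by (simp add: power2_eq_square)
  have "Z \<le> K * Z" using assms mult_right_mono[of 1 K Z] by simp
  then have "60 * Z \<le> S" using s by simp
  have "4 * K * Z\<^sup>2 = (4/3600) * ((60 * K * Z) * (60 * Z))" by (simp add: power2_eq_square)
  also have "\<dots> \<le> (4/3600) * (S * S)" using s \<open>60 * Z \<le> S\<close> assms by (intro mult_left_mono mult_mono) auto
  finally have 2: "4 * K * Z\<^sup>2 \<le> (4/3600) * S\<^sup>2" by (simp add: power2_eq_square)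
  have "0 < S\<^sup>2" using Spos by simp
  then show False using m 1 2 by linarith
qed

section \<open>The a priori estimate\<close>

text \<open>With \<open>L = l\<^sup>4\<close>, the layer estimates and the energy estimate close up, because every term they share
  carries either a factor of \<open>\<Phi>\<close> or a small constant.\<close>

lemma layer_closure:
  fixes C \<eta> X P \<Phi> T Q p W h nw \<kappa> l a \<beta> \<mu>p Y :: real
  assumes C: "1 \<le> C"
    and nn: "0 \<le> X" "0 \<le> P" "0 \<le> \<Phi>" "0 \<le> T" "0 \<le> Q" "0 \<le> p" "0 \<le> h" "0 \<le> nw" "0 < \<kappa>" "0 < l" "0 \<le> a" "0 \<le> \<mu>p"
    and l1: "l \<le> 1" and lk: "l ^ 4 \<le> \<kappa>" and bk: "\<beta> * \<kappa> * l ^ 12 = 1"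
    and Q: "Q\<^sup>2 = 2 * P * X + P\<^sup>2" and p: "p\<^sup>2 = P * Q"
    and Y: "Y = l ^ 6 * X + l ^ 8 * \<Phi> + l ^ 3 * p"
    and W: "\<kappa> * W = Y + a * h / (\<kappa> * l ^ 4)"
    and h: "h \<le> C * (\<kappa>\<^sup>2 * W)" and nw: "nw \<le> C * (sqrt \<kappa> * W)"
    and Pst: "P\<^sup>2 \<le> C * (l ^ 4 * Q\<^sup>2 + nw * P + (l ^ 8 * X\<^sup>2 + l ^ 4 * X * P + l ^ 8 * \<Phi> * P + l ^ 8 * T))"
    and Tle: "T \<le> (\<Phi> + \<beta> * (a * h)) * Q"
    and Xst: "X\<^sup>2 \<le> C * (X * P + \<beta> * \<mu>p * P\<^sup>2 + \<Phi> * P + T)"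
    and \<eta>: "0 < \<eta>" "80 * (1000000 * C ^ 16) * C\<^sup>2 * \<eta> \<le> 1/2"
    and sm: "l ^ 4 \<le> \<eta>" "a \<le> \<eta> * l ^ 4" "\<beta> * \<mu>p * l ^ 8 \<le> \<eta>"
  shows "P \<le> 60 * (1000000 * C ^ 17) * l ^ 6 * \<Phi>"
    and "\<kappa>\<^sup>2 * W \<le> 400 * (1000000 * C ^ 17) * \<kappa> * (l ^ 8 * \<Phi>)"
proof -
  define C9 where "C9 = 1000000 * C ^ 16"
  have Cmono: "C ^ i \<le> C ^ j" if "i \<le> j" for i j using C that by (simp add: power_increasing)
  have C9: "1 \<le> C9" unfolding C9_def using one_le_power[OF C, of 16] by linarith
  have \<eta>1: "80 * C9 * C\<^sup>2 * \<eta> \<le> 1/2" using \<eta> by (simp add: C9_def)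
  have \<eta>2: "2 * C * \<eta> \<le> 1"
  proof -
    have "2 * C * \<eta> \<le> 80 * C9 * C\<^sup>2 * \<eta>"
    proof (rule mult_right_mono)
      have "2 * C = 2 * 1 * C" by simp
      also have "\<dots> \<le> 80 * C9 * C\<^sup>2" using C C9 Cmono[of 1 2] by (intro mult_mono) auto
      finally show "2 * C \<le> 80 * C9 * C\<^sup>2" .
    qed (use \<eta> in simp)
    then show ?thesis using \<eta>1 by linarith
  qed
  have \<eta>3: "1024 * C ^ 8 * \<eta> \<le> 1"
  proof -
    have "1024 * C ^ 8 * \<eta> \<le> 80 * C9 * C\<^sup>2 * \<eta>"
    proof (rule mult_right_mono)
      have "C ^ 16 * 1 \<le> C ^ 16 * C\<^sup>2" using C by (intro mult_left_mono) auto
      then show "1024 * C ^ 8 \<le> 80 * C9 * C\<^sup>2"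
        unfolding C9_def using Cmono[of 8 16] one_le_power[OF C, of 16] by simp
    qed (use \<eta> in simp)
    then show ?thesis using \<eta>1 by linarith
  qed
  have lp: "0 < l ^ n" for n using nn by simp
  have Ynn: "0 \<le> Y" unfolding Y using nn by simp
  \<comment> \<open>\<open>W\<close> itself contains \<open>h\<close>; the smallness of
    \<alpha>^2/L, in the form \<open>a \<le> \<eta> * l ^ 4\<close>, lets \<open>h\<close> be
    absorbed on the left.\<close>
  have hY: "h \<le> 2 * C * \<kappa> * Y"
  proof -
    have "\<kappa>\<^sup>2 * W = \<kappa> * Y + a * h / l ^ 4"
    proof -
      have "\<kappa>\<^sup>2 * W = \<kappa> * (\<kappa> * W)" by (simp add: power2_eq_square)
      then show ?thesis unfolding W using nn by (simp add: distrib_left)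
    qed
    moreover have "a * h / l ^ 4 \<le> \<eta> * h"
      using mult_right_mono[OF sm(2) nn(7)] lp[of 4] by (simp add: pos_divide_le_eq mult_ac)
    ultimately have "C * (\<kappa>\<^sup>2 * W) \<le> C * (\<kappa> * Y + \<eta> * h)" using C by (intro mult_left_mono) auto
    then have "h \<le> C * \<kappa> * Y + (C * \<eta>) * h" using h by (simp add: distrib_left mult_ac)
    also have "(C * \<eta>) * h \<le> (1/2) * h" using \<eta>2 nn by (intro mult_right_mono) auto
    finally show ?thesis by simp
  qed
  have WY: "\<kappa> * W \<le> 2 * Y"
  proof -
    have "a * h \<le> (\<eta> * l ^ 4) * (2 * C * \<kappa> * Y)" using sm(2) hY nn \<eta> by (intro mult_mono) auto
    also have "\<dots> = (2 * C * \<eta>) * (\<kappa> * l ^ 4 * Y)" by (simp add: mult_ac)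
    also have "\<dots> \<le> 1 * (\<kappa> * l ^ 4 * Y)" using \<eta>2 nn lp Ynn by (intro mult_right_mono) auto
    finally have "a * h / (\<kappa> * l ^ 4) \<le> Y" using nn lp[of 4] by (simp add: pos_divide_le_eq mult_ac)
    then show ?thesis unfolding W by simp
  qed
  \<comment> \<open>Rescaling by the powers of \<open>L\<close> natural to each quantity puts
    \<open>X\<close>, \<open>R\<close>, \<open>q\<close> and \<open>t\<close> on one scale, measured
    by \<open>S\<close>; the target is then \<open>S\<close> of order
    \<open>l\<^sup>2 * \<Phi>\<close>.\<close>
  define R where "R = P / l ^ 4"
  define S where "S = X + R"
  define q where "q = Q / l\<^sup>2"
  define t where "t = p / l ^ 3"
  have PR: "P = l ^ 4 * R" using nn by (simp add: R_def)
  have Qq: "Q = l\<^sup>2 * q" using nn by (simp add: q_def)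
  have pt: "p = l ^ 3 * t" using nn by (simp add: t_def)
  have nn': "0 \<le> R" "0 \<le> q" "0 \<le> t" "0 \<le> S" using nn by (auto simp: R_def q_def t_def S_def)
  have q2: "q\<^sup>2 = 2 * R * X + l ^ 4 * R\<^sup>2"
  proof -
    have "l ^ 4 * q\<^sup>2 = l ^ 4 * (2 * R * X + l ^ 4 * R\<^sup>2)"
      using Q unfolding Qq PR by (simp add: power_mult_distrib algebra_simps flip: power_mult)
    then show ?thesis using lp[of 4] by simp
  qed
  have t2: "t\<^sup>2 = R * q"
  proof -
    have "l ^ 6 * t\<^sup>2 = l ^ 6 * (R * q)"
      using p unfolding pt PR Qq by (simp add: power_mult_distrib mult_ac flip: power_mult power_add)
    then show ?thesis using lp[of 6] by simp
  qed
  have nwR: "nw \<le> 2 * C * (l ^ 4 * (X + l\<^sup>2 * \<Phi> + t))"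
  proof -
    have sk: "l\<^sup>2 \<le> sqrt \<kappa>" by (rule real_le_rsqrt) (use lk in \<open>simp flip: power_mult\<close>)
    have "Y = l ^ 6 * (X + l\<^sup>2 * \<Phi> + t)"
      unfolding Y pt by (simp add: distrib_left flip: power_add mult.assoc)
    then have Y6: "Y = l\<^sup>2 * (l ^ 4 * (X + l\<^sup>2 * \<Phi> + t))" by (simp flip: power_add mult.assoc)
    have "sqrt \<kappa> * (sqrt \<kappa> * W) \<le> 2 * Y" using WY nn by (simp flip: mult.assoc)
    also have "\<dots> \<le> sqrt \<kappa> * (2 * (l ^ 4 * (X + l\<^sup>2 * \<Phi> + t)))"
      unfolding Y6 using mult_right_mono[OF sk, of "2 * (l ^ 4 * (X + l\<^sup>2 * \<Phi> + t))"] nn nn' lp by (simp add: mult_ac)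
    finally have "sqrt \<kappa> * W \<le> 2 * (l ^ 4 * (X + l\<^sup>2 * \<Phi> + t))" using nn by simp
    then have "C * (sqrt \<kappa> * W) \<le> C * (2 * (l ^ 4 * (X + l\<^sup>2 * \<Phi> + t)))" using C by (intro mult_left_mono) auto
    then show ?thesis using nw by simp
  qed
  have mainR: "R\<^sup>2 \<le> C * (2 * R * X + l ^ 4 * R\<^sup>2 + 2 * C * (X + l\<^sup>2 * \<Phi> + t) * R + X\<^sup>2 + X * R + l ^ 4 * \<Phi> * R + T)"
  proof -
    have "nw * P \<le> 2 * C * (l ^ 4 * (X + l\<^sup>2 * \<Phi> + t)) * P" by (intro mult_right_mono nwR nn)
    then have "C * (l ^ 4 * Q\<^sup>2 + nw * P + (l ^ 8 * X\<^sup>2 + l ^ 4 * X * P + l ^ 8 * \<Phi> * P + l ^ 8 * T))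
      \<le> C * (l ^ 4 * Q\<^sup>2 + 2 * C * (l ^ 4 * (X + l\<^sup>2 * \<Phi> + t)) * P + (l ^ 8 * X\<^sup>2 + l ^ 4 * X * P + l ^ 8 * \<Phi> * P + l ^ 8 * T))"
      using C by (intro mult_left_mono) auto
    also have "\<dots> = l ^ 8 * (C * (2 * R * X + l ^ 4 * R\<^sup>2 + 2 * C * (X + l\<^sup>2 * \<Phi> + t) * R + X\<^sup>2 + X * R + l ^ 4 * \<Phi> * R + T))"
    proof -
      have "l ^ 4 * Q\<^sup>2 = l ^ 8 * (2 * R * X + l ^ 4 * R\<^sup>2)"
        unfolding Qq q2[symmetric] by (simp add: power_mult_distrib flip: power_mult power_add mult.assoc)
      moreover have "C * (m * m * a + 2 * C * (m * b) * (m * R) + (m * m * c + m * X * (m * R) + m * m * \<Phi> * (m * R) + m * m * T))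
         = (m * m) * (C * (a + 2 * C * b * R + c + X * R + m * \<Phi> * R + T))" for m a b c :: real
        by (simp add: algebra_simps)
      from this[of "l ^ 4" "2 * R * X + l ^ 4 * R\<^sup>2" "X + l\<^sup>2 * \<Phi> + t" "X\<^sup>2"]
      have "C * (l ^ 8 * (2 * R * X + l ^ 4 * R\<^sup>2) + 2 * C * (l ^ 4 * (X + l\<^sup>2 * \<Phi> + t)) * (l ^ 4 * R)
          + (l ^ 8 * X\<^sup>2 + l ^ 4 * X * (l ^ 4 * R) + l ^ 8 * \<Phi> * (l ^ 4 * R) + l ^ 8 * T))
        = l ^ 8 * (C * (2 * R * X + l ^ 4 * R\<^sup>2 + 2 * C * (X + l\<^sup>2 * \<Phi> + t) * R + X\<^sup>2 + X * R + l ^ 4 * \<Phi> * R + T))"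
        unfolding power_add[symmetric] by simp
      ultimately show ?thesis unfolding PR by simp
    qed
    finally have "P\<^sup>2 \<le> l ^ 8 * (C * (2 * R * X + l ^ 4 * R\<^sup>2 + 2 * C * (X + l\<^sup>2 * \<Phi> + t) * R + X\<^sup>2 + X * R + l ^ 4 * \<Phi> * R + T))"
      using Pst by simp
    moreover have "P\<^sup>2 = l ^ 8 * R\<^sup>2" unfolding PR by (simp add: power_mult_distrib flip: power_mult)
    ultimately show ?thesis using lp[of 8] by simp
  qed
  have "1024 * C ^ 8 * l ^ 4 \<le> 1024 * C ^ 8 * \<eta>" using sm C by (intro mult_left_mono) auto
  then have sm8: "1024 * C ^ 8 * l ^ 4 \<le> 1" using \<eta>3 by simp
  have R9: "R\<^sup>2 \<le> C9 * (X\<^sup>2 + l ^ 4 * \<Phi>\<^sup>2 + T)"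
    unfolding C9_def by (rule absorb_R[OF C nn'(1) nn(1,3,4) nn'(2,3) _ l1 sm8 q2 t2 mainR]) (use nn in simp)
  have RS: "R \<le> S" "X \<le> S" using nn nn' by (auto simp: S_def)
  have l41: "l ^ 4 \<le> 1" "l\<^sup>2 \<le> 1" using l1 nn by (auto simp: power_le_one)
  have qS: "q \<le> 2 * S"
  proof (rule power2_le_imp_le)
    have "2 * R * X \<le> 2 * (S * S)" using RS nn nn' mult_mono[of R S X S] by simp
    moreover have "l ^ 4 * R\<^sup>2 \<le> 1 * S\<^sup>2" using l41 RS nn nn' by (intro mult_mono power_mono) auto
    ultimately have "q\<^sup>2 \<le> 3 * S\<^sup>2" unfolding q2 by (simp add: power2_eq_square)
    also have "\<dots> \<le> (2 * S)\<^sup>2" by (simp add: power_mult_distrib)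
    finally show "q\<^sup>2 \<le> (2 * S)\<^sup>2" .
  qed (use nn' in simp)
  have tS: "t \<le> 2 * S"
  proof (rule power2_le_imp_le)
    have "R * q \<le> S * (2 * S)" using RS qS nn' by (intro mult_mono) auto
    also have "\<dots> \<le> (2 * S)\<^sup>2" by (simp add: power2_eq_square)
    finally show "t\<^sup>2 \<le> (2 * S)\<^sup>2" unfolding t2 .
  qed (use nn' in simp)
  have YS: "Y \<le> 3 * (l ^ 6 * S) + l ^ 8 * \<Phi>"
  proof -
    have "l ^ 6 * X \<le> l ^ 6 * S" "l ^ 6 * t \<le> l ^ 6 * (2 * S)" using RS tS lp[of 6] by (auto intro!: mult_left_mono)
    moreover have "l ^ 3 * p = l ^ 6 * t" unfolding pt by (simp flip: power_add mult.assoc)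
    ultimately show ?thesis unfolding Y by simp
  qed
  \<comment> \<open>The factor \<beta> in the boundary term is cancelled exactly: \<kappa> comes
    from \<open>hY\<close>, \<open>l ^ 4\<close> from the bound on \<open>a\<close>,
    \<open>l ^ 6\<close> from \<open>YS\<close>, \<open>l\<^sup>2\<close> from \<open>Q\<close>, and
    \<open>\<beta> * \<kappa> * l ^ 12 = 1\<close>.\<close>
  have TS: "T \<le> 4 * (l\<^sup>2 * \<Phi> * S) + 12 * C * \<eta> * S\<^sup>2"
  proof -
    have "\<beta> * (a * h) * l\<^sup>2 \<le> l\<^sup>2 * \<Phi> + 6 * C * \<eta> * S"
    proof -
      have b0: "0 < \<beta>" using bk nn lp[of 12] by (metis zero_less_mult_pos2 zero_less_one mult.assoc mult_pos_pos)
      have "a * h \<le> (\<eta> * l ^ 4) * (2 * C * \<kappa> * (3 * (l ^ 6 * S) + l ^ 8 * \<Phi>))"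
      proof (rule mult_mono[OF sm(2)])
        have "2 * C * \<kappa> * Y \<le> 2 * C * \<kappa> * (3 * (l ^ 6 * S) + l ^ 8 * \<Phi>)" using YS C nn by (intro mult_left_mono) auto
        then show "h \<le> 2 * C * \<kappa> * (3 * (l ^ 6 * S) + l ^ 8 * \<Phi>)" using hY by simp
      qed (use nn \<eta> in auto)
      then have "\<beta> * (a * h) * l\<^sup>2 \<le> \<beta> * ((\<eta> * l ^ 4) * (2 * C * \<kappa> * (3 * (l ^ 6 * S) + l ^ 8 * \<Phi>))) * l\<^sup>2"
        using b0 by (intro mult_right_mono mult_left_mono) auto
      also have "\<dots> = (\<beta> * \<kappa> * l ^ 12) * (6 * C * \<eta> * S) + (\<beta> * \<kappa> * l ^ 12) * ((2 * C * \<eta>) * (l\<^sup>2 * \<Phi>))"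
      proof -
        have "\<beta> * ((\<eta> * m) * (2 * C * \<kappa> * (3 * (n * S) + k * \<Phi>))) * o'
          = (\<beta> * \<kappa> * (m * n * o')) * (6 * C * \<eta> * S) + (\<beta> * \<kappa> * (m * k)) * ((2 * C * \<eta>) * (o' * \<Phi>))" for m n k o' :: real
          by (simp add: algebra_simps)
        from this[of "l ^ 4" "l ^ 6" "l ^ 8" "l\<^sup>2"] show ?thesis unfolding power_add[symmetric] by simp
      qed
      also have "\<dots> = 6 * C * \<eta> * S + (2 * C * \<eta>) * (l\<^sup>2 * \<Phi>)" unfolding bk by simp
      also have "(2 * C * \<eta>) * (l\<^sup>2 * \<Phi>) \<le> 1 * (l\<^sup>2 * \<Phi>)" using \<eta>2 nn by (intro mult_right_mono) auto
      finally show ?thesis by simp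
    qed
    then have "(\<Phi> + \<beta> * (a * h)) * l\<^sup>2 \<le> 2 * (l\<^sup>2 * \<Phi>) + 6 * C * \<eta> * S" by (simp add: algebra_simps)
    then have "((\<Phi> + \<beta> * (a * h)) * l\<^sup>2) * q \<le> (2 * (l\<^sup>2 * \<Phi>) + 6 * C * \<eta> * S) * (2 * S)"
      using qS nn nn' C \<eta> by (intro mult_mono) auto
    then have "(\<Phi> + \<beta> * (a * h)) * Q \<le> (2 * (l\<^sup>2 * \<Phi>) + 6 * C * \<eta> * S) * (2 * S)" unfolding Qq by (simp add: mult_ac)
    then show ?thesis using Tle by (simp add: algebra_simps power2_eq_square)
  qed
  have XS: "X\<^sup>2 \<le> 14 * C\<^sup>2 * \<eta> * S\<^sup>2 + 5 * C * (l\<^sup>2 * \<Phi> * S)"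
  proof -
    have x1: "X * P \<le> \<eta> * S\<^sup>2"
    proof -
      have "X * P = l ^ 4 * (X * R)" unfolding PR by simp
      also have "\<dots> \<le> \<eta> * (S * S)" using sm RS nn nn' \<eta> by (intro mult_mono) auto
      finally show ?thesis by (simp add: power2_eq_square)
    qed
    have x2: "\<beta> * \<mu>p * P\<^sup>2 \<le> \<eta> * S\<^sup>2"
    proof -
      have "\<beta> * \<mu>p * P\<^sup>2 = (\<beta> * \<mu>p * l ^ 8) * R\<^sup>2" unfolding PR by (simp add: power_mult_distrib flip: power_mult)
      also have "\<dots> \<le> \<eta> * S\<^sup>2"  using sm RS nn nn' \<eta> by (intro mult_mono power_mono) auto
      finally show ?thesis .
    qed
    have x3: "\<Phi> * P \<le> l\<^sup>2 * \<Phi> * S"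
    proof -
      have "\<Phi> * P = l\<^sup>2 * \<Phi> * (l\<^sup>2 * R)" unfolding PR by (simp add: mult_ac flip: power_add) (simp flip: mult.assoc power_add)?
      also have "\<dots> \<le> l\<^sup>2 * \<Phi> * (1 * S)" using l41 RS nn nn' by (intro mult_mono) auto
      finally show ?thesis by simp
    qed
    have "X\<^sup>2 \<le> C * (\<eta> * S\<^sup>2 + \<eta> * S\<^sup>2 + l\<^sup>2 * \<Phi> * S + (4 * (l\<^sup>2 * \<Phi> * S) + 12 * C * \<eta> * S\<^sup>2))"
      by (rule order_trans[OF Xst], intro mult_left_mono add_mono x1 x2 x3 TS) (use C in simp)
    also have "\<dots> = 2 * C * (\<eta> * S\<^sup>2) + 12 * C\<^sup>2 * \<eta> * S\<^sup>2 + 5 * C * (l\<^sup>2 * \<Phi> * S)" by (simp add: algebra_simps power2_eq_square)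
    also have "2 * C * (\<eta> * S\<^sup>2) \<le> 2 * C\<^sup>2 * (\<eta> * S\<^sup>2)" using Cmono[of 1 2] \<eta> by (intro mult_right_mono) auto
    finally show ?thesis by (simp add: mult_ac)
  qed
  define Z where "Z = l\<^sup>2 * \<Phi>"
  have Z0: "0 \<le> Z" using nn by (simp add: Z_def)
  have Z2: "l ^ 4 * \<Phi>\<^sup>2 = Z\<^sup>2" by (simp add: Z_def power_mult_distrib flip: power_mult)
  \<comment> \<open>The bound for \<open>R\<close> feeds on \<open>X\<close> and \<open>T\<close>
    with the large constant \<open>C9\<close>, but those return to \<open>S\<^sup>2\<close> only
    with the factor \<eta>. The choice of \<eta> makes the total at most 1/2.\<close>
  have "S\<^sup>2 \<le> 2 * X\<^sup>2 + 2 * R\<^sup>2" unfolding S_def using sum_squares_bound[of X R] by (simp add: power2_sum)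
  also have "\<dots> \<le> 2 * X\<^sup>2 + 2 * (C9 * (X\<^sup>2 + Z\<^sup>2 + T))" using R9 Z2 by simp
  also have "\<dots> \<le> 4 * C9 * X\<^sup>2 + 2 * C9 * Z\<^sup>2 + 2 * C9 * T"
    using mult_right_mono[OF C9, of "X\<^sup>2"] by (simp add: algebra_simps)
  also have "\<dots> \<le> 4 * C9 * (14 * C\<^sup>2 * \<eta> * S\<^sup>2 + 5 * C * (Z * S)) + 2 * C9 * Z\<^sup>2 + 2 * C9 * (4 * (Z * S) + 12 * C * \<eta> * S\<^sup>2)"
    using XS TS C9 unfolding Z_def by (intro add_mono mult_left_mono) auto
  also have "\<dots> \<le> 80 * C9 * C\<^sup>2 * \<eta> * S\<^sup>2 + 28 * C9 * C * (Z * S) + 2 * C9 * Z\<^sup>2"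
  proof -
    have "C9 * (C * (\<eta> * S\<^sup>2)) \<le> C9 * (C\<^sup>2 * (\<eta> * S\<^sup>2))"
      using Cmono[of 1 2] \<eta> C9 by (intro mult_left_mono mult_right_mono) auto
    moreover have "C9 * (1 * (Z * S)) \<le> C9 * (C * (Z * S))"
      using C C9 Z0 nn' by (intro mult_left_mono mult_right_mono) auto
    ultimately show ?thesis by (simp add: algebra_simps)
  qed
  also have "80 * C9 * C\<^sup>2 * \<eta> * S\<^sup>2 \<le> 1/2 * S\<^sup>2" using \<eta>1 by (intro mult_right_mono) auto
  finally have S1: "S\<^sup>2 \<le> 56 * (C9 * C) * (Z * S) + 4 * C9 * Z\<^sup>2" by simp
  have "C9 \<le> C9 * C" using C C9 by simp
  then have "4 * C9 * Z\<^sup>2 \<le> 4 * (C9 * C) * Z\<^sup>2" by (intro mult_right_mono) auto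
  then have "S\<^sup>2 \<le> 56 * (C9 * C) * (Z * S) + 4 * (C9 * C) * Z\<^sup>2" using S1 by simp
  moreover have K1: "1 \<le> C9 * C" using C C9 \<open>C9 \<le> C9 * C\<close> by linarith
  ultimately have SZ: "S \<le> 60 * (C9 * C) * Z" by (intro absorb_S) (use nn' Z0 in auto)
  have K: "C9 * C = 1000000 * C ^ 17" by (simp add: C9_def power_Suc2[symmetric] del: power_Suc)
  have "P \<le> l ^ 4 * (60 * (C9 * C) * Z)" unfolding PR using RS SZ lp[of 4] by (intro mult_left_mono) auto
  also have "\<dots> = 60 * (C9 * C) * (l ^ 4 * l\<^sup>2) * \<Phi>" by (simp add: Z_def mult_ac)
  finally show "P \<le> 60 * (1000000 * C ^ 17) * l ^ 6 * \<Phi>" unfolding K by (simp flip: power_add)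
  have "l ^ 6 * S \<le> l ^ 6 * (60 * (C9 * C) * Z)" using SZ lp[of 6] by (intro mult_left_mono) auto
  also have "\<dots> = 60 * (C9 * C) * (l ^ 8 * \<Phi>)" by (simp add: Z_def mult_ac flip: power_add) (simp flip: mult.assoc power_add)?
  finally have "Y \<le> 180 * (C9 * C) * (l ^ 8 * \<Phi>) + l ^ 8 * \<Phi>" using YS by simp
  moreover have "l ^ 8 * \<Phi> \<le> (C9 * C) * (l ^ 8 * \<Phi>)" using mult_right_mono[OF K1, of "l ^ 8 * \<Phi>"] nn by simp
  ultimately have "Y \<le> 181 * ((C9 * C) * (l ^ 8 * \<Phi>))" by simp
  moreover have "0 \<le> (C9 * C) * (l ^ 8 * \<Phi>)" using K1 nn by simp
  ultimately have "Y \<le> 200 * (C9 * C) * (l ^ 8 * \<Phi>)" unfolding mult.assoc by linarith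
  then have "\<kappa> * (\<kappa> * W) \<le> \<kappa> * (2 * (200 * (C9 * C) * (l ^ 8 * \<Phi>)))" using WY nn by (intro mult_left_mono) auto
  then show "\<kappa>\<^sup>2 * W \<le> 400 * (1000000 * C ^ 17) * \<kappa> * (l ^ 8 * \<Phi>)"
    unfolding K by (simp add: power2_eq_square mult_ac)
qed

context orr_sommerfeld begin

text \<open>The real part of \<open>energy\<close> with its weight bounded on both sides; a negative
  \<mu> has the favourable sign and is dropped, hence \<open>max 0 \<mu>\<close>.\<close>

lemma X_energy: "X\<^sup>2 \<le> A\<^sup>2 * (X * P + \<beta> * max 0 \<mu> * P\<^sup>2 + \<Phi> * P + T)"
proof -
  have gX: "X\<^sup>2 / A \<le> integral {0..1} (\<lambda>x. g x * (cmod (\<phi>1 x))\<^sup>2)"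
  proof -
    have "integral {0..1} (\<lambda>x. 1 / A * (cmod (\<phi>1 x))\<^sup>2) \<le> integral {0..1} (\<lambda>x. g x * (cmod (\<phi>1 x))\<^sup>2)"
      by (intro integral_le integrable_continuous_interval continuous_on_mult_left continuous_intros c\<phi>1 cg mult_right_mono g_bounds) auto
    then show ?thesis by (simp add: X_def nrm_square[OF c\<phi>1])
  qed
  have gP: "integral {0..1} (\<lambda>x. g x * (cmod (\<phi> x))\<^sup>2) \<le> A * P\<^sup>2"
  proof -
    have "integral {0..1} (\<lambda>x. g x * (cmod (\<phi> x))\<^sup>2) \<le> integral {0..1} (\<lambda>x. A * (cmod (\<phi> x))\<^sup>2)"
      by (intro integral_le integrable_continuous_interval continuous_on_mult_left continuous_intros c\<phi> cg mult_right_mono g_bounds) auto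
    then show ?thesis by (simp add: P_def nrm_square[OF c\<phi>])
  qed
  have gP0: "0 \<le> integral {0..1} (\<lambda>x. g x * (cmod (\<phi> x))\<^sup>2)"
  proof (intro integral_nonneg integrable_continuous_interval continuous_intros c\<phi> cg mult_nonneg_nonneg)
    fix x :: real assume "x \<in> {0..1}"
    then show "0 \<le> g x" using order_trans[OF _ g_bounds(1), of 0 x] A1 by simp
  qed auto
  have "\<beta> * \<mu> * integral {0..1} (\<lambda>x. g x * (cmod (\<phi> x))\<^sup>2) \<le> \<beta> * max 0 \<mu> * (A * P\<^sup>2)"
  proof -
    have "\<beta> * \<mu> \<le> \<beta> * max 0 \<mu>" using beta by (intro mult_left_mono) auto
    moreover have "0 \<le> \<beta> * max 0 \<mu>" using beta by (intro mult_nonneg_nonneg) auto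
    ultimately show ?thesis using gP gP0 by (meson mult_left_mono mult_right_mono order_trans)
  qed
  then have "X\<^sup>2 / A \<le> A * (X * P + \<beta> * max 0 \<mu> * P\<^sup>2 + \<Phi> * P + T)"
    using energy(1) gX by (simp add: algebra_simps)
  then show ?thesis using A1 by (simp add: pos_divide_le_eq power2_eq_square mult_ac)
qed

text \<open>Far from the range of \<open>U\<close> the function \<open>V\<close> has size comparable
  to \<open>E = \<bar>\<mu>\<bar> + d\<close> throughout, so there is no layer. The threshold
  \<open>20 * A\<close> makes \<open>U1 * u\<close> a perturbation of \<open>V * u1\<close> in
  \<open>G\<close>, and makes the local part of the energy outweigh the non-local one, 10 against 8
  times \<open>P\<^sup>2\<close>.\<close>

lemma large_parameter_estimate:
  assumes d0: "0 \<le> d"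
    and U_low: "\<And>x. x \<in> {0..1} \<Longrightarrow> d \<le> \<bar>U x - \<nu>\<bar>"
    and U_up: "\<And>x. x \<in> {0..1} \<Longrightarrow> \<bar>U x - \<nu>\<bar> \<le> A / 2 + d"
    and sgn: "(\<forall>x\<in>{0..1}. d \<le> U x - \<nu>) \<or> (\<forall>x\<in>{0..1}. d \<le> \<nu> - U x) \<or> d = 0"
    and E: "20 * A \<le> \<bar>\<mu>\<bar> + d" and mu: "\<mu> \<le> 1" and al: "16 * \<alpha>\<^sup>2 \<le> 1"
    and e: "0 < e" "e ^ 4 * \<beta> = 1" "198 * A ^ 3 * e \<le> 1"
  shows "\<beta> * (nrm u1)\<^sup>2 \<le> 3600 * A ^ 6 * \<Phi>\<^sup>2"
proof -
  define E where "E = \<bar>\<mu>\<bar> + d"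
  have E20: "20 * A \<le> E" using E by (simp add: E_def)
  have E0: "0 < E" using E20 A1 by simp
  have Vlo: "E / 2 \<le> cmod (V x)" if "x \<in> {0..1}" for x
    using abs_Re_le_cmod[of "V x"] abs_Im_le_cmod[of "V x"] U_low[OF that] by (simp add: V_eq E_def)
  have Vup: "cmod (V x) \<le> 2 * E" if "x \<in> {0..1}" for x
    using cmod_le[of "V x"] U_up[OF that] E20 A1 by (simp add: V_eq E_def)
  have u1G: "E / 4 * nrm u1 \<le> nrm G"
  proof -
    have "nrm u1 \<le> (2 / E) * nrm (\<lambda>x. V x * u1 x)"
    proof (rule nrm_mult_le)
      fix x :: real assume x: "x \<in> {0..1}"
      have "1 * cmod (u1 x) \<le> (2 / E * cmod (V x)) * cmod (u1 x)"
        using Vlo[OF x] E0 by (intro mult_right_mono) (auto simp: field_simps)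
      then show "cmod (u1 x) \<le> 2 / E * cmod (V x * u1 x)" by (simp add: norm_mult)
    qed (use E0 in \<open>auto intro!: continuous_intros cV cu1\<close>)
    moreover have "nrm (\<lambda>x. V x * u1 x) \<le> nrm G + A * nrm u1"
    proof -
      have "(\<lambda>x. V x * u1 x) = (\<lambda>x. G x + of_real (U1 x) * u x)" by (simp add: G_eq)
      then have "nrm (\<lambda>x. V x * u1 x) \<le> nrm G + nrm (\<lambda>x. of_real (U1 x) * u x)"
        by (simp only:) (intro nrm_add_le cG continuous_intros cU1 cu)
      also have "nrm (\<lambda>x. of_real (U1 x) * u x) \<le> A * nrm u"
      proof (rule nrm_mult_le[OF cu])
        fix x :: real assume x: "x \<in> {0..1}"
        have "A * x \<le> A" using x A1 by (simp add: mult_left_le)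
        then have "\<bar>U1 x\<bar> \<le> A" using abs_U1_le[OF x] by simp
        then show "cmod (of_real (U1 x) * u x) \<le> A * cmod (u x)" by (simp add: norm_mult mult_right_mono)
      qed (use A1 in \<open>auto intro!: continuous_intros cU1 cu\<close>)
      also have "A * nrm u \<le> A * nrm u1" using nrm_u_le A1 by (intro mult_left_mono) auto
      finally show ?thesis by simp
    qed
    ultimately have "nrm u1 \<le> (2 / E) * (nrm G + A * nrm u1)"
      using E0 by (meson divide_nonneg_pos mult_left_mono order_trans zero_le_numeral)
    then have "E * nrm u1 \<le> 2 * (nrm G + A * nrm u1)" using E0 by (simp add: field_simps)
    moreover have "20 * A * nrm u1 \<le> E * nrm u1" by (intro mult_right_mono E20 nrm_nonneg)
    moreover have "0 \<le> A * nrm u1" using A1 nrm_nonneg by simp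
    ultimately show ?thesis by (simp add: algebra_simps)
  qed
  have hG: "h \<le> 8 * nrm G"
  proof -
    have "h \<le> integral {0..1::real} (\<lambda>x. 2 * E * nrm u1)"
      unfolding h_def
      by (intro integral_le integrable_continuous_interval continuous_intros cV cu mult_mono Vup u_le_nrm_u1) (use E0 in auto)
    then show ?thesis using u1G by simp
  qed
  have Gle: "nrm G \<le> (X + \<Phi>) / \<beta> + \<alpha>\<^sup>2 * h"
  proof -
    have "nrm G \<le> 1 * nrm (\<lambda>x. of_real (1 / \<beta> * cmod (\<phi>1 x)) + of_real (\<Phi> / \<beta> + \<alpha>\<^sup>2 * h))"
    proof (rule nrm_mult_le)
      fix x :: real assume x: "x \<in> {0..1}"
      have nn: "0 \<le> 1 / \<beta> * cmod (\<phi>1 x) + (\<Phi> / \<beta> + \<alpha>\<^sup>2 * h)" using beta Phi h_nonneg by simp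
      have "cmod (of_real (1 / \<beta> * cmod (\<phi>1 x)) + of_real (\<Phi> / \<beta> + \<alpha>\<^sup>2 * h))
        = 1 / \<beta> * cmod (\<phi>1 x) + (\<Phi> / \<beta> + \<alpha>\<^sup>2 * h)"
        unfolding of_real_add[symmetric] norm_of_real using nn by simp
      then show "cmod (G x) \<le> 1 * cmod (of_real (1 / \<beta> * cmod (\<phi>1 x)) + of_real (\<Phi> / \<beta> + \<alpha>\<^sup>2 * h))"
        using G_le[OF x] by (simp add: add_divide_distrib)
    qed (use beta in \<open>auto intro!: continuous_intros cG c\<phi>1\<close>)
    also have "\<dots> \<le> nrm (\<lambda>x. of_real (1 / \<beta> * cmod (\<phi>1 x))) + nrm (\<lambda>x. of_real (\<Phi> / \<beta> + \<alpha>\<^sup>2 * h))"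
      using nrm_add_le[of "\<lambda>x. of_real (1 / \<beta> * cmod (\<phi>1 x))" "\<lambda>x. of_real (\<Phi> / \<beta> + \<alpha>\<^sup>2 * h)"]
      by (simp add: continuous_intros c\<phi>1 del: of_real_add of_real_mult of_real_divide times_divide_eq_left)
    also have "nrm (\<lambda>x. of_real (1 / \<beta> * cmod (\<phi>1 x))) \<le> 1 / \<beta> * X"
      unfolding X_def
      by (rule nrm_mult_le) (use beta in \<open>auto intro!: continuous_intros c\<phi>1 simp: norm_mult norm_divide\<close>)
    also have "nrm (\<lambda>x. of_real (\<Phi> / \<beta> + \<alpha>\<^sup>2 * h)) \<le> \<Phi> / \<beta> + \<alpha>\<^sup>2 * h"
    proof (rule nrm_le_if_le)
      have "0 \<le> \<Phi> / \<beta> + \<alpha>\<^sup>2 * h" using Phi beta h_nonneg by simp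
      then show "cmod (of_real (\<Phi> / \<beta> + \<alpha>\<^sup>2 * h)) \<le> \<Phi> / \<beta> + \<alpha>\<^sup>2 * h" by (simp only: norm_of_real abs_of_nonneg order_refl)
    qed (rule continuous_on_const)
    finally show ?thesis by (simp add: add_divide_distrib)
  qed
  have hle: "\<beta> * h \<le> 16 * (X + \<Phi>)"
  proof -
    have "\<alpha>\<^sup>2 * h \<le> 1 / 16 * (8 * nrm G)" using al hG h_nonneg by (intro mult_mono) auto
    then have "nrm G \<le> 2 * ((X + \<Phi>) / \<beta>)" using Gle by linarith
    then have "h \<le> 16 * ((X + \<Phi>) / \<beta>)" using hG by linarith
    then show ?thesis using beta by (simp add: field_simps)
  qed
  have Tle: "T \<le> (2 * \<Phi> + X) * Q"
  proof -
    have "\<beta> * (\<alpha>\<^sup>2 * h) = \<alpha>\<^sup>2 * (\<beta> * h)" by simp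
    also have "\<dots> \<le> 1 / 16 * (16 * (X + \<Phi>))"
      by (rule mult_mono[OF _ hle]) (use al h_nonneg beta in auto)
    finally have "(\<Phi> + \<beta> * (\<alpha>\<^sup>2 * h)) * Q \<le> (2 * \<Phi> + X) * Q" by (intro mult_right_mono Q_nonneg) auto
    then show ?thesis using T_le by simp
  qed
  define r where "r = X * P + \<Phi> * P + T"
  have r0: "0 \<le> r" using X_nonneg P_nonneg Phi T_nonneg by (simp add: r_def)
  have A3: "1 \<le> A ^ 3" "A\<^sup>2 \<le> A ^ 3" "A \<le> A ^ 3"
    using A1 power_increasing[of 2 3 A] power_increasing[of 1 3 A] by auto
  \<comment> \<open>If \<open>d\<close> is the dominant part of \<open>E\<close>, then
    \<open>U - \<nu>\<close> has a fixed sign and the imaginary part of the energy controls \<phi>.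
    Otherwise \<mu> is very negative, since it is bounded above by 1, and the real part
    does.\<close>
  have main: "X\<^sup>2 + \<beta> * P\<^sup>2 \<le> 3 * A ^ 3 * r"
  proof (cases "E / 2 \<le> d")
    case True
    have N: "(nrm u1)\<^sup>2 + \<alpha>\<^sup>2 * (nrm u)\<^sup>2 \<le> 8 * P\<^sup>2"
    proof -
      have le: "nrm u1 \<le> 2 * P" "nrm u \<le> 2 * P" using nrm_u_le nrm_u1_le nrm_u2_le by auto
      have "(nrm u1)\<^sup>2 \<le> (2 * P)\<^sup>2" "(nrm u)\<^sup>2 \<le> (2 * P)\<^sup>2"
        by (rule power_mono[OF le(1) nrm_nonneg], rule power_mono[OF le(2) nrm_nonneg])
      moreover have "\<alpha>\<^sup>2 * (nrm u)\<^sup>2 \<le> 1 * (nrm u)\<^sup>2" using al by (intro mult_right_mono) auto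
      ultimately show ?thesis by (simp add: power_mult_distrib)
    qed
    have W: "10 * P\<^sup>2 \<le> \<bar>integral {0..1} (\<lambda>x. g x * (U x - \<nu>) * (cmod (\<phi> x))\<^sup>2)\<bar>"
    proof -
      have d10: "10 \<le> 1 / A * d" using True E20 A1 by (simp add: pos_le_divide_eq)
      have dpos: "0 < d" using True E0 by simp
      have I: "(\<lambda>x. g x * (U x - \<nu>) * (cmod (\<phi> x))\<^sup>2) integrable_on {0..1}"
        "(\<lambda>x. g x * (\<nu> - U x) * (cmod (\<phi> x))\<^sup>2) integrable_on {0..1}"
        by (intro integrable_continuous_interval continuous_intros cg cU c\<phi>)+
      have J: "(\<lambda>x. 10 * (cmod (\<phi> x))\<^sup>2) integrable_on {0..1}"
        by (intro integrable_continuous_interval continuous_intros c\<phi>)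
      have ge: "10 * (cmod (\<phi> x))\<^sup>2 \<le> g x * y * (cmod (\<phi> x))\<^sup>2" if "x \<in> {0..1}" "d \<le> y" for x y
      proof (rule mult_right_mono)
        have "1 / A * d \<le> g x * y" using that g_bounds[OF that(1)] A1 dpos
          by (intro mult_mono) (auto intro: order_trans[OF _ g_bounds(1)[OF that(1)]])
        then show "10 \<le> g x * y" using d10 by simp
      qed simp
      from sgn dpos consider "\<forall>x\<in>{0..1}. d \<le> U x - \<nu>" | "\<forall>x\<in>{0..1}. d \<le> \<nu> - U x" by auto
      then show ?thesis
      proof cases
        case 1
        then have "integral {0..1} (\<lambda>x. 10 * (cmod (\<phi> x))\<^sup>2) \<le> integral {0..1} (\<lambda>x. g x * (U x - \<nu>) * (cmod (\<phi> x))\<^sup>2)"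
          by (intro integral_le I J ge) auto
        then show ?thesis by (simp add: P_def nrm_square[OF c\<phi>])
      next
        case 2
        then have "integral {0..1} (\<lambda>x. 10 * (cmod (\<phi> x))\<^sup>2) \<le> integral {0..1} (\<lambda>x. g x * (\<nu> - U x) * (cmod (\<phi> x))\<^sup>2)"
          by (intro integral_le I J ge) auto
        also have "\<dots> = integral {0..1} (\<lambda>x. - (g x * (U x - \<nu>) * (cmod (\<phi> x))\<^sup>2))"
          by (rule integral_cong) (simp add: algebra_simps)
        also have "\<dots> = - integral {0..1} (\<lambda>x. g x * (U x - \<nu>) * (cmod (\<phi> x))\<^sup>2)" by simp
        finally show ?thesis by (simp add: P_def nrm_square[OF c\<phi>])
      qed
    qed
    have "\<beta> * (2 * P\<^sup>2) \<le> \<beta> * \<bar>integral {0..1} (\<lambda>x. g x * (U x - \<nu>) * (cmod (\<phi> x))\<^sup>2) - ((nrm u1)\<^sup>2 + \<alpha>\<^sup>2 * (nrm u)\<^sup>2)\<bar>"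
    proof (rule mult_left_mono)
      have "0 \<le> (nrm u1)\<^sup>2 + \<alpha>\<^sup>2 * (nrm u)\<^sup>2" by simp
      then show "2 * P\<^sup>2 \<le> \<bar>integral {0..1} (\<lambda>x. g x * (U x - \<nu>) * (cmod (\<phi> x))\<^sup>2) - ((nrm u1)\<^sup>2 + \<alpha>\<^sup>2 * (nrm u)\<^sup>2)\<bar>"
        using N W by arith
    qed (use beta in simp)
    also have "\<dots> \<le> A * r" unfolding r_def by (rule energy(2))
    finally have bP: "\<beta> * P\<^sup>2 \<le> A * r / 2" by simp
    have "\<beta> * max 0 \<mu> * P\<^sup>2 \<le> \<beta> * 1 * P\<^sup>2" using mu beta by (intro mult_right_mono mult_left_mono) auto
    then have "X * P + \<beta> * max 0 \<mu> * P\<^sup>2 + \<Phi> * P + T \<le> r + A * r / 2" using bP by (simp add: r_def)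
    then have "X\<^sup>2 \<le> A\<^sup>2 * (r + A * r / 2)" using X_energy by (meson mult_left_mono order_trans zero_le_power2)
    also have "\<dots> = A\<^sup>2 * r + A ^ 3 * r / 2" by (simp add: algebra_simps power2_eq_square power3_eq_cube)
    finally have "X\<^sup>2 + \<beta> * P\<^sup>2 \<le> A\<^sup>2 * r + A ^ 3 * r / 2 + A * r / 2" using bP by simp
    moreover have "A\<^sup>2 * r \<le> A ^ 3 * r" "A * r \<le> A ^ 3 * r" "0 \<le> A ^ 3 * r"
      using A3 r0 A1 by (auto intro!: mult_right_mono mult_nonneg_nonneg)
    ultimately show ?thesis by simp
  next
    case False
    then have "E / 2 < \<bar>\<mu>\<bar>" by (simp add: E_def)
    then have mneg: "\<mu> < - (E / 2)" using mu E20 A1 by (simp add: abs_if split: if_splits)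
    have gP: "P\<^sup>2 / A \<le> integral {0..1} (\<lambda>x. g x * (cmod (\<phi> x))\<^sup>2)"
    proof -
      have "integral {0..1} (\<lambda>x. 1 / A * (cmod (\<phi> x))\<^sup>2) \<le> integral {0..1} (\<lambda>x. g x * (cmod (\<phi> x))\<^sup>2)"
        by (intro integral_le integrable_continuous_interval continuous_on_mult_left continuous_intros c\<phi> cg mult_right_mono g_bounds) auto
      then show ?thesis by (simp add: P_def nrm_square[OF c\<phi>])
    qed
    have gX: "X\<^sup>2 / A \<le> integral {0..1} (\<lambda>x. g x * (cmod (\<phi>1 x))\<^sup>2)"
    proof -
      have "integral {0..1} (\<lambda>x. 1 / A * (cmod (\<phi>1 x))\<^sup>2) \<le> integral {0..1} (\<lambda>x. g x * (cmod (\<phi>1 x))\<^sup>2)"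
        by (intro integral_le integrable_continuous_interval continuous_on_mult_left continuous_intros c\<phi>1 cg mult_right_mono g_bounds) auto
      then show ?thesis by (simp add: X_def nrm_square[OF c\<phi>1])
    qed
    have "\<beta> * 1 * (P\<^sup>2 / A) \<le> \<beta> * (- \<mu>) * integral {0..1} (\<lambda>x. g x * (cmod (\<phi> x))\<^sup>2)"
      using gP mneg E20 A1 beta by (intro mult_mono mult_nonneg_nonneg) auto
    then have "X\<^sup>2 / A + \<beta> * P\<^sup>2 / A \<le> A * r" using energy(1) gX by (simp add: r_def)
    then have "(X\<^sup>2 + \<beta> * P\<^sup>2) / A \<le> A * r" by (simp add: add_divide_distrib)
    then have "X\<^sup>2 + \<beta> * P\<^sup>2 \<le> A\<^sup>2 * r" using A1 by (simp add: pos_divide_le_eq power2_eq_square mult_ac)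
    also have "\<dots> \<le> A ^ 3 * r" using A3 r0 by (intro mult_right_mono) auto
    also have "\<dots> \<le> 3 * A ^ 3 * r" using A1 r0 by (intro mult_right_mono) auto
    finally show ?thesis .
  qed
  \<comment> \<open>With \<open>e\<close> = \<beta>^(-1/4), \<open>P\<close> is at most
    \<open>e\<^sup>2 * S\<close> and \<open>Q\<close> at most \<open>2 * (e * S)\<close>, so each
    term of \<open>r\<close> gains a factor \<open>e\<close> and the quadratic one is
    absorbed.\<close>
  define S where "S = sqrt (X\<^sup>2 + \<beta> * P\<^sup>2)"
  have S2: "S\<^sup>2 = X\<^sup>2 + \<beta> * P\<^sup>2" and S0: "0 \<le> S" using beta by (auto simp: S_def)
  have e1: "e \<le> 1"
  proof -
    have "1 * e \<le> 198 * A ^ 3 * e" using A3 e by (intro mult_right_mono) auto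
    then show ?thesis using e by linarith
  qed
  have XS: "X \<le> S" by (rule power2_le_imp_le) (use S2 S0 beta in auto)
  have PS: "P \<le> e\<^sup>2 * S"
  proof (rule power2_le_imp_le)
    have "P\<^sup>2 = e ^ 4 * (\<beta> * P\<^sup>2)" using e(2) by (simp flip: mult.assoc)
    also have "\<dots> \<le> e ^ 4 * S\<^sup>2" unfolding S2 using e by (intro mult_left_mono) auto
    finally show "P\<^sup>2 \<le> (e\<^sup>2 * S)\<^sup>2" by (simp add: power_mult_distrib flip: power_mult)
  qed (use S0 in simp)
  have QS: "Q \<le> 2 * (e * S)"
  proof (rule power2_le_imp_le)
    have "P * X \<le> (e\<^sup>2 * S) * S" using PS XS P_nonneg X_nonneg S0 by (intro mult_mono) auto
    moreover have "P\<^sup>2 \<le> (e * S)\<^sup>2"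
    proof (rule power_mono)
      have "e\<^sup>2 * S \<le> e * S" using e e1 S0 by (intro mult_right_mono) (auto simp: power2_eq_square mult_left_le)
      then show "P \<le> e * S" using PS by simp
    qed (rule P_nonneg)
    moreover have "(2 * (e * S))\<^sup>2 = 4 * (e\<^sup>2 * S * S)" "(e * S)\<^sup>2 = e\<^sup>2 * S * S" by (simp_all add: power2_eq_square)
    moreover have "0 \<le> e\<^sup>2 * S * S" using S0 by simp
    ultimately show "Q\<^sup>2 \<le> (2 * (e * S))\<^sup>2" unfolding Q_square by linarith
  qed (use S0 e in simp)
  have rS: "r \<le> 3 * (e * S\<^sup>2) + 5 * (e * \<Phi> * S)"
  proof -
    have "e\<^sup>2 * S \<le> e * S" using e e1 S0 by (intro mult_right_mono) (auto simp: power2_eq_square mult_left_le)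
    then have P1: "P \<le> e * S" using PS by simp
    have "X * P \<le> S * (e * S)" using XS P1 X_nonneg P_nonneg S0 by (intro mult_mono) auto
    moreover have "\<Phi> * P \<le> \<Phi> * (e * S)" using P1 Phi by (intro mult_left_mono) auto
    moreover have "T \<le> (2 * \<Phi> + S) * (2 * (e * S))"
      using Tle QS XS Phi Q_nonneg S0 by (meson add_left_mono add_nonneg_nonneg mult_mono mult_nonneg_nonneg order_trans zero_le_numeral)
    ultimately show ?thesis unfolding r_def by (simp add: algebra_simps power2_eq_square)
  qed
  have SS: "S \<le> 30 * A ^ 3 * (e * \<Phi>)"
  proof -
    have "S\<^sup>2 \<le> 3 * A ^ 3 * (3 * (e * S\<^sup>2) + 5 * (e * \<Phi> * S))"
      unfolding S2 by (rule order_trans[OF main]) (use rS S2 A3 A1 in \<open>auto intro!: mult_left_mono\<close>)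
    also have "\<dots> = (9 * A ^ 3 * e) * S\<^sup>2 + 15 * A ^ 3 * (e * \<Phi>) * S" by (simp add: algebra_simps)
    also have "(9 * A ^ 3 * e) * S\<^sup>2 \<le> 1/2 * S\<^sup>2" using e by (intro mult_right_mono) auto
    finally have "S * S \<le> (30 * A ^ 3 * (e * \<Phi>)) * S" by (simp add: power2_eq_square)
    moreover have "0 \<le> 30 * A ^ 3 * (e * \<Phi>)" using A1 e Phi by simp
    ultimately show ?thesis using S0 by (cases "S = 0") (auto simp: mult_le_cancel_right)
  qed
  have "nrm u1 \<le> 2 * P" using nrm_u1_le nrm_u2_le by simp
  also have "\<dots> \<le> 2 * (e\<^sup>2 * (30 * A ^ 3 * (e * \<Phi>)))"
    by (rule mult_left_mono[OF order_trans[OF PS mult_left_mono[OF SS]]]) auto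
  also have "\<dots> = 60 * A ^ 3 * e ^ 3 * \<Phi>" by (simp add: power2_eq_square power3_eq_cube)
  finally have "(nrm u1)\<^sup>2 \<le> (60 * A ^ 3 * e ^ 3 * \<Phi>)\<^sup>2" by (intro power_mono nrm_nonneg)
  then have "\<beta> * (nrm u1)\<^sup>2 \<le> \<beta> * (60 * A ^ 3 * e ^ 3 * \<Phi>)\<^sup>2" using beta by (intro mult_left_mono) auto
  also have "\<dots> = (e ^ 4 * \<beta>) * (3600 * A ^ 6 * \<Phi>\<^sup>2) * e\<^sup>2"
  proof -
    have "(e ^ 3)\<^sup>2 = e ^ 4 * e\<^sup>2" by (simp flip: power_mult power_add)
    then show ?thesis by (simp add: power_mult_distrib mult_ac flip: power_mult)
  qed
  also have "\<dots> = (3600 * A ^ 6 * \<Phi>\<^sup>2) * e\<^sup>2" unfolding e(2) by simp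
  also have "\<dots> \<le> (3600 * A ^ 6 * \<Phi>\<^sup>2) * 1" using e e1 A1 by (intro mult_left_mono) (auto simp: power_le_one)
  finally show ?thesis by simp
qed

end

text \<open>The product 2000 \<open>A\<^sup>2 * C1\<^sup>2 * C4 * Km\<^sup>2\<close> with
  \<open>C1\<close> and \<open>C4\<close> unfolded. It stands outside the locale because the
  smallness thresholds are chosen from it before \<lambda>, \<alpha> and \<beta> are fixed.\<close>

definition layer_const :: "real \<Rightarrow> real \<Rightarrow> real" where
  "layer_const A Km = 2000 * A\<^sup>2 * (24 * A)\<^sup>2 * (2 * (24 * A)\<^sup>2 * (34 + 2 * (7 * A * (24 * A)\<^sup>2))) * Km\<^sup>2"

context layer begin

lemma layer_estimate:
  fixes C \<eta> :: real
  defines "C \<equiv> layer_const A Km"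
  assumes \<eta>: "0 < \<eta>" "80 * (1000000 * C ^ 16) * C\<^sup>2 * \<eta> \<le> 1/2"
    and sm: "L \<le> \<eta>" "\<alpha>\<^sup>2 \<le> \<eta> * L" "\<beta> * max 0 \<mu> * L\<^sup>2 \<le> \<eta>"
  shows "\<beta> * (nrm u1)\<^sup>2 \<le> 144000 * 1000000 ^ 2 * C ^ 36 * \<Phi>\<^sup>2"
proof -
  have C_eq: "C = 2000 * A\<^sup>2 * C1\<^sup>2 * C4 * Km\<^sup>2"
    by (simp add: C_def layer_const_def C4_def C3_def C1_def)
  have one: "1 \<le> A\<^sup>2" "1 \<le> C1\<^sup>2" "1 \<le> Km\<^sup>2" using A1 C1_ge Km1 by auto
  have AA: "A \<le> A\<^sup>2" using A1 by (simp add: power2_eq_square)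
  have m1: "a \<le> a * b" if "1 \<le> b" "0 \<le> a" for a b :: real using that mult_left_mono[of 1 b a] by simp
  have bounds: "A\<^sup>2 \<le> C" "1352 * A\<^sup>2 \<le> C" "A \<le> C" "A * C1\<^sup>2 \<le> C" "18 * A\<^sup>2 * C4 * Km\<^sup>2 \<le> C" "2 * C4 \<le> C" "3 * A * C4 \<le> C" "1 \<le> C"
  proof -
    define y where "y = A\<^sup>2 * C1\<^sup>2 * C4 * Km\<^sup>2"
    have C_y: "C = 2000 * y" by (simp add: C_eq y_def)
    have p: "0 \<le> A\<^sup>2 * C1\<^sup>2 * C4" "0 \<le> A\<^sup>2 * C1\<^sup>2" "0 \<le> A\<^sup>2" using C4_ge by auto
    have y1: "A\<^sup>2 * C1\<^sup>2 * C4 \<le> y" unfolding y_def by (rule m1[OF one(3) p(1)])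
    have y2: "A\<^sup>2 * C1\<^sup>2 \<le> y" using m1[OF C4_ge p(2)] y1 by linarith
    have y3: "A\<^sup>2 \<le> y" using m1[OF one(2) p(3)] y2 by linarith
    have y4: "A\<^sup>2 * C4 * Km\<^sup>2 \<le> y"
    proof -
      have "A\<^sup>2 * C4 * Km\<^sup>2 \<le> (A\<^sup>2 * C4 * Km\<^sup>2) * C1\<^sup>2" by (rule m1[OF one(2)]) (use C4_ge in auto)
      then show ?thesis by (simp add: y_def mult_ac)
    qed
    have y5: "A\<^sup>2 * C4 \<le> y" using m1[OF one(3), of "A\<^sup>2 * C4"] mult_nonneg_nonneg[of "A\<^sup>2" C4] C4_ge y4 by simp
    have y6: "A * C4 \<le> y" using mult_right_mono[OF AA, of C4] C4_ge y5 by linarith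
    have y7: "C4 \<le> y" using mult_right_mono[OF A1, of C4] C4_ge y6 by linarith
    have y8: "A * C1\<^sup>2 \<le> y" using mult_right_mono[OF AA, of "C1\<^sup>2"] y2 one by linarith
    have y9: "1 \<le> y" using y3 one by linarith
    show "A\<^sup>2 \<le> C" "1352 * A\<^sup>2 \<le> C" "A \<le> C" "A * C1\<^sup>2 \<le> C" "18 * A\<^sup>2 * C4 * Km\<^sup>2 \<le> C" "2 * C4 \<le> C" "3 * A * C4 \<le> C" "1 \<le> C"
      unfolding C_y using y3 AA y8 y4 y7 y6 y9 by linarith+
  qed
  \<comment> \<open>The fourth root turns L^(3/4), L^(3/2) and the square root of L into integral
    powers.\<close>
  define l where "l = L powr (1/4)"
  have l0: "0 < l" using L0 by (simp add: l_def)
  have lL: "l ^ 4 = L" using L0 by (simp add: l_def powr_powr flip: powr_numeral)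
  have l3: "L powr (3/4) = l ^ 3" using L0 by (simp add: l_def powr_powr flip: powr_numeral)
  have l2: "sqrt L = l\<^sup>2" using L0 by (simp add: l_def powr_powr powr_half_sqrt[symmetric] flip: powr_numeral)
  have l1: "l \<le> 1" using L0 L1 by (simp add: l_def powr_le1)
  have L2: "L\<^sup>2 = l ^ 8" "L ^ 3 = l ^ 12" unfolding lL[symmetric] by (simp_all flip: power_mult)
  have L32: "L * sqrt L = l ^ 6" by (simp only: l2) (simp flip: lL power_add)
  define Y where "Y = l ^ 6 * X + l ^ 8 * \<Phi> + l ^ 3 * sqrt (P * Q)"
  have W: "\<kappa> * W = Y + \<alpha>\<^sup>2 * h / (\<kappa> * l ^ 4)"
  proof -
    have "\<kappa> * ((a + b) / \<kappa> + c / (\<kappa>\<^sup>2 * L) + y / \<kappa>) = a + b + y + c / (\<kappa> * L)" for a b c y :: real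
      using \<kappa>0 L0 by (simp add: field_simps power2_eq_square)
    then show ?thesis unfolding W_def B_def Y_def L32 l3 lL L2(1) .
  qed
  have h': "h \<le> C * (\<kappa>\<^sup>2 * W)"
    by (rule order_trans[OF h_le], rule mult_right_mono[OF bounds(5)]) (use W_nonneg in simp)
  have nw': "nrm w \<le> C * (sqrt \<kappa> * W)"
    by (rule order_trans[OF nrm_w_le], rule mult_right_mono[OF bounds(6)]) (use W_nonneg \<kappa>0 in simp)
  have P': "P\<^sup>2 \<le> C * (l ^ 4 * Q\<^sup>2 + nrm w * P + (l ^ 8 * X\<^sup>2 + l ^ 4 * X * P + l ^ 8 * \<Phi> * P + l ^ 8 * T))"
  proof -
    have "1352 * A\<^sup>2 * (L * Q\<^sup>2) \<le> C * (L * Q\<^sup>2)" using L0 by (intro mult_right_mono bounds) auto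
    moreover have "A * (nrm w * P) \<le> C * (nrm w * P)" using P_nonneg nrm_nonneg by (intro mult_right_mono bounds) auto
    moreover have "A * C1\<^sup>2 * (L\<^sup>2 * X\<^sup>2 + L * X * P + L\<^sup>2 * \<Phi> * P + L\<^sup>2 * T) \<le> C * (L\<^sup>2 * X\<^sup>2 + L * X * P + L\<^sup>2 * \<Phi> * P + L\<^sup>2 * T)"
      using P_nonneg X_nonneg L0 Phi T_nonneg by (intro mult_right_mono bounds add_nonneg_nonneg mult_nonneg_nonneg) auto
    ultimately show ?thesis using P_step unfolding lL L2(1)[symmetric] by (simp add: distrib_left)
  qed
  have X': "X\<^sup>2 \<le> C * (X * P + \<beta> * max 0 \<mu> * P\<^sup>2 + \<Phi> * P + T)"
    by (rule order_trans[OF X_energy], intro mult_right_mono bounds add_nonneg_nonneg mult_nonneg_nonneg)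
       (use P_nonneg X_nonneg Phi T_nonneg beta in auto)
  have bk: "\<beta> * \<kappa> * l ^ 12 = 1" using \<beta>\<kappa>L L2 by simp
  have pq: "(sqrt (P * Q))\<^sup>2 = P * Q" using P_nonneg Q_nonneg by simp
  have lk: "l ^ 4 \<le> \<kappa>" using L_le_\<kappa> lL by simp
  note clo = layer_closure[OF bounds(8) X_nonneg P_nonneg Phi T_nonneg Q_nonneg _ h_nonneg nrm_nonneg \<kappa>0 l0 _ _ l1 lk bk
      Q_square pq Y_def W h' nw' P' T_le X' \<eta>]
  have c1: "P \<le> 60 * (1000000 * C ^ 17) * l ^ 6 * \<Phi>"
    and c2: "\<kappa>\<^sup>2 * W \<le> 400 * (1000000 * C ^ 17) * \<kappa> * (l ^ 8 * \<Phi>)"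
    by (rule clo; (use sm lL L2 P_nonneg Q_nonneg in simp))+
  have nu: "nrm u \<le> C * (400 * (1000000 * C ^ 17) * \<kappa> * (l ^ 8 * \<Phi>))"
  proof (rule nrm_le_if_le[OF cu])
    fix x :: real assume "x \<in> {0..1}"
    then have "cmod (u x) \<le> 3 * A * C4 * (\<kappa>\<^sup>2 * W)" by (rule u_le)
    also have "\<dots> \<le> C * (400 * (1000000 * C ^ 17) * \<kappa> * (l ^ 8 * \<Phi>))"
      using W_nonneg bounds by (intro mult_mono c2) auto
    finally show "cmod (u x) \<le> C * (400 * (1000000 * C ^ 17) * \<kappa> * (l ^ 8 * \<Phi>))" .
  qed
  \<comment> \<open>The powers combine to \<open>\<beta> * \<kappa> * l ^ 14 = l\<^sup>2\<close>,
    which is at most 1.\<close>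
  have "(nrm u1)\<^sup>2 \<le> 2 * P * nrm u" by (rule nrm_u1_square_le)
  also have "\<dots> \<le> 2 * (60 * (1000000 * C ^ 17) * l ^ 6 * \<Phi>) * (C * (400 * (1000000 * C ^ 17) * \<kappa> * (l ^ 8 * \<Phi>)))"
    using c1 nu P_nonneg nrm_nonneg[of u] bounds(8) l0 Phi by (intro mult_mono) auto
  finally have "\<beta> * (nrm u1)\<^sup>2 \<le> \<beta> * (2 * (60 * (1000000 * C ^ 17) * l ^ 6 * \<Phi>) * (C * (400 * (1000000 * C ^ 17) * \<kappa> * (l ^ 8 * \<Phi>))))"
    using beta by (intro mult_left_mono) auto
  also have "\<dots> = 48000 * 1000000 ^ 2 * (C ^ 17 * C * C ^ 17) * \<Phi>\<^sup>2 * (\<beta> * \<kappa> * (l ^ 6 * l ^ 8))"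
    by (simp add: power2_eq_square)
  also have "\<dots> = 48000 * 1000000 ^ 2 * C ^ 35 * \<Phi>\<^sup>2 * ((\<beta> * \<kappa> * l ^ 12) * l\<^sup>2)"
  proof -
    have "l ^ 6 * l ^ 8 = l ^ 12 * l\<^sup>2" "C ^ 17 * C * C ^ 17 = C ^ 35" by (simp_all flip: power_add power_Suc2)
    then show ?thesis by simp
  qed
  also have "\<dots> \<le> 144000 * 1000000 ^ 2 * C ^ 36 * \<Phi>\<^sup>2 * (1 * 1)"
    unfolding bk using bounds(8) l1 l0 power_increasing[of 35 36 C]
    by (intro mult_mono mult_left_mono mult_right_mono) (auto simp: power_le_one)
  finally show ?thesis by simp
qed

end

section \<open>From the operator graph to the integrated and weak equations\<close>

lemma L2_01_diff:
  assumes f: "L2_01 f" and g: "L2_01 g"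
  shows "L2_01 (\<lambda>x. f x - g x)"
proof -
  have fi: "set_integrable lborel {0..1} f" and gi: "set_integrable lborel {0..1} g"
    using L2_01_integrable f g by auto
  have d: "set_integrable lborel {0..1} (\<lambda>x. f x - g x)" by (rule set_integral_diff(1)[OF fi gi])
  then have m: "set_borel_measurable lborel {0..1} (\<lambda>x. f x - g x)"
    by (simp add: set_integrable_def set_borel_measurable_def)
  have m2: "set_borel_measurable lborel {0..1} (\<lambda>x. (cmod (f x - g x))\<^sup>2)"
  proof -
    have "(\<lambda>x. (cmod (indicator {0..1} x *\<^sub>R (f x - g x)))\<^sup>2) \<in> borel_measurable lborel"
      using m unfolding set_borel_measurable_def by measurable
    also have "(\<lambda>x. (cmod (indicator {0..1} x *\<^sub>R (f x - g x)))\<^sup>2) = (\<lambda>x. indicator {0..1} x *\<^sub>R (cmod (f x - g x))\<^sup>2)"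
      by (auto simp: indicator_def)
    finally show ?thesis by (simp add: set_borel_measurable_def)
  qed
  have "set_integrable lborel {0..1} (\<lambda>x. 2 * (cmod (f x))\<^sup>2 + 2 * (cmod (g x))\<^sup>2)"
    using f g by (intro set_integral_add(1)) (auto simp: L2_01_def)
  then have "set_integrable lborel {0..1} (\<lambda>x. (cmod (f x - g x))\<^sup>2)"
  proof (rule set_integrable_bound[OF _ m2], intro AE_I2 impI)
    fix x
    have "(cmod (f x - g x))\<^sup>2 \<le> (cmod (f x) + cmod (g x))\<^sup>2" by (intro power_mono norm_triangle_ineq4) auto
    also have "\<dots> \<le> 2 * (cmod (f x))\<^sup>2 + 2 * (cmod (g x))\<^sup>2"
      using sum_squares_bound[of "cmod (f x)" "cmod (g x)"] by (simp add: power2_sum)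
    finally show "norm ((cmod (f x - g x))\<^sup>2) \<le> norm (2 * (cmod (f x))\<^sup>2 + 2 * (cmod (g x))\<^sup>2)" by simp
  qed
  then show ?thesis using m by (simp add: L2_01_def)
qed

lemma continuous_on_primitive:
  fixes f :: "real \<Rightarrow> complex"
  assumes f: "set_integrable lborel {0..1} f"
  shows "continuous_on {0..1} (\<lambda>x. LBINT t:{0..x}. f t)"
  using indefinite_integral_continuous_1[OF set_borel_integral_eq_integral(1)[OF f]]
  by (subst continuous_on_cong[OF refl set_lebesgue_integral_subinterval(2)[OF f]])

lemma primitive_le_L2norm:
  assumes f: "L2_01 f" and x: "x \<in> {0..1}"
  shows "cmod (LBINT t:{0..x}. f t) \<le> L2norm_01 f"
proof -
  have fi: "set_integrable lborel {0..1} f" by (rule L2_01_integrable[OF f])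
  have nf: "set_integrable lborel {0..1} (\<lambda>t. cmod (f t))" using set_integrable_norm[OF fi] by simp
  have f2: "set_integrable lborel {0..1} (\<lambda>t. (cmod (f t))\<^sup>2)" using f by (simp add: L2_01_def)
  have "cmod (LBINT t:{0..x}. f t) \<le> (LBINT t:{0..x}. cmod (f t))"
    using set_integral_norm_bound[OF set_lebesgue_integral_subinterval(1)[OF fi x]] by simp
  also have "\<dots> \<le> (LBINT t:{0..1}. cmod (f t))"
  proof -
    have "set_integrable lborel {0..x} (\<lambda>t. cmod (f t))"
      by (rule set_integrable_subset[OF nf]) (use x in auto)
    then show ?thesis
      unfolding set_lebesgue_integral_def
      by (intro integral_mono) (use x nf in \<open>auto simp: set_integrable_def split: split_indicator\<close>)
  qed
  also have "\<dots> \<le> sqrt (LBINT t:{0..1}. (cmod (f t))\<^sup>2) * sqrt 1"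
  proof (rule le_sqrt_mult_if_young)
    fix t :: real assume t: "t > 0"
    have "2 * (LBINT x:{0..1}. cmod (f x)) = (LBINT x:{0..1}. 2 * cmod (f x))" by simp
    also have "\<dots> \<le> (LBINT x:{0..1}. t * (cmod (f x))\<^sup>2 + 1 / t)"
    proof (intro set_integral_mono set_integral_add(1))
      fix x
      have "0 \<le> (t * cmod (f x) - 1)\<^sup>2 / t" using t by simp
      also have "\<dots> = t * (cmod (f x))\<^sup>2 + 1 / t - 2 * cmod (f x)"
        using t by (simp add: power2_eq_square field_simps)
      finally show "2 * cmod (f x) \<le> t * (cmod (f x))\<^sup>2 + 1 / t" by simp
      show "set_integrable lborel {0..1::real} (\<lambda>x. 1 / t)" by (intro borel_integrable_atLeastAtMost') auto
    qed (use nf f2 in auto)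
    also have "\<dots> = t * (LBINT x:{0..1}. (cmod (f x))\<^sup>2) + (LBINT x:{0..1::real}. 1 / t)"
      using f2 by (subst set_integral_add(2)) (auto intro!: borel_integrable_atLeastAtMost')
    also have "(LBINT x:{0..1::real}. 1 / t) = 1 / t" by (simp add: set_lebesgue_integral_def content_real)
    finally show "2 * (LBINT x:{0..1}. cmod (f x)) \<le> t * (LBINT x:{0..1}. (cmod (f x))\<^sup>2) + 1 / t" .
  qed (auto simp: set_lebesgue_integral_def intro!: integral_nonneg_AE)
  finally show ?thesis by (simp add: L2norm_01_def)
qed

context profile begin

text \<open>Everything follows from the identity \<open>\<phi>1 = i \<beta> M - F\<close>, where
  \<open>M = G - \<alpha>\<^sup>2 H\<close> is the primitive of \<open>V \<phi> - U2 u\<close> and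
  \<open>F\<close> that of \<open>f\<close>. All terms vanish at 0 because \<open>u1\<close>,
  \<open>u3\<close> and \<open>U1\<close> do. The weak form integrates \<open>M\<close> by parts
  classically and \<open>F\<close> by \<open>primitive_by_parts\<close>.\<close>

lemma graph_imp_orr_sommerfeld:
  assumes gr: "Bsym_graph U U2 lam \<alpha> \<beta> u u1 f" and f: "L2_01 f" and \<beta>: "1 \<le> \<beta>" and \<alpha>: "\<alpha>\<^sup>2 \<le> 1/2"
  shows "\<exists>u2 u3 V \<phi> \<phi>1 G H. orr_sommerfeld U U1 U2 U3 A u u1 u2 u3 \<alpha> \<beta> (Re lam) (Im lam) (L2norm_01 f) V \<phi> \<phi>1 G H"
proof -
  obtain u2 u3 u4 where
    D: "\<And>x. x \<in> {0..1} \<Longrightarrow> (u has_vector_derivative u1 x) (at x within {0..1})"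
      "\<And>x. x \<in> {0..1} \<Longrightarrow> (u1 has_vector_derivative u2 x) (at x within {0..1})"
      "\<And>x. x \<in> {0..1} \<Longrightarrow> (u2 has_vector_derivative u3 x) (at x within {0..1})"
    and u3: "\<And>x. x \<in> {0..1} \<Longrightarrow> u3 x = u3 0 + (LBINT t:{0..x}. u4 t)"
    and u4: "L2_01 u4" and bc: "u1 0 = 0" "u3 0 = 0" "u 1 = 0" "u1 1 = 0"
    and ae: "AE x in lborel. x \<in> {0..1} \<longrightarrow>
           f x = - u4 x + complex_of_real (\<alpha>\<^sup>2) * u2 x
                 + \<i> * complex_of_real \<beta> * (complex_of_real (U x) + \<i> * lam)
                     * (u2 x - complex_of_real (\<alpha>\<^sup>2) * u x)
                 - \<i> * complex_of_real \<beta> * complex_of_real (U2 x) * u x"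
    using gr unfolding Bsym_graph_def by blast
  define V where "V x = Complex (U x - Im lam) (Re lam)" for x
  have V_alt: "V x = of_real (U x) + \<i> * lam" for x by (simp add: V_def complex_eq_iff)
  define \<phi> where "\<phi> x = u2 x - of_real (\<alpha>\<^sup>2) * u x" for x
  define \<phi>1 where "\<phi>1 x = u3 x - of_real (\<alpha>\<^sup>2) * u1 x" for x
  define G where "G x = V x * u1 x - of_real (U1 x) * u x" for x
  define H where "H x = integral {0..x} (\<lambda>t. V t * u t)" for x
  define F where "F x = (LBINT t:{0..x}. f t)" for x
  define M where "M x = G x - of_real (\<alpha>\<^sup>2) * H x" for x
  have cu: "continuous_on {0..1} u" and cu1: "continuous_on {0..1} u1" and cu2: "continuous_on {0..1} u2"
    using vector_derivative_continuous_on[OF D(1)] vector_derivative_continuous_on[OF D(2)] vector_derivative_continuous_on[OF D(3)] by auto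
  have u4i: "set_integrable lborel {0..1} u4" and fi: "set_integrable lborel {0..1} f"
    using L2_01_integrable u4 f by auto
  have cu3: "continuous_on {0..1} u3"
    by (subst continuous_on_cong[OF refl u3]) (auto intro!: continuous_intros continuous_on_primitive u4i)
  have cF: "continuous_on {0..1} F" unfolding F_def[abs_def] by (rule continuous_on_primitive[OF fi])
  have cV: "continuous_on {0..1} V" unfolding V_alt[abs_def] by (intro continuous_intros cU)
  have dV: "(V has_vector_derivative of_real (U1 x)) (at x within {0..1})" if "x \<in> {0..1}" for x
    unfolding V_alt[abs_def] by (auto intro!: derivative_eq_intros has_vector_derivative_of_real dU that)
  have dG: "(G has_vector_derivative V x * u2 x - of_real (U2 x) * u x) (at x within {0..1})" if "x \<in> {0..1}" for x
  proof -
    have "(G has_vector_derivative (V x * u2 x + of_real (U1 x) * u1 x) - (of_real (U1 x) * u1 x + of_real (U2 x) * u x)) (at x within {0..1})"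
      unfolding G_def[abs_def]
      by (intro has_vector_derivative_diff has_vector_derivative_mult dV D has_vector_derivative_of_real dU1 that)
    then show ?thesis by simp
  qed
  have dH: "(H has_vector_derivative V x * u x) (at x within {0..1})" if "x \<in> {0..1}" for x
    unfolding H_def[abs_def] by (rule integral_has_vector_derivative[OF _ that]) (intro continuous_intros cV cu)
  have dM: "(M has_vector_derivative V x * \<phi> x - of_real (U2 x) * u x) (at x within {0..1})" if "x \<in> {0..1}" for x
  proof -
    have "(M has_vector_derivative (V x * u2 x - of_real (U2 x) * u x) - of_real (\<alpha>\<^sup>2) * (V x * u x)) (at x within {0..1})"
      unfolding M_def[abs_def] by (intro has_vector_derivative_diff has_vector_derivative_mult_right dG dH that)
    then show ?thesis by (simp add: \<phi>_def algebra_simps)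
  qed
  have M0: "M 0 = 0" by (simp add: M_def G_def H_def bc U1_0)
  define k where "k x = of_real (\<alpha>\<^sup>2) * u2 x + \<i> * of_real \<beta> * (V x * \<phi> x - of_real (U2 x) * u x)" for x
  have ck: "continuous_on {0..1} k" unfolding k_def[abs_def] \<phi>_def
    by (intro continuous_intros cu2 cu cV cU2)
  have id: "\<phi>1 x = \<i> * of_real \<beta> * M x - F x" if x: "x \<in> {0..1}" for x
  proof -
    have "(LBINT t:{0..x}. u4 t) = (LBINT t:{0..x}. k t - f t)"
      unfolding set_lebesgue_integral_def
    proof (rule integral_cong_AE)
      show "(\<lambda>t. indicator {0..x} t *\<^sub>R u4 t) \<in> borel_measurable lborel"
        using set_lebesgue_integral_subinterval(1)[OF u4i x] by (auto simp: set_integrable_def)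
      have "set_integrable lborel {0..1} (\<lambda>t. k t - f t)"
        by (intro set_integral_diff(1) borel_integrable_atLeastAtMost' ck fi)
      from set_lebesgue_integral_subinterval(1)[OF this x]
      show "(\<lambda>t. indicator {0..x} t *\<^sub>R (k t - f t)) \<in> borel_measurable lborel" by (auto simp: set_integrable_def)
      show "AE t in lborel. indicator {0..x} t *\<^sub>R u4 t = indicator {0..x} t *\<^sub>R (k t - f t)"
        using ae
      proof eventually_elim
        case (elim t)
        show ?case
        proof (cases "t \<in> {0..x}")
          case True
          then have "t \<in> {0..1}" using x by auto
          then have "u4 t = k t - f t" using elim by (simp add: k_def \<phi>_def V_alt algebra_simps)
          then show ?thesis by simp
        qed simp
      qed
    qed
    also have "\<dots> = (LBINT t:{0..x}. k t) - F x"
      unfolding F_def using set_lebesgue_integral_subinterval(1)[OF borel_integrable_atLeastAtMost'[OF ck] x]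
        set_lebesgue_integral_subinterval(1)[OF fi x] by (rule set_integral_diff(2))
    also have "(LBINT t:{0..x}. k t) = integral {0..x} k"
      by (rule set_lebesgue_integral_subinterval(2)[OF borel_integrable_atLeastAtMost'[OF ck] x])
    also have "integral {0..x} k = (of_real (\<alpha>\<^sup>2) * u1 x + \<i> * of_real \<beta> * M x) - (of_real (\<alpha>\<^sup>2) * u1 0 + \<i> * of_real \<beta> * M 0)"
    proof (rule integral_unique, rule fundamental_theorem_of_calculus)
      fix t assume t: "t \<in> {0..x}"
      then have t1: "t \<in> {0..1}" using x by auto
      have "((\<lambda>x. of_real (\<alpha>\<^sup>2) * u1 x + \<i> * of_real \<beta> * M x) has_vector_derivative k t) (at t within {0..1})"
        unfolding k_def by (intro has_vector_derivative_add has_vector_derivative_mult_right D dM t1)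
      then show "((\<lambda>x. of_real (\<alpha>\<^sup>2) * u1 x + \<i> * of_real \<beta> * M x) has_vector_derivative k t) (at t within {0..x})"
        by (rule has_vector_derivative_within_subset) (use x in auto)
    qed (use x in auto)
    finally have "u3 x = of_real (\<alpha>\<^sup>2) * u1 x + \<i> * of_real \<beta> * M x - F x"
      using u3[OF x] by (simp add: bc M0)
    then show ?thesis by (simp add: \<phi>1_def)
  qed
  have "orr_sommerfeld U U1 U2 U3 A u u1 u2 u3 \<alpha> \<beta> (Re lam) (Im lam) (L2norm_01 f) V \<phi> \<phi>1 G H"
  proof unfold_locales
    fix x :: real assume x: "x \<in> {0..1}"
    have "\<phi>1 x - \<i> * of_real \<beta> * (G x - of_real (\<alpha>\<^sup>2) * H x) = - F x"
      using id[OF x] by (simp add: M_def)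
    then show "cmod (\<phi>1 x - \<i> * of_real \<beta> * (G x - of_real (\<alpha>\<^sup>2) * H x)) \<le> L2norm_01 f"
      using primitive_le_L2norm[OF f x] by (simp add: F_def)
  next
    fix q q' :: "real \<Rightarrow> complex"
    assume dq: "\<And>x. x \<in> {0..1} \<Longrightarrow> (q has_vector_derivative q' x) (at x within {0..1})"
      and cq': "continuous_on {0..1} q'"
    have cq: "continuous_on {0..1} q" by (rule vector_derivative_continuous_on[OF dq])
    have cM: "continuous_on {0..1} M" by (rule vector_derivative_continuous_on[OF dM])
    have cM': "continuous_on {0..1} (\<lambda>x. V x * \<phi> x - of_real (U2 x) * u x)"
      unfolding \<phi>_def by (intro continuous_intros cu2 cu cV cU2)
    let ?J = "integral {0..1} (\<lambda>x. (V x * \<phi> x - of_real (U2 x) * u x) * q x)"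
    let ?I = "integral {0..1} (\<lambda>x. M x * q' x)"
    have "((\<lambda>x. M x * q' x + (V x * \<phi> x - of_real (U2 x) * u x) * q x) has_integral (M 1 * q 1 - M 0 * q 0)) {0..1}"
      by (rule fundamental_theorem_of_calculus) (auto intro!: has_vector_derivative_mult dM dq)
    then have "M 1 * q 1 = integral {0..1} (\<lambda>x. M x * q' x + (V x * \<phi> x - of_real (U2 x) * u x) * q x)"
      by (simp add: integral_unique M0)
    also have "\<dots> = ?I + ?J"
      by (intro integral_add integrable_continuous_interval continuous_on_mult cM cq' cM' cq)
    \<comment> \<open>The \<open>M\<close> part of the weak form cancels against the boundary term
      \<open>\<phi>1 1 * q 1\<close>; what is left is exactly the integral of
      \<open>f * q\<close>.\<close>
    finally have parts: "?I + ?J = M 1 * q 1" ..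
    have "integral {0..1} (\<lambda>x. \<phi>1 x * q' x) = integral {0..1} (\<lambda>x. \<i> * of_real \<beta> * (M x * q' x) - F x * q' x)"
      by (rule integral_cong) (simp add: id left_diff_distrib)
    also have "\<dots> = \<i> * of_real \<beta> * ?I - integral {0..1} (\<lambda>x. F x * q' x)"
      by (subst integral_diff) (auto intro!: integrable_continuous_interval continuous_intros cM cq' cF)
    finally have i1: "integral {0..1} (\<lambda>x. \<phi>1 x * q' x) = \<i> * of_real \<beta> * ?I - integral {0..1} (\<lambda>x. F x * q' x)" .
    have i2: "(LBINT x:{0..1}. f x * q x) = F 1 * q 1 - integral {0..1} (\<lambda>x. F x * q' x)"
      unfolding F_def by (rule primitive_by_parts[OF fi dq cq'])
    have "\<i> * of_real \<beta> * ?J - \<phi>1 1 * q 1 + integral {0..1} (\<lambda>x. \<phi>1 x * q' x)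
      = \<i> * of_real \<beta> * (?I + ?J) - \<i> * of_real \<beta> * (M 1 * q 1) + (F 1 * q 1 - integral {0..1} (\<lambda>x. F x * q' x))"
      unfolding i1 id[of 1, simplified] by (simp add: algebra_simps)
    also have "\<dots> = (LBINT x:{0..1}. f x * q x)" unfolding parts i2 by simp
    finally show "cmod (\<i> * of_real \<beta> * ?J - \<phi>1 1 * q 1 + integral {0..1} (\<lambda>x. \<phi>1 x * q' x)) \<le> L2norm_01 f * nrm q"
      using L2_01_mult_continuous(2)[OF f cq] by simp
  qed (use D cu3 bc \<beta> \<alpha> L2norm_01_nonneg in \<open>simp_all add: V_def \<phi>_def \<phi>1_def G_def H_def\<close>)
  then show ?thesis by blast
qed

end

text \<open>All constants are fixed from \<open>A\<close> alone. Each solution then falls under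
  \<open>large_parameter_estimate\<close> or, with suitable \<kappa> and \<open>L\<close>, under
  \<open>layer_estimate\<close>.\<close>

lemma a_priori_estimate:
  fixes U U1 U2 U3 :: "real \<Rightarrow> real" and A :: real
  assumes prof: "profile U U1 U2 U3 A"
  shows "\<exists>\<alpha>L \<Upsilon> \<beta>0 K. 0 < \<alpha>L \<and> \<alpha>L \<le> 1/4 \<and> 0 < \<Upsilon> \<and> 1 < \<beta>0 \<and> 0 < K \<and>
    (\<forall>u u1 u2 u3 \<alpha> \<beta> \<mu> \<nu> \<Phi> V \<phi> \<phi>1 G H.
      orr_sommerfeld U U1 U2 U3 A u u1 u2 u3 \<alpha> \<beta> \<mu> \<nu> \<Phi> V \<phi> \<phi>1 G H \<longrightarrow> \<beta>0 < \<beta> \<longrightarrow>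
      \<alpha>\<^sup>2 \<le> \<alpha>L\<^sup>2 * \<beta> powr (-1/3) \<longrightarrow> \<mu> < \<Upsilon> * \<beta> powr (-1/2) \<longrightarrow> \<beta> * (nrm u1)\<^sup>2 \<le> K * \<Phi>\<^sup>2)"
proof -
  interpret profile U U1 U2 U3 A by (rule prof)
  \<comment> \<open>When \<open>\<bar>\<mu>\<bar> + d < 20 * A\<close>, each of the three candidates
    for \<kappa> is at most \<open>20 * A + 1\<close>.\<close>
  define Km where "Km = 20 * A + 1"
  have Km1: "1 \<le> Km" using A1 by (simp add: Km_def)
  define C where "C = layer_const A Km"
  have C0: "0 < C" unfolding C_def layer_const_def using A1 Km1 by (simp add: add_pos_nonneg)
  define \<eta> where "\<eta> = 1 / (160 * (1000000 * C ^ 16) * C\<^sup>2)"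
  have \<eta>0: "0 < \<eta>" using C0 by (simp add: \<eta>_def)
  have \<eta>1: "80 * (1000000 * C ^ 16) * C\<^sup>2 * \<eta> \<le> 1/2" using C0 by (simp add: \<eta>_def)
  \<comment> \<open>Since \<open>L \<ge> \<beta> powr (-1/3) / Km\<close>, the condition
    \<open>\<alpha>L\<^sup>2 * Km \<le> \<eta>\<close> gives
    \<open>\<alpha>\<^sup>2 \<le> \<eta> * L\<close>. The bound 1/4 serves
    \<open>16 * \<alpha>\<^sup>2 \<le> 1\<close>.\<close>
  define \<alpha>L where "\<alpha>L = min (1/4) (sqrt (\<eta> / Km))"
  have \<alpha>L: "0 < \<alpha>L" "\<alpha>L \<le> 1/4" using \<eta>0 Km1 by (auto simp: \<alpha>L_def)
  have \<alpha>L2: "\<alpha>L\<^sup>2 * Km \<le> \<eta>"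
  proof -
    have "\<alpha>L\<^sup>2 \<le> (sqrt (\<eta> / Km))\<^sup>2" using \<alpha>L by (intro power_mono) (auto simp: \<alpha>L_def)
    also have "\<dots> = \<eta> / Km" using \<eta>0 Km1 by simp
    finally show ?thesis using Km1 by (simp add: pos_le_divide_eq)
  qed
  \<comment> \<open>The bound 1/2 ensures \<open>\<mu> \<le> \<kappa> * L / 2\<close>, as
    \<open>e\<^sup>2 \<le> \<kappa> * L\<close>; the bound \<eta> ensures
    \<open>\<beta> * max 0 \<mu> * L\<^sup>2 \<le> \<eta>\<close>, as
    \<open>L \<le> e\<close>.\<close>
  define \<Upsilon> where "\<Upsilon> = min (1/2) \<eta>"
  have \<Upsilon>: "0 < \<Upsilon>" "\<Upsilon> \<le> 1/2" "\<Upsilon> \<le> \<eta>" using \<eta>0 by (auto simp: \<Upsilon>_def)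
  \<comment> \<open>The two fourth powers guarantee \<open>e \<le> \<eta>\<close> and
    \<open>198 * A ^ 3 * e \<le> 1\<close> for \<open>e\<close> = \<beta>^(-1/4).\<close>
  define \<beta>0 where "\<beta>0 = 2 + (1 / \<eta>) ^ 4 + (198 * A ^ 3) ^ 4"
  have \<beta>0: "1 < \<beta>0" "(1 / \<eta>) ^ 4 \<le> \<beta>0" "(198 * A ^ 3) ^ 4 \<le> \<beta>0"
  proof -
    have "0 \<le> (1 / \<eta>) ^ 4" "0 \<le> (198 * A ^ 3) ^ 4" by auto
    then show "1 < \<beta>0" "(1 / \<eta>) ^ 4 \<le> \<beta>0" "(198 * A ^ 3) ^ 4 \<le> \<beta>0" unfolding \<beta>0_def by linarith+
  qed
  define K where "K = 3600 * A ^ 6 + 144000 * 1000000 ^ 2 * C ^ 36"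
  have K0: "0 < K" using A1 C0 by (simp add: K_def add_pos_pos)
  have "\<beta> * (nrm u1)\<^sup>2 \<le> K * \<Phi>\<^sup>2"
    if os: "orr_sommerfeld U U1 U2 U3 A u u1 u2 u3 \<alpha> \<beta> \<mu> \<nu> \<Phi> V \<phi> \<phi>1 G H" and \<beta>: "\<beta>0 < \<beta>"
      and \<alpha>: "\<alpha>\<^sup>2 \<le> \<alpha>L\<^sup>2 * \<beta> powr (-1/3)" and \<mu>: "\<mu> < \<Upsilon> * \<beta> powr (-1/2)"
    for u u1 u2 u3 \<alpha> \<beta> \<mu> \<nu> \<Phi> V \<phi> \<phi>1 G H
  proof -
    interpret orr_sommerfeld U U1 U2 U3 A u u1 u2 u3 \<alpha> \<beta> \<mu> \<nu> \<Phi> V \<phi> \<phi>1 G H by (rule os)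
    have \<beta>1: "1 < \<beta>" using \<beta> \<beta>0 by simp
    define e where "e = \<beta> powr (-1/4)"
    have e0: "0 < e" using \<beta>1 by (simp add: e_def)
    have "e ^ 4 = \<beta> powr (- 1)" using \<beta>1 by (simp add: e_def powr_powr flip: powr_numeral)
    then have e4: "e ^ 4 * \<beta> = 1" using \<beta>1 by (simp add: powr_minus)
    have e2: "\<beta> powr (-1/2) = e\<^sup>2" using \<beta>1 by (simp add: e_def powr_powr flip: powr_numeral)
    have e_le: "e * c \<le> 1" if "c ^ 4 \<le> \<beta>0" "0 \<le> c" for c
    proof -
      have "(e * c) ^ 4 = e ^ 4 * c ^ 4" by (simp add: power_mult_distrib)
      also have "\<dots> \<le> e ^ 4 * \<beta>" using that \<beta> e0 by (intro mult_left_mono) auto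
      also have "\<dots> = 1 ^ 4" using e4 by simp
      finally show ?thesis using power_mono_iff[of "e * c" 1 4] that e0 by simp
    qed
    have e\<eta>: "e \<le> \<eta>" using e_le[OF \<beta>0(2)] \<eta>0 by (simp add: field_simps)
    have eA: "198 * A ^ 3 * e \<le> 1" using e_le[OF \<beta>0(3)] A1 by (simp add: mult_ac)
    have e1: "e \<le> 1" using e_le[of 1] \<beta>0 by simp
    have \<mu>e: "\<mu> \<le> \<Upsilon> * e\<^sup>2" using \<mu> e2 by simp
    have e21: "e\<^sup>2 \<le> 1" using e1 e0 by (simp add: power_le_one)
    have ebk: "\<beta> powr (-1/3) \<le> 1" using powr_mono[of "-1/3" 0 \<beta>] \<beta>1 by simp
    have \<alpha>16: "16 * \<alpha>\<^sup>2 \<le> 1"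
    proof -
      have "\<alpha>L\<^sup>2 \<le> (1/4)\<^sup>2" using \<alpha>L by (intro power_mono) auto
      then have "\<alpha>L\<^sup>2 * \<beta> powr (-1/3) \<le> (1/4)\<^sup>2 * 1" using ebk by (intro mult_mono) auto
      then show ?thesis using \<alpha> by (simp add: power2_eq_square)
    qed
    obtain xc d where cp: "xc \<in> {0..1}" "0 \<le> d"
      "\<And>x. x \<in> {0..1} \<Longrightarrow> \<bar>x\<^sup>2 - xc\<^sup>2\<bar> / (2 * A) + d \<le> \<bar>U x - \<nu>\<bar>"
      "\<And>x. x \<in> {0..1} \<Longrightarrow> \<bar>U x - \<nu>\<bar> \<le> A / 2 * \<bar>x\<^sup>2 - xc\<^sup>2\<bar> + d"
      and sgn: "(\<forall>x\<in>{0..1}. d \<le> U x - \<nu>) \<or> (\<forall>x\<in>{0..1}. d \<le> \<nu> - U x) \<or> d = 0"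
      by (rule critical_point[of \<nu>]) blast
    have \<Upsilon>e: "\<Upsilon> * e\<^sup>2 \<le> 1/2" using mult_mono[OF \<Upsilon>(2) e21] by simp
    show ?thesis
    proof (cases "20 * A \<le> \<bar>\<mu>\<bar> + d")
      case True
      have "\<beta> * (nrm u1)\<^sup>2 \<le> 3600 * A ^ 6 * \<Phi>\<^sup>2"
      proof (rule large_parameter_estimate[OF cp(2) _ _ sgn True _ \<alpha>16 e0 e4 eA])
        fix x :: real assume x: "x \<in> {0..1}"
        have "0 \<le> \<bar>x\<^sup>2 - xc\<^sup>2\<bar> / (2 * A)" using A1 by simp
        then show "d \<le> \<bar>U x - \<nu>\<bar>" using cp(3)[OF x] by linarith
        have "0 \<le> x\<^sup>2" "x\<^sup>2 \<le> 1" "0 \<le> xc\<^sup>2" "xc\<^sup>2 \<le> 1" using x cp(1) by (auto simp: power_le_one)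
        then have "\<bar>x\<^sup>2 - xc\<^sup>2\<bar> \<le> 1" by linarith
        then have "A / 2 * \<bar>x\<^sup>2 - xc\<^sup>2\<bar> \<le> A / 2 * 1" using A1 by (intro mult_left_mono) auto
        then show "\<bar>U x - \<nu>\<bar> \<le> A / 2 + d" using cp(4)[OF x] by simp
      next
        show "\<mu> \<le> 1" using \<mu>e \<Upsilon>e by simp
      qed
      also have "\<dots> \<le> K * \<Phi>\<^sup>2" unfolding K_def using C0 by (intro mult_right_mono) auto
      finally show ?thesis .
    next
      case False
      define E where "E = \<bar>\<mu>\<bar> + d"
      have E0: "0 \<le> E" "E \<le> 20 * A" using cp(2) False by (auto simp: E_def)
      define \<kappa> where "\<kappa> = max xc (max e (sqrt E))"
      have \<kappa>0: "0 < \<kappa>" using e0 by (simp add: \<kappa>_def)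
      have \<kappa>e: "e \<le> \<kappa>" "xc \<le> \<kappa>" "sqrt E \<le> \<kappa>" by (auto simp: \<kappa>_def)
      have E\<kappa>: "E \<le> \<kappa>\<^sup>2" using power_mono[OF \<kappa>e(3), of 2] E0 by simp
      have \<kappa>Km: "\<kappa> \<le> Km"
      proof -
        have "sqrt E \<le> sqrt ((20 * A + 1)\<^sup>2)"
        proof (rule real_sqrt_le_mono)
          have "20 * A + 1 \<le> (20 * A + 1)\<^sup>2" using A1 by (simp add: power2_eq_square)
          then show "E \<le> (20 * A + 1)\<^sup>2" using E0 by linarith
        qed
        then have "sqrt E \<le> Km" using A1 by (simp add: Km_def)
        then show ?thesis using cp(1) e1 Km1 by (simp add: \<kappa>_def)
      qed
      define L where "L = root 3 (1 / (\<beta> * \<kappa>))"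
      have L0: "0 < L" using \<beta>1 \<kappa>0 by (simp add: L_def)
      have L3: "L ^ 3 = 1 / (\<beta> * \<kappa>)" using \<beta>1 \<kappa>0 by (simp add: L_def)
      have bkL: "\<beta> * \<kappa> * L ^ 3 = 1" using L3 \<beta>1 \<kappa>0 by simp
      have inv\<beta>: "1 / \<beta> = e ^ 4" using e4 \<beta>1 by (simp add: field_simps)
      have L3e: "L ^ 3 = e ^ 4 / \<kappa>" using L3 inv\<beta> by (metis divide_divide_eq_left)
      have Le: "L \<le> e"
      proof (rule power_le_imp_le_base[where n = 2])
        have "e ^ 4 / \<kappa> \<le> e ^ 4 / e" using \<kappa>e e0 by (intro divide_left_mono) auto
        also have "\<dots> = e ^ 3" using e0 by (simp add: power_eq_if)
        finally show "L ^ Suc 2 \<le> e ^ Suc 2" using L3e by (simp add: eval_nat_numeral)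
      qed (use e0 in simp)
      have L\<kappa>: "L \<le> \<kappa>" using Le \<kappa>e by simp
      \<comment> \<open>\<open>\<kappa> * L\<close> is the cube root of
        \<open>\<kappa>\<^sup>2 * e ^ 4\<close>, hence smallest at the floor
        \<open>\<kappa> = e\<close>.\<close>
      have e2kL: "e\<^sup>2 \<le> \<kappa> * L"
      proof (rule power_le_imp_le_base[where n = 2])
        have "(e\<^sup>2) ^ 3 = e ^ 4 * e\<^sup>2" by (simp flip: power_mult power_add)
        also have "\<dots> \<le> e ^ 4 * \<kappa>\<^sup>2" using \<kappa>e e0 by (intro mult_left_mono power_mono) auto
        also have "\<dots> = (\<kappa> * L) ^ 3" unfolding power_mult_distrib L3e using \<kappa>0 by (simp add: power2_eq_square power3_eq_cube)
        finally show "(e\<^sup>2) ^ Suc 2 \<le> (\<kappa> * L) ^ Suc 2" by (simp add: eval_nat_numeral)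
      qed (use \<kappa>0 L0 in simp)
      have \<kappa>c: "\<kappa> = xc \<or> \<kappa> = L \<or> \<kappa>\<^sup>2 = \<bar>\<mu>\<bar> + d"
      proof -
        consider "\<kappa> = xc" | "\<kappa> = e" | "\<kappa> = sqrt E" unfolding \<kappa>_def by linarith
        then show ?thesis
        proof cases
          case 2
          \<comment> \<open>At the floor the layer width coincides with \<kappa>.\<close>
          have "L ^ 3 = e ^ 3" using L3e 2 e0 by (simp add: power_eq_if)
          then have "L = e" using L0 e0 by (metis less_imp_le power_eq_imp_eq_base zero_less_numeral)
          then show ?thesis using 2 by simp
        next
          case 3
          then have "\<kappa>\<^sup>2 = E" using E0 by simp
          then show ?thesis by (simp add: E_def)
        qed simp
      qed
      interpret layer U U1 U2 U3 A u u1 u2 u3 \<alpha> \<beta> \<mu> \<nu> \<Phi> V \<phi> \<phi>1 G H xc d \<kappa> L Km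
      proof unfold_locales
        show "\<mu> \<le> \<kappa> * L / 2"
          using \<mu>e mult_right_mono[OF \<Upsilon>(2), of "e\<^sup>2"] e2kL by simp
        show "L \<le> 1" using Le e1 by simp
        show "\<bar>\<mu>\<bar> + d \<le> \<kappa>\<^sup>2" using E\<kappa> by (simp add: E_def)
      qed (use cp \<kappa>0 L0 L\<kappa> bkL \<kappa>e \<kappa>Km Km1 \<kappa>c in auto)
      have "\<beta> * (nrm u1)\<^sup>2 \<le> 144000 * 1000000 ^ 2 * C ^ 36 * \<Phi>\<^sup>2"
        unfolding C_def
      proof (rule layer_estimate[OF \<eta>0 \<eta>1[unfolded C_def]])
        show "L \<le> \<eta>" using Le e\<eta> by simp
        show "\<alpha>\<^sup>2 \<le> \<eta> * L"
        proof -
          define b where "b = \<beta> powr (-1/3)"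
          have b0: "0 < b" using \<beta>1 by (simp add: b_def)
          have "b ^ 3 = \<beta> powr (- 1)" using \<beta>1 by (simp add: b_def powr_powr flip: powr_numeral)
          then have b3: "b ^ 3 = 1 / \<beta>" using \<beta>1 by (simp add: powr_minus divide_inverse)
          have "b / Km \<le> L"
          proof (rule power_le_imp_le_base[where n = 2])
            have "(b / Km) ^ 3 = 1 / \<beta> / Km ^ 3" by (simp add: power_divide b3)
            also have "\<dots> \<le> 1 / \<beta> / \<kappa>"
            proof (rule divide_left_mono)
              have "\<kappa> \<le> Km ^ 1" using \<kappa>Km by simp
              also have "\<dots> \<le> Km ^ 3" using Km1 by (intro power_increasing) auto
              finally show "\<kappa> \<le> Km ^ 3" .
            qed (use \<beta>1 \<kappa>0 Km1 in auto)
            finally show "(b / Km) ^ Suc 2 \<le> L ^ Suc 2" using L3 by (simp add: eval_nat_numeral)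
          qed (use L0 in simp)
          then have bL: "b \<le> Km * L" using Km1 by (simp add: pos_divide_le_eq mult.commute)
          have "\<alpha>\<^sup>2 \<le> \<alpha>L\<^sup>2 * b" using \<alpha> by (simp add: b_def)
          also have "\<dots> \<le> \<alpha>L\<^sup>2 * (Km * L)" by (intro mult_left_mono bL) auto
          also have "\<dots> = (\<alpha>L\<^sup>2 * Km) * L" by simp
          also have "\<dots> \<le> \<eta> * L" using \<alpha>L2 L0 by (intro mult_right_mono) auto
          finally show ?thesis .
        qed
        show "\<beta> * max 0 \<mu> * L\<^sup>2 \<le> \<eta>"
        proof -
          have "max 0 \<mu> \<le> \<eta> * e\<^sup>2"
            using \<mu>e mult_right_mono[OF \<Upsilon>(3), of "e\<^sup>2"] \<eta>0 by simp
          moreover have "L\<^sup>2 \<le> e\<^sup>2" using Le L0 by (intro power_mono) auto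
          ultimately have "max 0 \<mu> * L\<^sup>2 \<le> (\<eta> * e\<^sup>2) * e\<^sup>2" using \<eta>0 by (intro mult_mono) auto
          then have "\<beta> * (max 0 \<mu> * L\<^sup>2) \<le> \<beta> * ((\<eta> * e\<^sup>2) * e\<^sup>2)" using \<beta>1 by (intro mult_left_mono) auto
          also have "\<dots> = \<eta> * (e ^ 4 * \<beta>)"
          proof -
            have "e ^ 4 = e\<^sup>2 * e\<^sup>2" by (simp flip: power_add)
            then show ?thesis by (simp only: mult_ac)
          qed
          finally show ?thesis unfolding e4 by (simp add: mult.assoc)
        qed
      qed
      also have "\<dots> \<le> K * \<Phi>\<^sup>2" unfolding K_def using A1 by (intro mult_right_mono) auto
      finally show ?thesis .
    qed
  qed
  then show ?thesis using \<alpha>L \<Upsilon> \<beta>0 K0 by blast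
qed

section \<open>Existence by shooting\<close>

text \<open>As \<open>f\<close> is only square integrable, \<open>u'''\<close> need not be differentiable; \<open>z = u''' + \<integral>\<^sub>0\<^sup>x f\<close> is.\<close>

definition ivp_solution ::
  "(real \<Rightarrow> real) \<Rightarrow> (real \<Rightarrow> real) \<Rightarrow> complex \<Rightarrow> real \<Rightarrow> real \<Rightarrow>
   (real \<Rightarrow> complex) \<Rightarrow> (real \<Rightarrow> complex) \<Rightarrow> (real \<Rightarrow> complex) \<Rightarrow> (real \<Rightarrow> complex) \<Rightarrow> bool" where
  "ivp_solution U U2 lam \<alpha> \<beta> u u1 u2 f \<longleftrightarrow>
     (\<exists>u3 z z'. (\<forall>x\<in>{0..1}. (u has_vector_derivative u1 x) (at x within {0..1}) \<and>
                     (u1 has_vector_derivative u2 x) (at x within {0..1}) \<and>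
                     (u2 has_vector_derivative u3 x) (at x within {0..1}) \<and>
                     (z has_vector_derivative z' x) (at x within {0..1}) \<and>
                     u3 x = z x - (LBINT t:{0..x}. f t) \<and>
                     z' x = of_real (\<alpha>\<^sup>2) * u2 x + \<i> * of_real \<beta> * ((of_real (U x) + \<i> * lam) * (u2 x - of_real (\<alpha>\<^sup>2) * u x)
                            - of_real (U2 x) * u x)) \<and>
        u1 0 = 0 \<and> z 0 = 0)"

lemma ivp_solution_add_scaled:
  assumes u: "ivp_solution U U2 lam \<alpha> \<beta> u u1 u2 f" and v: "ivp_solution U U2 lam \<alpha> \<beta> v v1 v2 (\<lambda>_. 0)"
  shows "ivp_solution U U2 lam \<alpha> \<beta> (\<lambda>x. u x + c * v x) (\<lambda>x. u1 x + c * v1 x) (\<lambda>x. u2 x + c * v2 x) f"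
proof -
  obtain u3 z z' where U: "\<forall>x\<in>{0..1}. (u has_vector_derivative u1 x) (at x within {0..1}) \<and>
                     (u1 has_vector_derivative u2 x) (at x within {0..1}) \<and>
                     (u2 has_vector_derivative u3 x) (at x within {0..1}) \<and>
                     (z has_vector_derivative z' x) (at x within {0..1}) \<and>
                     u3 x = z x - (LBINT t:{0..x}. f t) \<and>
                     z' x = of_real (\<alpha>\<^sup>2) * u2 x + \<i> * of_real \<beta> * ((of_real (U x) + \<i> * lam) * (u2 x - of_real (\<alpha>\<^sup>2) * u x)
                            - of_real (U2 x) * u x)" "u1 0 = 0" "z 0 = 0"
    using u unfolding ivp_solution_def by blast
  obtain v3 y y' where V: "\<forall>x\<in>{0..1}. (v has_vector_derivative v1 x) (at x within {0..1}) \<and>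
                     (v1 has_vector_derivative v2 x) (at x within {0..1}) \<and>
                     (v2 has_vector_derivative v3 x) (at x within {0..1}) \<and>
                     (y has_vector_derivative y' x) (at x within {0..1}) \<and>
                     v3 x = y x - (LBINT t:{0..x}. 0) \<and>
                     y' x = of_real (\<alpha>\<^sup>2) * v2 x + \<i> * of_real \<beta> * ((of_real (U x) + \<i> * lam) * (v2 x - of_real (\<alpha>\<^sup>2) * v x)
                            - of_real (U2 x) * v x)" "v1 0 = 0" "y 0 = 0"
    using v unfolding ivp_solution_def by blast
  have a1: "z' x + c * y' x = of_real (\<alpha>\<^sup>2) * (u2 x + c * v2 x) + \<i> * of_real \<beta> * ((of_real (U x) + \<i> * lam)
      * ((u2 x + c * v2 x) - of_real (\<alpha>\<^sup>2) * (u x + c * v x)) - of_real (U2 x) * (u x + c * v x))"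
    if "x \<in> {0..1}" for x
  proof -
    have e: "z' x = of_real (\<alpha>\<^sup>2) * u2 x + \<i> * of_real \<beta> * ((of_real (U x) + \<i> * lam) * (u2 x - of_real (\<alpha>\<^sup>2) * u x) - of_real (U2 x) * u x)"
      "y' x = of_real (\<alpha>\<^sup>2) * v2 x + \<i> * of_real \<beta> * ((of_real (U x) + \<i> * lam) * (v2 x - of_real (\<alpha>\<^sup>2) * v x) - of_real (U2 x) * v x)"
      using U(1) V(1) that by blast+
    show ?thesis unfolding e by (simp add: algebra_simps)
  qed
  have a2: "u3 x + c * v3 x = (z x + c * y x) - (LBINT t:{0..x}. f t)" if "x \<in> {0..1}" for x
    using U(1) V(1) that by simp
  have D: "(u has_vector_derivative u1 x) (at x within {0..1})" "(u1 has_vector_derivative u2 x) (at x within {0..1})"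
    "(u2 has_vector_derivative u3 x) (at x within {0..1})" "(z has_vector_derivative z' x) (at x within {0..1})"
    "(v has_vector_derivative v1 x) (at x within {0..1})" "(v1 has_vector_derivative v2 x) (at x within {0..1})"
    "(v2 has_vector_derivative v3 x) (at x within {0..1})" "(y has_vector_derivative y' x) (at x within {0..1})"
    if "x \<in> {0..1}" for x using U(1) V(1) that by blast+
  have b: "u1 0 + c * v1 0 = 0" "z 0 + c * y 0 = 0" using U V by auto
  show ?thesis
    unfolding ivp_solution_def
    by (intro exI[of _ "\<lambda>x. u3 x + c * v3 x"] exI[of _ "\<lambda>x. z x + c * y x"] exI[of _ "\<lambda>x. z' x + c * y' x"] conjI ballI
          has_vector_derivative_add has_vector_derivative_mult_right D a1 a2 b)
qed

lemma ivp_solution_zero: "ivp_solution U U2 lam \<alpha> \<beta> (\<lambda>_. 0) (\<lambda>_. 0) (\<lambda>_. 0) (\<lambda>_. 0)"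
  unfolding ivp_solution_def
  by (rule exI[of _ "\<lambda>_. 0"], rule exI[of _ "\<lambda>_. 0"], rule exI[of _ "\<lambda>_. 0"]) auto

lemma norm_quadruple_le:
  fixes a b c z :: complex
  shows "norm (a, b, c, z) \<le> norm a + norm b + norm c + norm z"
  using norm_Pair_le[of a "(b, c, z)"] norm_Pair_le[of b "(c, z)"] norm_Pair_le[of c z] by linarith

lemma norm_quadruple_ge:
  fixes a b c z :: complex
  shows "norm a \<le> norm (a, b, c, z)" "norm b \<le> norm (a, b, c, z)" "norm c \<le> norm (a, b, c, z)" "norm z \<le> norm (a, b, c, z)"
proof -
  have 1: "norm a \<le> norm (a, b, c, z)" "norm (b, c, z) \<le> norm (a, b, c, z)" using norm_fst_le norm_snd_le by auto
  have 2: "norm b \<le> norm (b, c, z)" "norm (c, z) \<le> norm (b, c, z)" using norm_fst_le norm_snd_le by auto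
  have 3: "norm c \<le> norm (c, z)" "norm z \<le> norm (c, z)" using norm_fst_le norm_snd_le by auto
  show "norm a \<le> norm (a, b, c, z)" "norm b \<le> norm (a, b, c, z)" "norm c \<le> norm (a, b, c, z)" "norm z \<le> norm (a, b, c, z)"
    using 1 2 3 by linarith+
qed

context profile begin

text \<open>A first-order system for \<open>u\<close>, \<open>u1\<close>, \<open>u2\<close> and
  \<open>z\<close>, in which \<open>f\<close> enters only through its continuous primitive
  \<open>F\<close>.\<close>

lemma ivp_solution_exists:
  assumes f: "L2_01 f"
  shows "\<exists>u u1 u2. ivp_solution U U2 lam \<alpha> \<beta> u u1 u2 f \<and> u 0 = a \<and> u2 0 = c"
proof -
  define F where "F x = (LBINT t:{0..x}. f t)" for x
  have cF: "continuous_on {0..1} F" unfolding F_def[abs_def] by (rule continuous_on_primitive[OF L2_01_integrable[OF f]])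
  define V where "V x = of_real (U x) + \<i> * lam" for x
  have cV: "continuous_on {0..1} V" unfolding V_def[abs_def] by (intro continuous_intros cU)
  define k where "k t a c = of_real (\<alpha>\<^sup>2) * c + \<i> * of_real \<beta> * (V t * (c - of_real (\<alpha>\<^sup>2) * a) - of_real (U2 t) * a)"
    for t and a c :: complex
  define \<Theta> where "\<Theta> t p = (case p of (a, b, c, z) \<Rightarrow> (b, c, z - F t, k t a c))" for t and p :: "complex \<times> complex \<times> complex \<times> complex"
  obtain B where B: "\<And>t. t \<in> {0..1} \<Longrightarrow> cmod (V t) \<le> B" "\<And>t. t \<in> {0..1} \<Longrightarrow> \<bar>U2 t\<bar> \<le> B"
  proof -
    obtain B1 where "\<forall>y\<in>V ` {0..1}. cmod y \<le> B1"
      using compact_imp_bounded[OF compact_continuous_image[OF cV compact_Icc]] unfolding bounded_iff by blast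
    moreover obtain B2 where "\<forall>y\<in>U2 ` {0..1}. norm y \<le> B2"
      using compact_imp_bounded[OF compact_continuous_image[OF cU2 compact_Icc]] unfolding bounded_iff by blast
    ultimately show ?thesis by (intro that[of "max B1 B2"]) (auto simp: le_max_iff_disj)
  qed
  have B0: "0 \<le> B" using order_trans[OF norm_ge_zero B(1)[of 0]] by simp
  define K where "K = 3 + (\<alpha>\<^sup>2 + \<bar>\<beta>\<bar> * (B * (1 + \<alpha>\<^sup>2) + B))"
  have "\<exists>y. y 0 = (a, 0, c, 0) \<and> (\<forall>x\<in>{0..1}. (y has_vector_derivative \<Theta> x (y x)) (at x within {0..1}))"
  proof (rule picard_lindeloef_lipschitz)
    fix y :: "real \<Rightarrow> complex \<times> complex \<times> complex \<times> complex" assume y: "continuous_on {0..1} y"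
    show "continuous_on {0..1} (\<lambda>t. \<Theta> t (y t))"
      unfolding \<Theta>_def k_def split_beta by (intro continuous_intros y cF cV cU2)
  next
    fix t :: real and p p' :: "complex \<times> complex \<times> complex \<times> complex" assume t: "t \<in> {0..1}"
    obtain a b c z where p: "p = (a, b, c, z)" by (cases p)
    obtain a' b' c' z' where p': "p' = (a', b', c', z')" by (cases p')
    define N where "N = norm (p - p')"
    have n: "norm (a - a') \<le> N" "norm (b - b') \<le> N" "norm (c - c') \<le> N" "norm (z - z') \<le> N"
      unfolding N_def p p' using norm_quadruple_ge[where a = "a - a'" and b = "b - b'" and c = "c - c'" and z = "z - z'"] by auto
    have N0: "0 \<le> N" by (simp add: N_def)
    have kk: "k t a c - k t a' c' = k t (a - a') (c - c')" by (simp add: k_def algebra_simps)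
    have "norm (k t (a - a') (c - c')) \<le> \<alpha>\<^sup>2 * N + \<bar>\<beta>\<bar> * (B * (N + \<alpha>\<^sup>2 * N) + B * N)"
    proof -
      have 1: "norm (of_real (\<alpha>\<^sup>2) * (c - c')) \<le> \<alpha>\<^sup>2 * N"
        using n(3) by (simp add: norm_mult norm_power mult_left_mono)
      have 2: "norm (of_real (\<alpha>\<^sup>2) * (a - a')) \<le> \<alpha>\<^sup>2 * N"
        using n(1) by (simp add: norm_mult norm_power mult_left_mono)
      have 3: "norm ((c - c') - of_real (\<alpha>\<^sup>2) * (a - a')) \<le> N + \<alpha>\<^sup>2 * N"
        using norm_triangle_ineq4[of "c - c'" "of_real (\<alpha>\<^sup>2) * (a - a')"] 2 n(3) by linarith
      have 4: "norm (V t * ((c - c') - of_real (\<alpha>\<^sup>2) * (a - a'))) \<le> B * (N + \<alpha>\<^sup>2 * N)"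
        unfolding norm_mult by (intro mult_mono B t 3) (use B0 in auto)
      have 5: "norm (of_real (U2 t) * (a - a')) \<le> B * N"
        unfolding norm_mult by (intro mult_mono) (use B0 B(2)[OF t] n(1) in auto)
      have "norm (V t * ((c - c') - of_real (\<alpha>\<^sup>2) * (a - a')) - of_real (U2 t) * (a - a')) \<le> B * (N + \<alpha>\<^sup>2 * N) + B * N"
        using 4 5 norm_triangle_ineq4[of "V t * ((c - c') - of_real (\<alpha>\<^sup>2) * (a - a'))" "of_real (U2 t) * (a - a')"] by linarith
      then have 6: "norm (\<i> * of_real \<beta> * (V t * ((c - c') - of_real (\<alpha>\<^sup>2) * (a - a')) - of_real (U2 t) * (a - a'))) \<le> \<bar>\<beta>\<bar> * (B * (N + \<alpha>\<^sup>2 * N) + B * N)"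
        by (simp only: norm_mult norm_of_real norm_ii mult_1) (intro mult_left_mono, auto)
      show ?thesis unfolding k_def using norm_triangle_le[OF add_mono[OF 1 6]] .
    qed
    then have kb: "norm (k t a c - k t a' c') \<le> (\<alpha>\<^sup>2 + \<bar>\<beta>\<bar> * (B * (1 + \<alpha>\<^sup>2) + B)) * N"
      unfolding kk by (simp add: algebra_simps)
    have "norm (\<Theta> t p - \<Theta> t p') = norm (b - b', c - c', z - z', k t a c - k t a' c')"
      by (simp add: \<Theta>_def p p')
    also have "\<dots> \<le> norm (b - b') + norm (c - c') + norm (z - z') + norm (k t a c - k t a' c')"
      by (rule norm_quadruple_le)
    also have "\<dots> \<le> K * N" using n kb by (simp add: K_def distrib_right)
    finally show "norm (\<Theta> t p - \<Theta> t p') \<le> K * norm (p - p')" by (simp add: N_def)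
  qed
  then obtain y where y0: "y 0 = (a, 0, c, 0)"
    and dy: "\<And>x. x \<in> {0..1} \<Longrightarrow> (y has_vector_derivative \<Theta> x (y x)) (at x within {0..1})" by blast
  define u u1 u2 z where "u x = fst (y x)" and "u1 x = fst (snd (y x))" and "u2 x = fst (snd (snd (y x)))"
    and "z x = snd (snd (snd (y x)))" for x
  have Th: "\<Theta> x (y x) = (u1 x, u2 x, z x - F x, k x (u x) (u2 x))" for x
    by (simp add: \<Theta>_def u_def u1_def u2_def z_def split_beta)
  have d: "(u has_vector_derivative u1 x) (at x within {0..1})" "(u1 has_vector_derivative u2 x) (at x within {0..1})"
    "(u2 has_vector_derivative z x - F x) (at x within {0..1})" "(z has_vector_derivative k x (u x) (u2 x)) (at x within {0..1})"
    if x: "x \<in> {0..1}" for x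
  proof -
    note D = dy[OF x, unfolded Th]
    note D1 = bounded_linear.has_vector_derivative[OF bounded_linear_snd D]
    note D2 = bounded_linear.has_vector_derivative[OF bounded_linear_snd D1]
    show "(u has_vector_derivative u1 x) (at x within {0..1})"
      using bounded_linear.has_vector_derivative[OF bounded_linear_fst D] by (simp add: u_def[abs_def])
    show "(u1 has_vector_derivative u2 x) (at x within {0..1})"
      using bounded_linear.has_vector_derivative[OF bounded_linear_fst D1] by (simp add: u1_def[abs_def])
    show "(u2 has_vector_derivative z x - F x) (at x within {0..1})"
      using bounded_linear.has_vector_derivative[OF bounded_linear_fst D2] by (simp add: u2_def[abs_def])
    show "(z has_vector_derivative k x (u x) (u2 x)) (at x within {0..1})"
      using bounded_linear.has_vector_derivative[OF bounded_linear_snd D2] by (simp add: z_def[abs_def])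
  qed
  have "ivp_solution U U2 lam \<alpha> \<beta> u u1 u2 f"
    unfolding ivp_solution_def
    by (rule exI[of _ "\<lambda>x. z x - F x"], rule exI[of _ z], rule exI[of _ "\<lambda>x. k x (u x) (u2 x)"])
       (use d y0 in \<open>auto simp: F_def k_def V_def u1_def z_def\<close>)
  moreover have "u 0 = a" "u2 0 = c" by (simp_all add: u_def u2_def y0)
  ultimately show ?thesis by blast
qed

text \<open>The fourth derivative is \<open>z' - f\<close>: a continuous function minus a square
  integrable one.\<close>

lemma ivp_solution_imp_graph:
  assumes u: "ivp_solution U U2 lam \<alpha> \<beta> u u1 u2 f" and f: "L2_01 f" and bc: "u 1 = 0" "u1 1 = 0"
  shows "Bsym_graph U U2 lam \<alpha> \<beta> u u1 f"
proof -
  obtain u3 z z' where d: "\<And>x. x \<in> {0..1} \<Longrightarrow> (u has_vector_derivative u1 x) (at x within {0..1})"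
      "\<And>x. x \<in> {0..1} \<Longrightarrow> (u1 has_vector_derivative u2 x) (at x within {0..1})"
      "\<And>x. x \<in> {0..1} \<Longrightarrow> (u2 has_vector_derivative u3 x) (at x within {0..1})"
      "\<And>x. x \<in> {0..1} \<Longrightarrow> (z has_vector_derivative z' x) (at x within {0..1})"
    and u3: "\<And>x. x \<in> {0..1} \<Longrightarrow> u3 x = z x - (LBINT t:{0..x}. f t)"
    and z': "\<And>x. x \<in> {0..1} \<Longrightarrow> z' x = of_real (\<alpha>\<^sup>2) * u2 x + \<i> * of_real \<beta> * ((of_real (U x) + \<i> * lam) * (u2 x - of_real (\<alpha>\<^sup>2) * u x)
                            - of_real (U2 x) * u x)"
    and i: "u1 0 = 0" "z 0 = 0"
    using u unfolding ivp_solution_def by blast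
  have cu: "continuous_on {0..1} u" and cu2: "continuous_on {0..1} u2"
    using vector_derivative_continuous_on[OF d(1)] vector_derivative_continuous_on[OF d(3)] by auto
  have cz': "continuous_on {0..1} z'"
    by (subst continuous_on_cong[OF refl z']) (auto intro!: continuous_intros cu cu2 cU cU2)
  have fi: "set_integrable lborel {0..1} f" by (rule L2_01_integrable[OF f])
  have z'i: "set_integrable lborel {0..1} z'" by (rule borel_integrable_atLeastAtMost'[OF cz'])
  have u30: "u3 0 = 0"
  proof -
    have "(LBINT t:{0..0}. f t) = integral {0..0} f" by (rule set_lebesgue_integral_subinterval(2)[OF fi]) simp
    then show ?thesis using u3[of 0] i by simp
  qed
  have int: "u3 x = u3 0 + (LBINT t:{0..x}. z' t - f t)" if x: "x \<in> {0..1}" for x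
  proof -
    have "(LBINT t:{0..x}. z' t - f t) = (LBINT t:{0..x}. z' t) - (LBINT t:{0..x}. f t)"
      by (rule set_integral_diff(2)[OF set_lebesgue_integral_subinterval(1)[OF z'i x] set_lebesgue_integral_subinterval(1)[OF fi x]])
    also have "(LBINT t:{0..x}. z' t) = integral {0..x} z'" by (rule set_lebesgue_integral_subinterval(2)[OF z'i x])
    also have "integral {0..x} z' = z x - z 0"
      by (rule integral_unique, rule fundamental_theorem_of_calculus)
         (use x in \<open>auto intro: has_vector_derivative_within_subset[OF d(4)]\<close>)
    finally show ?thesis using u3[OF x] u30 i by simp
  qed
  show ?thesis
    unfolding Bsym_graph_def
    by (rule exI[of _ u2], rule exI[of _ u3], rule exI[of _ "\<lambda>t. z' t - f t"])
       (use d int bc i u30 L2_01_diff[OF L2_01_continuous(1)[OF cz'] f] in \<open>auto simp: z' algebra_simps\<close>)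
qed

text \<open>The homogeneous solutions with \<open>u'(0) = u'''(0) = 0\<close> form a plane spanned
  by \<open>v\<close> and \<open>w\<close>. Injectivity makes the map from this plane to the data at
  1 invertible, and Cramer's rule corrects a particular solution \<open>p\<close>.\<close>

lemma surjective_if_injective:
  assumes inj: "\<And>u u1. Bsym_graph U U2 lam \<alpha> \<beta> u u1 (\<lambda>_. 0) \<Longrightarrow> \<forall>x\<in>{0..1}. u x = 0"
    and f: "L2_01 f"
  shows "\<exists>u u1. Bsym_graph U U2 lam \<alpha> \<beta> u u1 f"
proof -
  have L0: "L2_01 (\<lambda>_. 0)" by (rule L2_01_continuous) simp
  obtain v v1 v2 where v: "ivp_solution U U2 lam \<alpha> \<beta> v v1 v2 (\<lambda>_. 0)" "v 0 = 1" "v2 0 = 0"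
    using ivp_solution_exists[OF L0] by blast
  obtain w w1 w2 where w: "ivp_solution U U2 lam \<alpha> \<beta> w w1 w2 (\<lambda>_. 0)" "w 0 = 0" "w2 0 = 1"
    using ivp_solution_exists[OF L0] by blast
  obtain p p1 p2 where p: "ivp_solution U U2 lam \<alpha> \<beta> p p1 p2 f"
    using ivp_solution_exists[OF f] by blast
  \<comment> \<open>The coefficients are the initial values \<open>u 0\<close> and
    \<open>u2 0\<close> of the combination. Once \<open>u\<close> vanishes on [0,1], uniqueness of
    derivatives carries the zero over to \<open>u1\<close> and \<open>u2 0\<close>.\<close>
  have nz: "a = 0 \<and> b = 0" if "a * v 1 + b * w 1 = 0" "a * v1 1 + b * w1 1 = 0" for a b
  proof -
    define u where "u = (\<lambda>x. (0 + a * v x) + b * w x)"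
    define u1 where "u1 = (\<lambda>x. (0 + a * v1 x) + b * w1 x)"
    define u2 where "u2 = (\<lambda>x. (0 + a * v2 x) + b * w2 x)"
    have s: "ivp_solution U U2 lam \<alpha> \<beta> u u1 u2 (\<lambda>_. 0)"
      unfolding u_def u1_def u2_def by (intro ivp_solution_add_scaled ivp_solution_zero v w)
    have "Bsym_graph U U2 lam \<alpha> \<beta> u u1 (\<lambda>_. 0)"
      by (rule ivp_solution_imp_graph[OF s L0]) (use that in \<open>auto simp: u_def u1_def\<close>)
    then have z: "\<forall>x\<in>{0..1}. u x = 0" by (rule inj)
    have lim: "at x within {0..1} \<noteq> bot" if "x \<in> {0..1}" for x :: real
      using that by (simp add: at_within_Icc_at trivial_limit_within islimpt_Icc)
    have du: "(u has_vector_derivative u1 x) (at x within {0..1})" "(u1 has_vector_derivative u2 x) (at x within {0..1})" if "x \<in> {0..1}" for x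
      using s that unfolding ivp_solution_def by blast+
    have z1: "u1 x = 0" if x: "x \<in> {0..1}" for x
    proof -
      have "(u has_vector_derivative 0) (at x within {0..1})"
        by (rule has_vector_derivative_transform[OF x, of _ "\<lambda>_. 0"]) (use z in auto)
      then show ?thesis using vector_derivative_unique_within[OF lim[OF x] du(1)[OF x]] by simp
    qed
    have "u2 0 = 0"
    proof -
      have "(u1 has_vector_derivative 0) (at 0 within {0..1})"
        by (rule has_vector_derivative_transform[of _ _ _ "\<lambda>_. 0"]) (use z1 in auto)
      then show ?thesis using vector_derivative_unique_within[OF lim du(2), of 0 0] by simp
    qed
    then show ?thesis using z v w by (auto simp: u_def u2_def)
  qed
  define D where "D = v 1 * w1 1 - w 1 * v1 1"
  have D: "D \<noteq> 0"
  proof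
    assume D0: "D = 0"
    \<comment> \<open>If the determinant vanished, both pairs built from the cofactors would lie in
      the kernel; then all four entries are 0 and the pair (1, 1) contradicts
      \<open>nz\<close>.\<close>
    have "w1 1 = 0" "v1 1 = 0" using nz[of "w1 1" "- v1 1"] D0 by (auto simp: D_def algebra_simps)
    moreover have "w 1 = 0" "v 1 = 0" using nz[of "w 1" "- v 1"] D0 by (auto simp: D_def algebra_simps)
    ultimately show False using nz[of 1 1] by simp
  qed
  define a where "a = (w 1 * p1 1 - p 1 * w1 1) / D"
  define b where "b = (p 1 * v1 1 - v 1 * p1 1) / D"
  have s: "ivp_solution U U2 lam \<alpha> \<beta> (\<lambda>x. (p x + a * v x) + b * w x) (\<lambda>x. (p1 x + a * v1 x) + b * w1 x) (\<lambda>x. (p2 x + a * v2 x) + b * w2 x) f"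
    by (intro ivp_solution_add_scaled p v w)
  have "(p 1 + a * v 1) + b * w 1 = 0"
    using D by (simp add: a_def b_def field_simps) (simp add: D_def algebra_simps)
  moreover have "(p1 1 + a * v1 1) + b * w1 1 = 0"
    using D by (simp add: a_def b_def field_simps) (simp add: D_def algebra_simps)
  ultimately show ?thesis using ivp_solution_imp_graph[OF s f] by blast
qed

end

text \<open>Evenness forces \<open>U1 0 = 0\<close>, since near 0 the reflected profile coincides
  with \<open>U\<close> but has the opposite derivative there. The bounds come from compactness, and
  the negative supremum \<open>s\<close> of \<open>U2\<close> gives
  \<open>1 / A \<le> - s\<close>.\<close>

lemma profile_of_symmetric_concave:
  fixes U U1 U2 U3 U4 :: "real \<Rightarrow> real"
  assumes dU: "\<forall>x\<in>{-1..1}. (U has_real_derivative U1 x) (at x within {-1..1})"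
    and dU1: "\<forall>x\<in>{-1..1}. (U1 has_real_derivative U2 x) (at x within {-1..1})"
    and dU2: "\<forall>x\<in>{-1..1}. (U2 has_real_derivative U3 x) (at x within {-1..1})"
    and dU3: "\<forall>x\<in>{-1..1}. (U3 has_real_derivative U4 x) (at x within {-1..1})"
    and U1: "U 1 = 0" and neg: "(SUP x\<in>{-1..1}. U2 x) < 0" and even: "\<forall>x\<in>{-1..1}. U (-x) = U x"
  shows "\<exists>A. profile U U1 U2 U3 A"
proof -
  have sub: "{0..1::real} \<subseteq> {-1..1}" by auto
  have c2: "continuous_on {-1..1} U2" and c3: "continuous_on {-1..1} U3"
    using dU2 dU3 by (auto intro!: DERIV_continuous_on)
  obtain B where B: "\<And>x. x \<in> {-1..1} \<Longrightarrow> \<bar>U2 x\<bar> \<le> B"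
    using compact_imp_bounded[OF compact_continuous_image[OF c2 compact_Icc]] unfolding bounded_iff by fastforce
  define s where "s = (SUP x\<in>{-1..1}. U2 x)"
  have s: "U2 x \<le> s" if "x \<in> {-1..1}" for x
    unfolding s_def
  proof (rule cSUP_upper[OF that], rule bdd_aboveI2)
    fix x :: real assume "x \<in> {-1..1}"
    then show "U2 x \<le> B" using B[of x] by simp
  qed
  have s0: "s < 0" using neg by (simp add: s_def)
  have nz: "U2 x \<noteq> 0" if "x \<in> {-1..1}" for x using s[OF that] s0 by simp
  have c32: "continuous_on {-1..1} (\<lambda>x. U3 x / (U2 x)\<^sup>2)" by (intro continuous_intros c2 c3) (use nz in auto)
  obtain N where N: "\<And>x. x \<in> {-1..1} \<Longrightarrow> \<bar>U3 x / (U2 x)\<^sup>2\<bar> \<le> N"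
    using compact_imp_bounded[OF compact_continuous_image[OF c32 compact_Icc]] unfolding bounded_iff by fastforce
  define A where "A = max (max 1 (- 1 / s)) (max B N)"
  have A: "1 \<le> A" "- 1 / s \<le> A" "B \<le> A" "N \<le> A" by (auto simp: A_def)
  have "U1 0 = 0"
  proof -
    have at0: "at (0::real) within {-1..1} = at 0" by (rule at_within_interior) simp
    have d: "(U has_real_derivative U1 0) (at 0)" using dU at0 by (metis atLeastAtMost_iff neg_le_0_iff_le zero_le_one)
    have "((\<lambda>x. U (- x)) has_real_derivative - U1 0) (at 0)"
      using DERIV_mirror[of U "U1 0" 0] d by simp
    moreover have "eventually (\<lambda>x. U (- x) = U x) (nhds 0)"
      by (rule eventually_mono[OF eventually_nhds_in_open[of "{-1<..<1::real}" 0]]) (use even in auto)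
    ultimately have d': "(U has_real_derivative - U1 0) (at 0)"
      using DERIV_cong_ev[where f = "\<lambda>x. U (- x)" and g = U, OF refl _ refl] by blast
    have "U1 0 = - U1 0" by (rule DERIV_unique[OF d d'])
    then show ?thesis by simp
  qed
  moreover have "1 / A \<le> - s"
  proof -
    have "A * s \<le> - 1" by (rule neg_divide_le_eq[OF s0, THEN iffD1, OF A(2)])
    then show ?thesis using A(1) by (simp add: pos_divide_le_eq mult.commute)
  qed
  ultimately have "profile U U1 U2 U3 A"
  proof unfold_locales
    fix x :: real assume x: "x \<in> {0..1}"
    then have x1: "x \<in> {-1..1}" by auto
    show "(U has_real_derivative U1 x) (at x within {0..1})" "(U1 has_real_derivative U2 x) (at x within {0..1})"
      "(U2 has_real_derivative U3 x) (at x within {0..1})"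
      using dU dU1 dU2 x1 by (auto intro: DERIV_subset[OF _ sub])
    show "- U2 x \<le> A" using B[OF x1] A by simp
    show "\<bar>U3 x / (U2 x)\<^sup>2\<bar> \<le> A" using N[OF x1] A by linarith
    assume "1 / A \<le> - s"
    then show "1 / A \<le> - U2 x" using s[OF x1] by simp
  qed (use U1 A in \<open>auto intro: continuous_on_subset[OF c3 sub]\<close>)
  then show ?thesis by blast
qed

theorem theorem1p1:
  fixes U U1 U2 U3 U4 :: "real \<Rightarrow> real"
  assumes "\<forall>x\<in>{-1..1}. (U has_real_derivative U1 x) (at x within {-1..1})"
      and "\<forall>x\<in>{-1..1}. (U1 has_real_derivative U2 x) (at x within {-1..1})"
      and "\<forall>x\<in>{-1..1}. (U2 has_real_derivative U3 x) (at x within {-1..1})"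
      and "\<forall>x\<in>{-1..1}. (U3 has_real_derivative U4 x) (at x within {-1..1})"
      and "continuous_on {-1..1} U4"
      and "U (-1) = 0" and "U 1 = 0"
      and "(SUP x\<in>{-1..1}. U2 x) < 0"
      and "\<forall>x\<in>{-1..1}. U (-x) = U x"
      and "U1 (-1) = 1" and "U1 1 = -1"
  shows "\<exists>alphaL C Upsilon beta0::real. alphaL > 0 \<and> C > 0 \<and> Upsilon > 0 \<and> beta0 > 1 \<and>
           (\<forall>beta > beta0. \<forall>alpha lam.
              0 \<le> alpha \<and> alpha \<le> alphaL * beta powr (-1/6) \<and>
              Re lam < Upsilon * beta powr (-1/2) \<longrightarrow>
                Bsym_invertible U U2 lam alpha beta \<and>
                Bsym_inv_norm U U2 lam alpha beta + Bsym_dinv_norm U U2 lam alpha beta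
                  \<le> ereal (C * beta powr (-1/2) * ln beta))"
proof -
  obtain A where prof: "profile U U1 U2 U3 A"
    using profile_of_symmetric_concave[OF assms(1-4,7-9)] by blast
  interpret profile U U1 U2 U3 A by (rule prof)
  obtain \<alpha>L \<Upsilon> \<beta>0 K where c: "0 < \<alpha>L" "\<alpha>L \<le> 1/4" "0 < \<Upsilon>" "1 < \<beta>0" "0 < K"
    and est: "\<And>u u1 u2 u3 \<alpha> \<beta> \<mu> \<nu> \<Phi> V \<phi> \<phi>1 G H.
      orr_sommerfeld U U1 U2 U3 A u u1 u2 u3 \<alpha> \<beta> \<mu> \<nu> \<Phi> V \<phi> \<phi>1 G H \<Longrightarrow> \<beta>0 < \<beta> \<Longrightarrow>
      \<alpha>\<^sup>2 \<le> \<alpha>L\<^sup>2 * \<beta> powr (-1/3) \<Longrightarrow> \<mu> < \<Upsilon> * \<beta> powr (-1/2) \<Longrightarrow> \<beta> * (nrm u1)\<^sup>2 \<le> K * \<Phi>\<^sup>2"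
    using a_priori_estimate[OF prof] by metis
  have main: "Bsym_invertible U U2 lam \<alpha> \<beta> \<and>
      Bsym_inv_norm U U2 lam \<alpha> \<beta> + Bsym_dinv_norm U U2 lam \<alpha> \<beta> \<le> ereal (2 * sqrt K * \<beta> powr (-1/2) * ln \<beta>)"
    \<comment> \<open>The threshold 3 exceeds e, so that \<open>ln \<beta> \<ge> 1\<close>.\<close>
    if \<beta>: "max \<beta>0 3 < \<beta>" and \<alpha>: "0 \<le> \<alpha>" "\<alpha> \<le> \<alpha>L * \<beta> powr (-1/6)" and lam: "Re lam < \<Upsilon> * \<beta> powr (-1/2)"
    for \<alpha> \<beta> lam
  proof -
    have \<beta>3: "3 < \<beta>" "\<beta>0 < \<beta>" using \<beta> by auto
    have \<alpha>2: "\<alpha>\<^sup>2 \<le> \<alpha>L\<^sup>2 * \<beta> powr (-1/3)"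
    proof -
      have "\<alpha>\<^sup>2 \<le> (\<alpha>L * \<beta> powr (-1/6))\<^sup>2" using \<alpha> by (intro power_mono)
      also have "\<dots> = \<alpha>L\<^sup>2 * (\<beta> powr (-1/6) * \<beta> powr (-1/6))" by (simp add: power2_eq_square)
      also have "\<beta> powr (-1/6) * \<beta> powr (-1/6) = \<beta> powr (-1/3)" by (simp flip: powr_add)
      finally show ?thesis .
    qed
    have \<alpha>half: "\<alpha>\<^sup>2 \<le> 1/2"
    proof -
      have "\<beta> powr (-1/6) \<le> 1" using powr_mono[of "-1/6" 0 \<beta>] \<beta>3 by simp
      then have "\<alpha>L * \<beta> powr (-1/6) \<le> 1/4 * 1" using c by (intro mult_mono) auto
      then have "\<alpha>\<^sup>2 \<le> (1/4)\<^sup>2" using \<alpha> by (intro power_mono) auto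
      then show ?thesis by (simp add: power2_eq_square)
    qed
    \<comment> \<open>One bound for both norms, because \<open>nrm u \<le> nrm u1\<close>; their sum
      explains the factor 2 in the final constant.\<close>
    define r where "r = sqrt K * \<beta> powr (-1/2)"
    have r2: "r\<^sup>2 * \<beta> = K"
    proof -
      have "r\<^sup>2 = K * (\<beta> powr (-1/2) * \<beta> powr (-1/2))" using c by (simp add: r_def power_mult_distrib power2_eq_square)
      also have "\<beta> powr (-1/2) * \<beta> powr (-1/2) = \<beta> powr (-1)" by (simp flip: powr_add)
      finally show ?thesis using \<beta>3 by (simp add: powr_minus)
    qed
    have r0: "0 < r" using c \<beta>3 by (simp add: r_def)
    have bound: "nrm u1 \<le> r * L2norm_01 f \<and> nrm u \<le> nrm u1 \<and> (\<forall>x\<in>{0..1}. cmod (u x) \<le> nrm u1)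
        \<and> continuous_on {0..1} u \<and> continuous_on {0..1} u1"
      if g: "Bsym_graph U U2 lam \<alpha> \<beta> u u1 f" and f: "L2_01 f" for u u1 f
    proof -
      obtain u2 u3 V \<phi> \<phi>1 G H where os: "orr_sommerfeld U U1 U2 U3 A u u1 u2 u3 \<alpha> \<beta> (Re lam) (Im lam) (L2norm_01 f) V \<phi> \<phi>1 G H"
        using graph_imp_orr_sommerfeld[OF g f _ \<alpha>half] \<beta>3 by auto
      have "\<beta> * (nrm u1)\<^sup>2 \<le> K * (L2norm_01 f)\<^sup>2" by (rule est[OF os \<beta>3(2) \<alpha>2 lam])
      also have "\<dots> = \<beta> * (r * L2norm_01 f)\<^sup>2" using r2 by (simp add: power_mult_distrib mult_ac)
      finally have "(nrm u1)\<^sup>2 \<le> (r * L2norm_01 f)\<^sup>2" using \<beta>3 by simp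
      then have "nrm u1 \<le> r * L2norm_01 f"
        by (rule power2_le_imp_le) (use r0 L2norm_01_nonneg in simp)
      then show ?thesis using orr_sommerfeld.nrm_u_le[OF os] orr_sommerfeld.u_le_nrm_u1[OF os] orr_sommerfeld.cu[OF os] orr_sommerfeld.cu1[OF os] by blast
    qed
    have inj: "\<forall>x\<in>{0..1}. u x = 0" if g: "Bsym_graph U U2 lam \<alpha> \<beta> u u1 (\<lambda>_. 0)" for u u1
    proof -
      have "L2_01 (\<lambda>_. 0)" by (rule L2_01_continuous) simp
      moreover have "L2norm_01 (\<lambda>_. 0) = 0" by (simp add: L2norm_01_def set_lebesgue_integral_def)
      ultimately have "nrm u1 \<le> 0" "\<forall>x\<in>{0..1}. cmod (u x) \<le> nrm u1" using bound[OF g] by auto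
      then show ?thesis using order_trans[OF _ \<open>nrm u1 \<le> 0\<close>] norm_le_zero_iff by blast
    qed
    have inv: "Bsym_invertible U U2 lam \<alpha> \<beta>"
      unfolding Bsym_invertible_def
    proof (intro conjI allI impI)
      show "\<exists>u u1. Bsym_graph U U2 lam \<alpha> \<beta> u u1 f" if "L2_01 f" for f
        by (rule surjective_if_injective[OF _ that]) (rule inj)
      show "\<forall>x\<in>{0..1}. u x = 0" if "Bsym_graph U U2 lam \<alpha> \<beta> u u1 (\<lambda>_. 0)" for u u1
        by (rule inj[OF that])
    qed
    have n1: "Bsym_inv_norm U U2 lam \<alpha> \<beta> \<le> ereal r"
      unfolding Bsym_inv_norm_def
    proof (rule Sup_least, clarify)
      fix u u1 f assume g: "Bsym_graph U U2 lam \<alpha> \<beta> u u1 f" and f: "L2_01 f" and nz: "L2norm_01 f \<noteq> 0"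
      have p: "0 < L2norm_01 f" using nz L2norm_01_nonneg[of f] by simp
      have "L2norm_01 u \<le> r * L2norm_01 f" using bound[OF g f] by (simp add: L2_01_continuous(2))
      then show "ereal (L2norm_01 u / L2norm_01 f) \<le> ereal r" using p by (simp add: pos_divide_le_eq)
    qed
    have n2: "Bsym_dinv_norm U U2 lam \<alpha> \<beta> \<le> ereal r"
      unfolding Bsym_dinv_norm_def
    proof (rule Sup_least, clarify)
      fix u u1 f assume g: "Bsym_graph U U2 lam \<alpha> \<beta> u u1 f" and f: "L2_01 f" and nz: "L2norm_01 f \<noteq> 0"
      have p: "0 < L2norm_01 f" using nz L2norm_01_nonneg[of f] by simp
      have "L2norm_01 u1 \<le> r * L2norm_01 f" using bound[OF g f] by (simp add: L2_01_continuous(2))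
      then show "ereal (L2norm_01 u1 / L2norm_01 f) \<le> ereal r" using p by (simp add: pos_divide_le_eq)
    qed
    have "1 \<le> ln \<beta>"
    proof -
      have "exp 1 \<le> \<beta>" using exp_le \<beta>3 by linarith
      then show ?thesis using \<beta>3 by (simp add: ln_ge_iff)
    qed
    \<comment> \<open>The estimate is of order \<beta>^(-1/2); multiplying by
      \<open>ln \<beta> \<ge> 1\<close> only enlarges the bound.\<close>
    then have "2 * r * 1 \<le> 2 * r * ln \<beta>" using r0 by (intro mult_left_mono) auto
    then have "ereal r + ereal r \<le> ereal (2 * sqrt K * \<beta> powr (-1/2) * ln \<beta>)" by (simp add: r_def mult_ac)
    then show ?thesis using inv add_mono[OF n1 n2] order_trans by blast
  qed
  show ?thesis
    by (rule exI[of _ \<alpha>L], rule exI[of _ "2 * sqrt K"], rule exI[of _ \<Upsilon>], rule exI[of _ "max \<beta>0 3"])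
       (use c main in auto)
qed

end
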